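(* Let $\mathcal{K}$ be a field, $\Gamma\leq\Gamma'\leq\mathbb{R}$ additive subgroups, $\Lambda=\Lambda^{\mathcal{K},\Gamma}$, and let $(C_*,\partial,\ell)$ be a Floer-type complex over $\Lambda$. Consider the Floer-type complex $(C'_*,\partial\otimes 1,\ell')$ over $\Lambda^{\mathcal{K},\Gamma'}$ obtained by extension of coefficients, $C'_k=C_k\otimes_\Lambda\Lambda^{\mathcal{K},\Gamma'}$. Let $\tilde{\mathcal{B}}_{C,k}$ be the verbose barcode of $(C_*,\partial,\ell)$ in degree $k$ and let $\pi\colon\mathbb{R}/\Gamma\to\mathbb{R}/\Gamma'$ be the projection. Then the verbose barcode of $(C'_*,\partial\otimes 1,\ell')$ in degree $k$ is the multiset $$\{(\pi([a]),L)\mid([a],L)\in\tilde{\mathcal{B}}_{C,k}\}.$$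
   Context: **Novikov field.** For an additive subgroup $\Gamma\leq\mathbb{R}$, $\Lambda^{\mathcal{K},\Gamma}$ is the field of formal sums $\sum_{g\in\Gamma}a_gT^g$ with $a_g\in\mathcal{K}$ such that for every $C\in\mathbb{R}$ only finitely many $g<C$ have $a_g\neq 0$, with power-series addition and multiplication. Its valuation is $\nu(\sum a_gT^g)=\min\{g\mid a_g\neq 0\}$, $\nu(0)=\infty$. For $\Gamma\leq\Gamma'$ there is an obvious field extension $\Lambda^{\mathcal{K},\Gamma}\hookrightarrow\Lambda^{\mathcal{K},\Gamma'}$. **Orthogonalizable spaces.** A non-Archimedean normed vector space over $\Lambda=\Lambda^{\mathcal{K},\Gamma}$ is a pair $(C,\ell)$ with $C$ a $\Lambda$-vector space and $\ell\colon C\to\mathbb{R}\cup\{-\infty\}$ satisfying: $\ell(x)=-\infty$ iff $x=0$; $\ell(\lambda x)=\ell(x)-\nu(\lambda)$; $\ell(x+y)\leq\max\{\ell(x),\ell(y)\}$. A finite ordered collection $(w_1,\dots,w_r)$ in $C$ is orthogonal if $\ell(\sum_i\lambda_iw_i)=\max_i\ell(\lambda_iw_i)$ for all $\lambda_i\in\Lambda$. An orthogonalizable $\Lambda$-space is a finite-dimensional non-Archimedean normed vector space admitting an orthogonal basis; subspaces (with restricted $\ell$) are again orthogonalizable. **Singular value decomposition.** Let $A\colon C\to D$ be a $\Lambda$-linear map of rank $r$ between orthogonalizable $\Lambda$-spaces. A singular value decomposition of $A$ is a choice of orthogonal ordered bases $(y_1,\dots,y_n)$ for $C$ and $(x_1,\dots,x_m)$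 for $D$ such that: $(y_{r+1},\dots,y_n)$ is an orthogonal ordered basis for $\ker A$; $(x_1,\dots,x_r)$ is an orthogonal ordered basis for $\mathrm{Im}\,A$; $Ay_i=x_i$ for $i\leq r$; $\ell_C(y_1)-\ell_D(x_1)\geq\cdots\geq\ell_C(y_r)-\ell_D(x_r)$. **Floer-type complex.** $(C_*,\partial,\ell)$ over $\Lambda$ is a chain complex $C_*=\bigoplus_{k\in\mathbb{Z}}C_k$ of $\Lambda$-vector spaces ($\partial C_k\subset C_{k-1}$, $\partial_k=\partial|_{C_k}$) with a function $\ell$ such that each $(C_k,\ell|_{C_k})$ is orthogonalizable and $\ell(\partial x)\leq\ell(x)$ for $x\in C_k$. **Verbose barcode.** From a singular value decomposition $((y_1,\dots,y_n),(x_1,\dots,x_m))$ of $\partial_{k+1}\colon C_{k+1}\to\ker\partial_k$, with $r=\mathrm{rank}\,\partial_{k+1}$, the degree-$k$ verbose barcode is the multiset of elements of $(\mathbb{R}/\Gamma)\times[0,\infty]$ consisting of $(\ell(x_i)\bmod\Gamma,\ell(y_i)-\ell(x_i))$ for $i=1,\dots,r$ and $(\ell(x_i)\bmod\Gamma,\infty)$ for $i=r+1,\dots,m$. It does not depend on the choice of singular value decomposition. **Coefficient extension.** The filtration $\ell'$ on $C'_k=C_k\otimes_\Lambda\Lambda^{\mathcal{K},\Gamma'}$ is defined by choosing an orthogonal ordered basis $(w_1,\dots,w_n)$ of $C_k$ and setting $\ell'(\sum_i\lambda'_i\,w_i\otimes 1)=\max_i(\ell(w_i)-\nu(\lambda'_i))$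 for $\lambda'_i\in\Lambda^{\mathcal{K},\Gamma'}$; it is independent of the chosen orthogonal basis. *)

theory Defs
  imports
    "HOL-Library.Extended_Real"
    "HOL-Library.Multiset"
    "HOL-Algebra.Free_Abelian_Groups"
    "Jordan_Normal_Form.Missing_VectorSpace"
begin

section \<open>Novikov fields\<close>

abbreviation real_group :: "real monoid" where
  "real_group \<equiv> \<lparr>carrier = UNIV, monoid.mult = (+), one = 0\<rparr>"

text \<open>
  The formal sum of the \<open>a\<^sub>g T\<^sup>g\<close> is its coefficient function \<open>a\<close> on the reals, supported in
  \<open>\<Gamma>\<close>. The operations do not mention \<open>\<Gamma>\<close>, so for \<open>\<Gamma> \<subseteq> \<Gamma>'\<close> the field extension is the
  inclusion of carriers. The index set of the convolution is finite for elements of the carrier.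
\<close>

definition novikov :: "real set \<Rightarrow> (real \<Rightarrow> 'k::field) ring" where
  "novikov \<Gamma> =
    \<lparr>carrier = {a. (\<forall>g. a g \<noteq> 0 \<longrightarrow> g \<in> \<Gamma>) \<and> (\<forall>C. finite {g. g < C \<and> a g \<noteq> 0})},
     monoid.mult = (\<lambda>a b g. \<Sum>h\<in>{h. a h \<noteq> 0 \<and> b (g - h) \<noteq> 0}. a h * b (g - h)),
     one = (\<lambda>g. if g = 0 then 1 else 0),
     zero = (\<lambda>g. 0),
     add = (\<lambda>a b g. a g + b g)\<rparr>"

definition nov_val :: "(real \<Rightarrow> 'k::field) \<Rightarrow> ereal" where
  "nov_val a = (if a = (\<lambda>g. 0) then \<infinity> else ereal (LEAST g. a g \<noteq> 0))"


section \<open>Orthogonalizable spaces\<close>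

locale nonarch_normed_space =
  vectorspace "novikov \<Gamma>" C
  for \<Gamma> :: "real set" and C :: "(real \<Rightarrow> 'k::field, 'c, 'd) module_scheme" +
  fixes \<l> :: "'c \<Rightarrow> ereal"
  assumes level_not_PInfty: "x \<in> carrier C \<Longrightarrow> \<l> x \<noteq> \<infinity>"
    and level_eq_MInfty_iff: "x \<in> carrier C \<Longrightarrow> \<l> x = -\<infinity> \<longleftrightarrow> x = \<zero>\<^bsub>C\<^esub>"
    and level_smult: "a \<in> carrier (novikov \<Gamma>) \<Longrightarrow> x \<in> carrier C \<Longrightarrow>
      \<l> (a \<odot>\<^bsub>C\<^esub> x) = \<l> x - nov_val a"
    and level_add: "x \<in> carrier C \<Longrightarrow> y \<in> carrier C \<Longrightarrow> \<l> (x \<oplus>\<^bsub>C\<^esub> y) \<le> max (\<l> x) (\<l> y)"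

text \<open>
  The supremum over the finite index set is a maximum; for the empty collection it is \<open>-\<infinity>\<close>,
  the level of \<open>0\<close>.
\<close>

definition orthogonal ::
  "real set \<Rightarrow> (real \<Rightarrow> 'k::field, 'c, 'd) module_scheme \<Rightarrow> ('c \<Rightarrow> ereal) \<Rightarrow> 'c list \<Rightarrow> bool" where
  "orthogonal \<Gamma> C \<l> ws \<longleftrightarrow> set ws \<subseteq> carrier C \<and>
    (\<forall>a \<in> {..<length ws} \<rightarrow> carrier (novikov \<Gamma>).
      \<l> (\<Oplus>\<^bsub>C\<^esub>i\<in>{..<length ws}. a i \<odot>\<^bsub>C\<^esub> (ws ! i)) =
      (SUP i\<in>{..<length ws}. \<l> (a i \<odot>\<^bsub>C\<^esub> (ws ! i))))"

definition orthogonal_basis ::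
  "real set \<Rightarrow> (real \<Rightarrow> 'k::field, 'c, 'd) module_scheme \<Rightarrow> ('c \<Rightarrow> ereal) \<Rightarrow> 'c list \<Rightarrow> bool" where
  "orthogonal_basis \<Gamma> C \<l> ws \<longleftrightarrow>
    distinct ws \<and> vectorspace.basis (novikov \<Gamma>) C (set ws) \<and> orthogonal \<Gamma> C \<l> ws"

definition orthogonalizable ::
  "real set \<Rightarrow> (real \<Rightarrow> 'k::field, 'c, 'd) module_scheme \<Rightarrow> ('c \<Rightarrow> ereal) \<Rightarrow> bool" where
  "orthogonalizable \<Gamma> C \<l> \<longleftrightarrow>
    nonarch_normed_space \<Gamma> C \<l> \<and> vectorspace.fin_dim (novikov \<Gamma>) C \<and>
    (\<exists>ws. orthogonal_basis \<Gamma> C \<l> ws)"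


section \<open>Singular value decompositions\<close>

definition rank_of ::
  "real set \<Rightarrow> (real \<Rightarrow> 'k::field, 'c) module \<Rightarrow> (real \<Rightarrow> 'k, 'd) module \<Rightarrow> ('c \<Rightarrow> 'd) \<Rightarrow> nat" where
  "rank_of \<Gamma> C D A = vectorspace.dim (novikov \<Gamma>) (D\<lparr>carrier := mod_hom.im C A\<rparr>)"

text \<open>Lists are indexed from \<open>0\<close>, so the first \<open>r\<close> entries are those at the indices \<open>i < r\<close>.\<close>

definition is_svd ::
  "real set \<Rightarrow> (real \<Rightarrow> 'k::field, 'c) module \<Rightarrow> ('c \<Rightarrow> ereal) \<Rightarrow>
   (real \<Rightarrow> 'k, 'd) module \<Rightarrow> ('d \<Rightarrow> ereal) \<Rightarrow> ('c \<Rightarrow> 'd) \<Rightarrow> 'c list \<Rightarrow> 'd list \<Rightarrow> bool" where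
  "is_svd \<Gamma> C \<l>C D \<l>D A ys xs \<longleftrightarrow>
    (let r = rank_of \<Gamma> C D A in
      orthogonal_basis \<Gamma> C \<l>C ys \<and>
      orthogonal_basis \<Gamma> D \<l>D xs \<and>
      orthogonal_basis \<Gamma> (C\<lparr>carrier := mod_hom.ker C D A\<rparr>) \<l>C (drop r ys) \<and>
      orthogonal_basis \<Gamma> (D\<lparr>carrier := mod_hom.im C A\<rparr>) \<l>D (take r xs) \<and>
      (\<forall>i<r. A (ys ! i) = xs ! i) \<and>
      (\<forall>i j. i \<le> j \<longrightarrow> j < r \<longrightarrow>
        \<l>C (ys ! j) - \<l>D (xs ! j) \<le> \<l>C (ys ! i) - \<l>D (xs ! i)))"


section \<open>Floer-type complexes and their verbose barcodes\<close>

record ('k, 'c) filtered_complex =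
  chains :: "int \<Rightarrow> (real \<Rightarrow> 'k, 'c) module"
  bdry :: "int \<Rightarrow> 'c \<Rightarrow> 'c"
  filt :: "int \<Rightarrow> 'c \<Rightarrow> ereal"

locale floer_complex =
  fixes \<Gamma> :: "real set" and F :: "('k::field, 'c) filtered_complex"
  assumes chains_orthogonalizable: "orthogonalizable \<Gamma> (chains F k) (filt F k)"
    and bdry_linear: "linear_map (novikov \<Gamma>) (chains F k) (chains F (k - 1)) (bdry F k)"
    and bdry_bdry: "x \<in> carrier (chains F k) \<Longrightarrow>
      bdry F (k - 1) (bdry F k x) = \<zero>\<^bsub>chains F (k - 2)\<^esub>"
    and bdry_filt: "x \<in> carrier (chains F k) \<Longrightarrow> filt F (k - 1) (bdry F k x) \<le> filt F k x"

definition cycles :: "('k, 'c) filtered_complex \<Rightarrow> int \<Rightarrow> (real \<Rightarrow> 'k, 'c) module" where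
  "cycles F k =
    (chains F k)\<lparr>carrier := mod_hom.ker (chains F k) (chains F (k - 1)) (bdry F k)\<rparr>"

text \<open>
  Elements of \<open>\<real>/\<Gamma>\<close> are the cosets of \<open>\<Gamma>\<close>. The bars at the indices \<open>i < r\<close> are finite, where
  \<open>r\<close> is the rank of the boundary map into the cycles; \<open>ys\<close> lives in degree \<open>k + 1\<close>, \<open>xs\<close> in
  degree \<open>k\<close>.
\<close>

definition svd_barcode ::
  "real set \<Rightarrow> ('k::field, 'c) filtered_complex \<Rightarrow> int \<Rightarrow> 'c list \<Rightarrow> 'c list \<Rightarrow>
   (real set \<times> ereal) multiset" where
  "svd_barcode \<Gamma> F k ys xs =
    (let r = rank_of \<Gamma> (chains F (k + 1)) (cycles F k) (bdry F (k + 1)) in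
      mset (map (\<lambda>i. (\<Gamma> #>\<^bsub>real_group\<^esub> real_of_ereal (filt F k (xs ! i)),
                      if i < r then filt F (k + 1) (ys ! i) - filt F k (xs ! i) else \<infinity>))
                [0..<length xs]))"

definition verbose_barcode ::
  "real set \<Rightarrow> ('k::field, 'c) filtered_complex \<Rightarrow> int \<Rightarrow> (real set \<times> ereal) multiset" where
  "verbose_barcode \<Gamma> F k =
    (THE B. \<exists>ys xs. is_svd \<Gamma> (chains F (k + 1)) (filt F (k + 1)) (cycles F k) (filt F k)
                      (bdry F (k + 1)) ys xs \<and>
                    B = svd_barcode \<Gamma> F k ys xs)"


section \<open>Extension of coefficients\<close>

text \<open>
  For a ring extension \<open>R \<subseteq> S\<close> with the operations of \<open>S\<close> restricting to those of \<open>R\<close>, the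
  tensor product \<open>M \<otimes>\<^sub>R S\<close> is the free abelian group on \<open>M \<times> S\<close> modulo the usual relations.
  Maps out of it are given on representatives; the union over the representatives of a class
  is a union of copies of one and the same coset.
\<close>

abbreviation tensor_free ::
  "'a ring \<Rightarrow> ('a, 'c) module \<Rightarrow> ('c \<times> 'a \<Rightarrow>\<^sub>0 int) monoid" where
  "tensor_free S M \<equiv> free_Abelian_group (carrier M \<times> carrier S)"

definition tensor_rel ::
  "'a ring \<Rightarrow> 'a ring \<Rightarrow> ('a, 'c) module \<Rightarrow> ('c \<times> 'a \<Rightarrow>\<^sub>0 int) set" where
  "tensor_rel R S M = generate (tensor_free S M)
    ({frag_of (x \<oplus>\<^bsub>M\<^esub> y, a) - frag_of (x, a) - frag_of (y, a) | x y a.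
        x \<in> carrier M \<and> y \<in> carrier M \<and> a \<in> carrier S} \<union>
     {frag_of (x, a \<oplus>\<^bsub>S\<^esub> b) - frag_of (x, a) - frag_of (x, b) | x a b.
        x \<in> carrier M \<and> a \<in> carrier S \<and> b \<in> carrier S} \<union>
     {frag_of (c \<odot>\<^bsub>M\<^esub> x, a) - frag_of (x, c \<otimes>\<^bsub>S\<^esub> a) | c x a.
        c \<in> carrier R \<and> x \<in> carrier M \<and> a \<in> carrier S})"

definition tensor_class ::
  "'a ring \<Rightarrow> 'a ring \<Rightarrow> ('a, 'c) module \<Rightarrow> ('c \<times> 'a \<Rightarrow>\<^sub>0 int) \<Rightarrow> ('c \<times> 'a \<Rightarrow>\<^sub>0 int) set" where
  "tensor_class R S M z = tensor_rel R S M #>\<^bsub>tensor_free S M\<^esub> z"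

text \<open>The fields \<open>mult\<close> and \<open>one\<close> of the record carry no meaning for a module.\<close>

definition extend_scalars ::
  "'a ring \<Rightarrow> 'a ring \<Rightarrow> ('a, 'c) module \<Rightarrow> ('a, ('c \<times> 'a \<Rightarrow>\<^sub>0 int) set) module" where
  "extend_scalars R S M =
    \<lparr>carrier = carrier (tensor_free S M Mod tensor_rel R S M),
     monoid.mult = (\<lambda>X Y. tensor_rel R S M),
     one = tensor_rel R S M,
     zero = \<one>\<^bsub>tensor_free S M Mod tensor_rel R S M\<^esub>,
     add = (\<lambda>X Y. X \<otimes>\<^bsub>tensor_free S M Mod tensor_rel R S M\<^esub> Y),
     smult = (\<lambda>s X. \<Union>z\<in>X. tensor_class R S M
       (frag_extend (\<lambda>(x, a). frag_of (x, s \<otimes>\<^bsub>S\<^esub> a)) z))\<rparr>"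

definition extend_map ::
  "'a ring \<Rightarrow> 'a ring \<Rightarrow> ('a, 'd) module \<Rightarrow> ('c \<Rightarrow> 'd) \<Rightarrow>
   ('c \<times> 'a \<Rightarrow>\<^sub>0 int) set \<Rightarrow> ('d \<times> 'a \<Rightarrow>\<^sub>0 int) set" where
  "extend_map R S N f X =
    (\<Union>z\<in>X. tensor_class R S N (frag_extend (\<lambda>(x, a). frag_of (f x, a)) z))"

definition extend_filt ::
  "real set \<Rightarrow> real set \<Rightarrow> (real \<Rightarrow> 'k::field, 'c) module \<Rightarrow> ('c \<Rightarrow> ereal) \<Rightarrow>
   ('c \<times> (real \<Rightarrow> 'k) \<Rightarrow>\<^sub>0 int) set \<Rightarrow> ereal" where
  "extend_filt \<Gamma> \<Gamma>' C \<l> v =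
    (let R = novikov \<Gamma>; S = novikov \<Gamma>'; C' = extend_scalars R S C;
         ws = (SOME ws. orthogonal_basis \<Gamma> C \<l> ws)
     in THE s. \<exists>a \<in> {..<length ws} \<rightarrow> carrier S.
          v = (\<Oplus>\<^bsub>C'\<^esub>i\<in>{..<length ws}.
                 a i \<odot>\<^bsub>C'\<^esub> tensor_class R S C (frag_of (ws ! i, \<one>\<^bsub>S\<^esub>))) \<and>
          s = (SUP i\<in>{..<length ws}. \<l> (ws ! i) - nov_val (a i)))"

definition extend_complex ::
  "real set \<Rightarrow> real set \<Rightarrow> ('k::field, 'c) filtered_complex \<Rightarrow>
   ('k, ('c \<times> (real \<Rightarrow> 'k) \<Rightarrow>\<^sub>0 int) set) filtered_complex" where
  "extend_complex \<Gamma> \<Gamma>' F =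
    \<lparr>chains = (\<lambda>k. extend_scalars (novikov \<Gamma>) (novikov \<Gamma>') (chains F k)),
     bdry = (\<lambda>k. extend_map (novikov \<Gamma>) (novikov \<Gamma>') (chains F (k - 1)) (bdry F k)),
     filt = (\<lambda>k. extend_filt \<Gamma> \<Gamma>' (chains F k) (filt F k))\<rparr>"

text \<open>The projection \<open>\<real>/\<Gamma> \<rightarrow> \<real>/\<Gamma>'\<close>, with target group \<open>\<Gamma>'\<close>: it sends \<open>\<Gamma> + a\<close> to \<open>\<Gamma>' + a\<close>.\<close>

definition coset_proj :: "real set \<Rightarrow> real set \<Rightarrow> real set" where
  "coset_proj \<Gamma>' X = \<Gamma>' <#>\<^bsub>real_group\<^esub> X"

end

theory Submission
  imports Defs
begin

text \<open>
  Gaussian elimination with a pivot of minimal gap \<open>\<l>(y\<^sub>j) - \<l>(B\<^sub>j\<^sub>i x\<^sub>i)\<close> in the matrix \<open>B\<close> of a linear map keeps both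
  bases orthogonal, so singular value decompositions exist. The barcode does not depend on the
  decomposition: the number of bars over the coset of \<open>a\<close> of length at most \<open>L\<close> is the dimension over
  the ground field of \<open>{v. \<l>(v) \<le> a} \<inter> A {u. \<l>(u) \<le> a + L}\<close> modulo the vectors of level below \<open>a\<close>. An orthogonal
  basis \<open>w\<^sub>i\<close> yields the orthogonal basis \<open>w\<^sub>i \<otimes> 1\<close> of the extended space at the same levels, so a
  decomposition of the boundary map of \<open>C\<close> becomes one of the extended boundary map. The target of
  the latter is the kernel of an extended map; it is controlled by completing an orthogonal basis of
  the cycles to one of the chains.
\<close>

section \<open>The Novikov field\<close>

text \<open>Since \<open>verbose_barcode\<close> is a definite description, exhibiting one
  decomposition over the large field proves nothing until uniqueness is known there too. The
  invariant behind uniqueness reads coefficients at single exponents: modulo lower level, a vector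
  of level at most \<open>a\<close> is determined by the coefficient of each basis vector at the one
  exponent that shifts this basis vector to level \<open>a\<close>. Only exponents in \<Gamma>
  occur, which is where the cosets come from. The transport meets an obstacle in the target space.
  The cycles of the extended complex are the kernel of \<open>\<partial> \<otimes> 1\<close> inside
  \<open>C_k \<otimes> \<Lambda>'\<close>, whereas extending the scalars of the cycles of
  \<open>C\<close> gives a quotient of another free group. The two are never compared: the cycle
  vectors of the decomposition are made the tail of a basis of \<open>C_k\<close> adapted to the
  boundary map in degree \<open>k\<close>, and the extension of this second decomposition shows that
  the tail spans the extended kernel.\<close>

lemma group_real_group: "group real_group"
  by (rule groupI) (auto intro: exI[of _ "- x" for x])

lemma inv_real_group: "inv\<^bsub>real_group\<^esub> x = - x"
  by (rule group.inv_equality[OF group_real_group]) auto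

lemma subgroup_real_group_zero: "subgroup \<Gamma> real_group \<Longrightarrow> 0 \<in> \<Gamma>"
  using subgroup.one_closed by fastforce

lemma subgroup_real_group_add: "subgroup \<Gamma> real_group \<Longrightarrow> x \<in> \<Gamma> \<Longrightarrow> y \<in> \<Gamma> \<Longrightarrow> x + y \<in> \<Gamma>"
  using subgroup.m_closed by fastforce

lemma subgroup_real_group_uminus: "subgroup \<Gamma> real_group \<Longrightarrow> x \<in> \<Gamma> \<Longrightarrow> - x \<in> \<Gamma>"
  using subgroup.m_inv_closed[of \<Gamma> real_group x] by (simp add: inv_real_group)

lemma subgroup_real_group_diff: "subgroup \<Gamma> real_group \<Longrightarrow> x \<in> \<Gamma> \<Longrightarrow> y \<in> \<Gamma> \<Longrightarrow> x - y \<in> \<Gamma>"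
  using subgroup_real_group_add[of \<Gamma> x "- y"] subgroup_real_group_uminus by simp

text \<open>Kept apart from the condition that exponents lie in \<Gamma>, so that convolution is
  studied once for all groups of exponents.\<close>

definition left_finite :: "(real \<Rightarrow> 'k::zero) \<Rightarrow> bool" where
  "left_finite a \<longleftrightarrow> (\<forall>C. finite {g. g < C \<and> a g \<noteq> 0})"

definition convolution :: "(real \<Rightarrow> 'k::field) \<Rightarrow> (real \<Rightarrow> 'k) \<Rightarrow> real \<Rightarrow> 'k" where
  "convolution a b g = (\<Sum>h\<in>{h. a h \<noteq> 0 \<and> b (g - h) \<noteq> 0}. a h * b (g - h))"

lemma carrier_novikov_iff:
  "a \<in> carrier (novikov \<Gamma>) \<longleftrightarrow> (\<forall>g. a g \<noteq> 0 \<longrightarrow> g \<in> \<Gamma>) \<and> left_finite a"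
  by (auto simp: novikov_def left_finite_def)

lemma mult_novikov [simp]: "a \<otimes>\<^bsub>novikov \<Gamma>\<^esub> b = convolution a b"
  by (simp add: novikov_def convolution_def fun_eq_iff)

lemma one_novikov: "\<one>\<^bsub>novikov \<Gamma>\<^esub> = (\<lambda>g. if g = 0 then 1 else 0)"
  by (simp add: novikov_def)

lemma zero_novikov [simp]: "\<zero>\<^bsub>novikov \<Gamma>\<^esub> = (\<lambda>g. 0)"
  by (simp add: novikov_def)

lemma add_novikov [simp]: "a \<oplus>\<^bsub>novikov \<Gamma>\<^esub> b = (\<lambda>g. a g + b g)"
  by (simp add: novikov_def)

lemma left_finite_finite_le: "left_finite a \<Longrightarrow> finite {g. a g \<noteq> 0 \<and> g \<le> C}"
  by (rule finite_subset[of _ "{g. g < C + 1 \<and> a g \<noteq> 0}"]) (auto simp: left_finite_def)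

text \<open>The support may be infinite, so its minimum is sought among the finitely many exponents
  up to the given \<open>g\<^sub>1\<close>; those beyond \<open>g\<^sub>1\<close> are larger
  anyway.\<close>

lemma left_finite_least:
  assumes "left_finite a" "a g\<^sub>1 \<noteq> 0"
  obtains g\<^sub>0 where "a g\<^sub>0 \<noteq> 0" "\<And>g. a g \<noteq> 0 \<Longrightarrow> g\<^sub>0 \<le> g"
proof
  let ?S = "{g. a g \<noteq> 0 \<and> g \<le> g\<^sub>1}"
  have fin: "finite ?S" and ne: "?S \<noteq> {}"
    using assms left_finite_finite_le by auto
  from Min_in[OF this] show "a (Min ?S) \<noteq> 0" by auto
  show "Min ?S \<le> g" if "a g \<noteq> 0" for g
  proof (cases "g \<le> g\<^sub>1")
    case True
    with fin that show ?thesis by auto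
  next
    case False
    with Min_in[OF fin ne] show ?thesis by auto
  qed
qed

lemma left_finite_bounded_below:
  assumes "left_finite a"
  obtains \<alpha> where "\<And>g. a g \<noteq> 0 \<Longrightarrow> \<alpha> \<le> g"
  using left_finite_least[OF assms] by metis

lemma left_finite_add:
  fixes a b :: "real \<Rightarrow> 'k::field"
  shows "left_finite a \<Longrightarrow> left_finite b \<Longrightarrow> left_finite (\<lambda>g. a g + b g)"
  unfolding left_finite_def
proof
  fix C assume *: "\<forall>C. finite {g. g < C \<and> a g \<noteq> 0}" "\<forall>C. finite {g. g < C \<and> b g \<noteq> 0}"
  show "finite {g. g < C \<and> a g + b g \<noteq> 0}"
    by (rule finite_subset[of _ "{g. g < C \<and> a g \<noteq> 0} \<union> {g. g < C \<and> b g \<noteq> 0}"]) (use * in auto)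
qed

text \<open>A lower bound for the support of \<open>b\<close> bounds \<open>h\<close> from above,
  and only finitely many exponents of \<open>a\<close> lie below a bound.\<close>

lemma finite_convolution_support:
  assumes "left_finite a" "left_finite b"
  shows "finite {h. a h \<noteq> 0 \<and> b (g - h) \<noteq> 0}"
proof -
  obtain \<beta> where "\<And>g. b g \<noteq> 0 \<Longrightarrow> \<beta> \<le> g" using left_finite_bounded_below assms by blast
  then have "{h. a h \<noteq> 0 \<and> b (g - h) \<noteq> 0} \<subseteq> {h. a h \<noteq> 0 \<and> h \<le> g - \<beta>}" by fastforce
  then show ?thesis using left_finite_finite_le[OF assms(1)] finite_subset by blast
qed

text \<open>The defining index set varies with the factors and with \<open>g\<close>; allowing any
  finite superset lets several convolutions be summed over a common index set.\<close>

lemma convolution_eq: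
  assumes "finite A" "\<And>h. a h \<noteq> 0 \<Longrightarrow> b (g - h) \<noteq> 0 \<Longrightarrow> h \<in> A"
  shows "convolution a b g = (\<Sum>h\<in>A. a h * b (g - h))"
  unfolding convolution_def by (rule sum.mono_neutral_left) (use assms in auto)

lemma convolution_nonzeroD:
  "convolution a b g \<noteq> 0 \<Longrightarrow> \<exists>h. a h \<noteq> 0 \<and> b (g - h) \<noteq> 0"
  unfolding convolution_def by (erule sum.not_neutral_contains_not_neutral) blast

text \<open>An exponent of the product is a sum \<open>h + k\<close> of exponents of the factors.
  Lower bounds for both supports turn \<open>h + k < C\<close> into upper bounds for
  \<open>h\<close> and for \<open>k\<close>, which leaves finitely many pairs.\<close>

lemma left_finite_convolution:
  assumes "left_finite a" "left_finite b"
  shows "left_finite (convolution a b)"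
  unfolding left_finite_def
proof
  fix C
  obtain \<alpha> where \<alpha>: "\<And>g. a g \<noteq> 0 \<Longrightarrow> \<alpha> \<le> g" using left_finite_bounded_below assms by blast
  obtain \<beta> where \<beta>: "\<And>g. b g \<noteq> 0 \<Longrightarrow> \<beta> \<le> g" using left_finite_bounded_below assms by blast
  have "{g. g < C \<and> convolution a b g \<noteq> 0} \<subseteq>
    (\<lambda>(h, k). h + k) ` ({h. a h \<noteq> 0 \<and> h \<le> C - \<beta>} \<times> {k. b k \<noteq> 0 \<and> k \<le> C - \<alpha>})"
  proof
    fix g assume "g \<in> {g. g < C \<and> convolution a b g \<noteq> 0}"
    then obtain h where h: "g < C" "a h \<noteq> 0" "b (g - h) \<noteq> 0"
      using convolution_nonzeroD by fastforce
    then show "g \<in> (\<lambda>(h, k). h + k) ` ({h. a h \<noteq> 0 \<and> h \<le> C - \<beta>} \<times> {k. b k \<noteq> 0 \<and> k \<le> C - \<alpha>})"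
      using \<alpha>[of h] \<beta>[of "g - h"] by (intro image_eqI[of _ _ "(h, g - h)"]) auto
  qed
  then show "finite {g. g < C \<and> convolution a b g \<noteq> 0}"
    by (rule finite_subset) (use assms left_finite_finite_le in auto)
qed

lemma convolution_commute: "convolution a b = convolution b a"
proof
  fix g
  show "convolution a b g = convolution b a g"
    unfolding convolution_def
    by (rule sum.reindex_bij_witness[of _ "\<lambda>h. g - h" "\<lambda>h. g - h"]) (auto simp: mult.commute)
qed

text \<open>For fixed \<open>g\<close>, the finite sets \<open>P\<close> and \<open>Q\<close>
  contain the first and second exponents of every triple of exponents of \<open>a\<close>,
  \<open>b\<close>, \<open>c\<close> with sum \<open>g\<close>, and \<open>H\<close> contains the
  partial sums of the first two. Over these sets associativity is an exchange of finite
  sums.\<close>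

lemma convolution_assoc:
  assumes "left_finite a" "left_finite b" "left_finite c"
  shows "convolution (convolution a b) c = convolution a (convolution b c)"
proof
  fix g
  obtain \<alpha> where \<alpha>: "\<And>g. a g \<noteq> 0 \<Longrightarrow> \<alpha> \<le> g" using left_finite_bounded_below assms by blast
  obtain \<beta> where \<beta>: "\<And>g. b g \<noteq> 0 \<Longrightarrow> \<beta> \<le> g" using left_finite_bounded_below assms by blast
  obtain \<gamma> where \<gamma>: "\<And>g. c g \<noteq> 0 \<Longrightarrow> \<gamma> \<le> g" using left_finite_bounded_below assms by blast
  define P where "P = {p. a p \<noteq> 0 \<and> p \<le> g - \<beta> - \<gamma>}"
  define Q where "Q = {q. b q \<noteq> 0 \<and> q \<le> g - \<alpha> - \<gamma>}"
  define H where "H = (\<lambda>(p, q). p + q) ` (P \<times> Q)"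
  have fin: "finite P" "finite Q" "finite H"
    using assms left_finite_finite_le by (auto simp: P_def Q_def H_def)
  have inH: "h \<in> H" if "a p \<noteq> 0" "b (h - p) \<noteq> 0" "c (g - h) \<noteq> 0" for p h
  proof -
    have "p \<in> P" "h - p \<in> Q"
      using that \<alpha>[of p] \<beta>[of "h - p"] \<gamma>[of "g - h"] by (auto simp: P_def Q_def)
    then show ?thesis unfolding H_def by (intro image_eqI[of _ _ "(p, h - p)"]) auto
  qed
  have "convolution (convolution a b) c g = (\<Sum>h\<in>H. convolution a b h * c (g - h))"
    using inH convolution_nonzeroD by (intro convolution_eq fin) blast
  also have "\<dots> = (\<Sum>h\<in>H. (\<Sum>p\<in>P. a p * b (h - p)) * c (g - h))"
  proof (rule sum.cong[OF refl])
    fix h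
    show "convolution a b h * c (g - h) = (\<Sum>p\<in>P. a p * b (h - p)) * c (g - h)"
    \<comment> \<open>\<open>P\<close> is known to contain the index set of
      \<open>convolution a b h\<close> only when \<open>c (g - h)\<close> is nonzero; otherwise both
      sides vanish.\<close>
    proof (cases "c (g - h) = 0")
      case False
      have "p \<in> P" if "a p \<noteq> 0" "b (h - p) \<noteq> 0" for p
        using that \<beta>[of "h - p"] \<gamma>[of "g - h"] False by (auto simp: P_def)
      then show ?thesis using convolution_eq[OF fin(1)] by metis
    qed simp
  qed
  also have "\<dots> = (\<Sum>p\<in>P. a p * (\<Sum>h\<in>H. b (h - p) * c (g - h)))"
    by (simp add: sum_distrib_left sum_distrib_right mult.assoc) (rule sum.swap)
  also have "\<dots> = (\<Sum>p\<in>P. a p * convolution b c (g - p))"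
  proof (rule sum.cong[OF refl])
    fix p assume p: "p \<in> P"
    have "convolution b c (g - p) = (\<Sum>q\<in>(\<lambda>h. h - p) ` H. b q * c (g - p - q))"
    proof (rule convolution_eq)
      show "q \<in> (\<lambda>h. h - p) ` H" if "b q \<noteq> 0" "c (g - p - q) \<noteq> 0" for q
        using inH[of p "p + q"] that p by (intro image_eqI[of _ _ "p + q"]) (auto simp: P_def algebra_simps)
    qed (use fin in auto)
    also have "\<dots> = (\<Sum>h\<in>H. b (h - p) * c (g - h))"
      by (subst sum.reindex) (auto simp: inj_on_def)
    finally show "a p * (\<Sum>h\<in>H. b (h - p) * c (g - h)) = a p * convolution b c (g - p)" by simp
  qed
  also have "\<dots> = convolution a (convolution b c) g"
  proof (rule convolution_eq[symmetric])
    fix p assume "a p \<noteq> 0" "convolution b c (g - p) \<noteq> 0"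
    then obtain q where "b q \<noteq> 0" "c (g - p - q) \<noteq> 0" using convolution_nonzeroD by blast
    with \<open>a p \<noteq> 0\<close> show "p \<in> P" using \<beta>[of q] \<gamma>[of "g - p - q"] by (auto simp: P_def)
  qed (use fin in auto)
  finally show "convolution (convolution a b) c g = convolution a (convolution b c) g" .
qed

lemma convolution_add_left:
  assumes "left_finite a" "left_finite b" "left_finite c"
  shows "convolution (\<lambda>g. a g + b g) c g = convolution a c g + convolution b c g"
proof -
  let ?A = "{h. a h \<noteq> 0 \<and> c (g - h) \<noteq> 0} \<union> {h. b h \<noteq> 0 \<and> c (g - h) \<noteq> 0}"
  have fin: "finite ?A" using assms finite_convolution_support by auto
  show ?thesis
    using convolution_eq[OF fin, of "\<lambda>g. a g + b g" c g] convolution_eq[OF fin, of a c g]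
      convolution_eq[OF fin, of b c g]
    by (fastforce simp: distrib_right sum.distrib)
qed

definition nov_monom :: "'k::field \<Rightarrow> real \<Rightarrow> real \<Rightarrow> 'k" where
  "nov_monom c g = (\<lambda>h. if h = g then c else 0)"

lemma one_novikov_monom: "\<one>\<^bsub>novikov \<Gamma>\<^esub> = nov_monom 1 0"
  by (simp add: one_novikov nov_monom_def)

lemma convolution_nov_monom: "convolution (nov_monom c g) a h = c * a (h - g)"
  by (subst convolution_eq[of "{g}"]) (auto simp: nov_monom_def split: if_splits)

lemma nov_monom_closed: "g \<in> \<Gamma> \<Longrightarrow> nov_monom c g \<in> carrier (novikov \<Gamma>)"
  unfolding carrier_novikov_iff left_finite_def
  by (auto simp: nov_monom_def intro: finite_subset[of _ "{g}"])

lemma cring_novikov: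
  assumes \<Gamma>: "subgroup \<Gamma> real_group"
  shows "cring (novikov \<Gamma> :: (real \<Rightarrow> 'k::field) ring)"
proof (rule cringI)
  let ?R = "novikov \<Gamma> :: (real \<Rightarrow> 'k) ring"
  have inv: "(\<lambda>g. - a g) \<in> carrier ?R" if "a \<in> carrier ?R" for a
    using that by (auto simp: carrier_novikov_iff left_finite_def)
  show "abelian_group ?R"
  proof (rule abelian_groupI)
    show "x \<oplus>\<^bsub>?R\<^esub> y \<in> carrier ?R" if "x \<in> carrier ?R" "y \<in> carrier ?R" for x y
      using that by (auto simp: carrier_novikov_iff left_finite_add) (metis add_0)
    show "\<exists>y\<in>carrier ?R. y \<oplus>\<^bsub>?R\<^esub> x = \<zero>\<^bsub>?R\<^esub>" if "x \<in> carrier ?R" for x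
      using inv[OF that] by (intro bexI[of _ "\<lambda>g. - x g"]) auto
  qed (auto simp: carrier_novikov_iff left_finite_def ac_simps)
  show "Group.comm_monoid ?R"
  proof (rule comm_monoidI)
    show "x \<otimes>\<^bsub>?R\<^esub> y \<in> carrier ?R" if "x \<in> carrier ?R" "y \<in> carrier ?R" for x y
    proof -
      have "g \<in> \<Gamma>" if "convolution x y g \<noteq> 0" for g
      proof -
        obtain h where "x h \<noteq> 0" "y (g - h) \<noteq> 0" using convolution_nonzeroD[OF \<open>convolution x y g \<noteq> 0\<close>] by blast
        then have "h \<in> \<Gamma>" "g - h \<in> \<Gamma>" using \<open>x \<in> carrier ?R\<close> \<open>y \<in> carrier ?R\<close> by (auto simp: carrier_novikov_iff)
        then have "h + (g - h) \<in> \<Gamma>" using subgroup_real_group_add[OF \<Gamma>] by blast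
        then show ?thesis by simp
      qed
      then show ?thesis using that by (auto simp: carrier_novikov_iff left_finite_convolution)
    qed
    show "\<one>\<^bsub>?R\<^esub> \<in> carrier ?R"
      unfolding one_novikov_monom by (rule nov_monom_closed[OF subgroup_real_group_zero[OF \<Gamma>]])
    show "\<one>\<^bsub>?R\<^esub> \<otimes>\<^bsub>?R\<^esub> x = x" for x
      by (simp add: one_novikov_monom fun_eq_iff convolution_nov_monom)
    show "x \<otimes>\<^bsub>?R\<^esub> y \<otimes>\<^bsub>?R\<^esub> z = x \<otimes>\<^bsub>?R\<^esub> (y \<otimes>\<^bsub>?R\<^esub> z)"
      if "x \<in> carrier ?R" "y \<in> carrier ?R" "z \<in> carrier ?R" for x y z
      using that by (simp add: carrier_novikov_iff convolution_assoc)
    show "x \<otimes>\<^bsub>?R\<^esub> y = y \<otimes>\<^bsub>?R\<^esub> x" for x y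
      by (simp add: convolution_commute)
  qed
  show "(x \<oplus>\<^bsub>?R\<^esub> y) \<otimes>\<^bsub>?R\<^esub> z = x \<otimes>\<^bsub>?R\<^esub> z \<oplus>\<^bsub>?R\<^esub> y \<otimes>\<^bsub>?R\<^esub> z"
    if "x \<in> carrier ?R" "y \<in> carrier ?R" "z \<in> carrier ?R" for x y z
    using that by (simp add: carrier_novikov_iff convolution_add_left fun_eq_iff)
qed

text \<open>The geometric series inverts \<open>1 - u\<close>: if the support of \<open>u\<close> lies above \<open>\<delta> > 0\<close>, that of
  \<open>u\<^sup>n\<close> lies above \<open>n \<delta>\<close>, so every coefficient of the series is a finite sum.\<close>

lemma novikov_geometric_series:
  fixes u :: "real \<Rightarrow> 'k::field"
  assumes \<Gamma>: "subgroup \<Gamma> real_group" and u: "u \<in> carrier (novikov \<Gamma>)"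
    and pos: "\<And>g. u g \<noteq> 0 \<Longrightarrow> 0 < g"
  obtains b where "b \<in> carrier (novikov \<Gamma>)"
    "\<And>g. b g = nov_monom 1 0 g + convolution u b g"
proof -
  let ?R = "novikov \<Gamma> :: (real \<Rightarrow> 'k) ring"
  interpret R: cring ?R using \<Gamma> by (rule cring_novikov)
  have lfu: "left_finite u" using u by (simp add: carrier_novikov_iff)
  obtain \<delta> where \<delta>: "\<delta> > 0" "\<And>g. u g \<noteq> 0 \<Longrightarrow> \<delta> \<le> g"
  proof (cases "\<exists>g. u g \<noteq> 0")
    case True
    then show ?thesis using left_finite_least[OF lfu] pos that by metis
  qed (use that[of 1] in auto)
  define p where "p n = u [^]\<^bsub>?R\<^esub> (n::nat)" for n
  have p_closed: "p n \<in> carrier ?R" for n using u by (simp add: p_def)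
  have p0: "p 0 = nov_monom 1 0" by (simp add: p_def one_novikov_monom)
  have pSuc: "p (Suc n) = convolution u (p n)" for n
    by (simp add: p_def convolution_commute)
  have p_supp: "of_nat n * \<delta> \<le> g" if "p n g \<noteq> 0" for n g
    using that
  proof (induction n arbitrary: g)
    case 0
    then show ?case by (auto simp: p0 nov_monom_def split: if_splits)
  next
    case (Suc n)
    then obtain h where "u h \<noteq> 0" "p n (g - h) \<noteq> 0" unfolding pSuc using convolution_nonzeroD by blast
    then show ?case using Suc.IH[of "g - h"] \<delta>(2)[of h] by (auto simp: algebra_simps)
  qed
  \<comment> \<open>The power \<open>p n\<close> vanishes at \<open>g\<close> as soon as
    \<open>n \<delta>\<close> exceeds \<open>g\<close>; the successor makes this strict when
    \<open>g / \<delta>\<close> is an integer.\<close>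
  define N where "N g = Suc (nat \<lceil>g / \<delta>\<rceil>)" for g
  have N: "p n g = 0" if "N g \<le> n" for n g
  proof (rule ccontr)
    assume "p n g \<noteq> 0"
    then have "real n \<le> g / \<delta>" using p_supp[of n g] \<delta> by (simp add: field_simps)
    also have "\<dots> \<le> real (nat \<lceil>g / \<delta>\<rceil>)" by linarith
    finally show False using that by (simp add: N_def)
  qed
  define b where "b g = (\<Sum>n<N g. p n g)" for g
  have b_eq: "b g = (\<Sum>n<M. p n g)" if "N g \<le> M" for g M
    unfolding b_def by (rule sum.mono_neutral_left) (use that N in auto)
  have b_ne: "\<exists>n<N g. p n g \<noteq> 0" if "b g \<noteq> 0" for g
    using that unfolding b_def by (metis lessThan_iff sum.not_neutral_contains_not_neutral)
  have mono: "g \<le> h \<Longrightarrow> N g \<le> N h" for g h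
    unfolding N_def using \<delta>(1) by (intro Suc_le_mono[THEN iffD2] nat_mono ceiling_mono divide_right_mono) auto
  have lfb: "left_finite b"
    unfolding left_finite_def
  proof
    fix C
    have "{g. g < C \<and> b g \<noteq> 0} \<subseteq> (\<Union>n<N C. {g. g < C \<and> p n g \<noteq> 0})"
    proof
      fix g assume "g \<in> {g. g < C \<and> b g \<noteq> 0}"
      then obtain n where "g < C" "n < N g" "p n g \<noteq> 0" using b_ne by blast
      moreover have "N g \<le> N C" using \<open>g < C\<close> by (intro mono) simp
      ultimately show "g \<in> (\<Union>n<N C. {g. g < C \<and> p n g \<noteq> 0})" by auto
    qed
    moreover have "finite (\<Union>n<N C. {g. g < C \<and> p n g \<noteq> 0})"
      using p_closed by (auto simp: carrier_novikov_iff left_finite_def)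
    ultimately show "finite {g. g < C \<and> b g \<noteq> 0}" by (rule finite_subset)
  qed
  have "b \<in> carrier ?R"
    unfolding carrier_novikov_iff
  proof (intro conjI allI impI lfb)
    fix g assume "b g \<noteq> 0"
    then obtain n where "p n g \<noteq> 0" using b_ne by blast
    then show "g \<in> \<Gamma>" using p_closed[of n] by (simp add: carrier_novikov_iff)
  qed
  moreover have "b g = nov_monom 1 0 g + convolution u b g" for g
  proof -
    \<comment> \<open>One index set has to serve the product of \<open>u\<close> with
      \<open>b\<close> and its products with all \<open>p n\<close>. The first part covers the
      latter because \<open>p n\<close> is supported on nonnegative exponents.\<close>
    let ?H = "{h. u h \<noteq> 0 \<and> h \<le> g} \<union> {h. u h \<noteq> 0 \<and> b (g - h) \<noteq> 0}"
    have fin: "finite ?H" using left_finite_finite_le[OF lfu] finite_convolution_support[OF lfu lfb] by auto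
    have inH: "h \<in> ?H" if "u h \<noteq> 0" "p n (g - h) \<noteq> 0" for h n
    proof -
      have "0 \<le> real n * \<delta>" using \<delta> by simp
      with p_supp[OF that(2)] have "h \<le> g" by linarith
      with that show ?thesis by auto
    qed
    have "convolution u b g = (\<Sum>h\<in>?H. u h * b (g - h))"
      by (rule convolution_eq[OF fin]) auto
    \<comment> \<open>As \<open>u\<close> lives on positive exponents, \<open>g - h\<close> lies
      below \<open>g\<close>, so truncation at \<open>N g\<close> is long enough for
      \<open>b (g - h)\<close> as well.\<close>
    also have "\<dots> = (\<Sum>h\<in>?H. u h * (\<Sum>n<N g. p n (g - h)))"
      using mono pos by (intro sum.cong[OF refl] arg_cong2[of _ _ _ _ "(*)"] b_eq) (auto simp: less_imp_le)
    also have "\<dots> = (\<Sum>n<N g. (\<Sum>h\<in>?H. u h * p n (g - h)))"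
      unfolding sum_distrib_left by (rule sum.swap)
    also have "\<dots> = (\<Sum>n<N g. p (Suc n) g)"
      unfolding pSuc using inH by (intro sum.cong[OF refl] convolution_eq[OF fin, symmetric]) auto
    also have "nov_monom 1 0 g + \<dots> = (\<Sum>n<Suc (N g). p n g)"
      by (simp only: sum.lessThan_Suc_shift p0)
    also have "\<dots> = b g" by (rule b_eq[symmetric]) simp
    finally show ?thesis ..
  qed
  ultimately show thesis by (rule that)
qed

text \<open>Dividing by the leading term turns \<open>a\<close> into \<open>1 - u\<close> with
  \<open>u\<close> supported on positive exponents, and the geometric series in \<open>u\<close>
  gives the inverse of \<open>1 - u\<close>.\<close>

theorem field_novikov:
  assumes \<Gamma>: "subgroup \<Gamma> real_group"
  shows "field (novikov \<Gamma> :: (real \<Rightarrow> 'k::field) ring)"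
proof -
  let ?R = "novikov \<Gamma> :: (real \<Rightarrow> 'k) ring"
  interpret R: cring ?R using \<Gamma> by (rule cring_novikov)
  show ?thesis
  proof (rule R.cring_fieldI2)
    show "\<zero>\<^bsub>?R\<^esub> \<noteq> \<one>\<^bsub>?R\<^esub>" by (auto simp: one_novikov dest: fun_cong[of _ _ 0])
    fix a assume a: "a \<in> carrier ?R" and "a \<noteq> \<zero>\<^bsub>?R\<^esub>"
    then obtain g where "a g \<noteq> 0" by auto
    then obtain g\<^sub>0 where g\<^sub>0: "a g\<^sub>0 \<noteq> 0" "\<And>g. a g \<noteq> 0 \<Longrightarrow> g\<^sub>0 \<le> g"
      using left_finite_least a carrier_novikov_iff by metis
    define m where "m = nov_monom (1 / a g\<^sub>0) (- g\<^sub>0)"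
    have m: "m \<in> carrier ?R"
      unfolding m_def using a g\<^sub>0(1) subgroup_real_group_uminus[OF \<Gamma>]
      by (intro nov_monom_closed) (auto simp: carrier_novikov_iff)
    define u where "u = \<one>\<^bsub>?R\<^esub> \<ominus>\<^bsub>?R\<^esub> m \<otimes>\<^bsub>?R\<^esub> a"
    have u: "u \<in> carrier ?R" unfolding u_def using R.m_closed[OF m a] R.one_closed by (rule R.minus_closed[rotated])
    have "u \<oplus>\<^bsub>?R\<^esub> m \<otimes>\<^bsub>?R\<^esub> a = \<one>\<^bsub>?R\<^esub>"
      unfolding u_def using R.m_closed[OF m a] R.one_closed by algebra
    then have u_eq: "u g = nov_monom 1 0 g - a (g + g\<^sub>0) / a g\<^sub>0" for g
      by (auto simp: one_novikov_monom fun_eq_iff m_def convolution_nov_monom eq_diff_eq)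
    have pos: "0 < g" if "u g \<noteq> 0" for g
    proof (rule ccontr)
      assume "\<not> 0 < g"
      then consider "g = 0" | "g < 0" by linarith
      then show False
        using that g\<^sub>0(1) g\<^sub>0(2)[of "g + g\<^sub>0"] by cases (auto simp: u_eq nov_monom_def)
    qed
    obtain b where b: "b \<in> carrier ?R" and "\<And>g. b g = nov_monom 1 0 g + convolution u b g"
      using novikov_geometric_series[OF \<Gamma> u pos] by metis
    then have "b = \<one>\<^bsub>?R\<^esub> \<oplus>\<^bsub>?R\<^esub> u \<otimes>\<^bsub>?R\<^esub> b" by (simp add: one_novikov_monom fun_eq_iff)
    then have "b \<ominus>\<^bsub>?R\<^esub> u \<otimes>\<^bsub>?R\<^esub> b = \<one>\<^bsub>?R\<^esub>"
      using b u by (metis R.add.inv_solve_right R.m_closed R.minus_eq R.one_closed R.a_comm)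
    moreover have "b \<ominus>\<^bsub>?R\<^esub> u \<otimes>\<^bsub>?R\<^esub> b = a \<otimes>\<^bsub>?R\<^esub> (m \<otimes>\<^bsub>?R\<^esub> b)"
      unfolding u_def using a b m by algebra
    ultimately show "\<exists>b\<in>carrier ?R. a \<otimes>\<^bsub>?R\<^esub> b = \<one>\<^bsub>?R\<^esub>"
      using R.m_closed[OF m b] by auto
  qed
qed

text \<open>Reading off one coefficient turns a linear combination over the Novikov field into one
  over the ground field; this is the passage used in \<open>card_leading_le\<close>.\<close>

lemma finsum_novikov:
  fixes f :: "'i \<Rightarrow> real \<Rightarrow> 'k::field"
  assumes \<Gamma>: "subgroup \<Gamma> real_group" and f: "f \<in> I \<rightarrow> carrier (novikov \<Gamma>)"
  shows "(\<Oplus>\<^bsub>novikov \<Gamma>\<^esub>i\<in>I. f i) g = (\<Sum>i\<in>I. f i g)"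
proof -
  interpret R: cring "novikov \<Gamma> :: (real \<Rightarrow> 'k) ring" using \<Gamma> by (rule cring_novikov)
  show ?thesis
    using f by (induction I rule: infinite_finite_induct) auto
qed

subsection \<open>The valuation\<close>

lemma nov_val_zero [simp]: "nov_val (\<lambda>g. 0) = \<infinity>"
  by (simp add: nov_val_def)

lemma nov_val_eqI:
  assumes "a g\<^sub>0 \<noteq> 0" "\<And>g. a g \<noteq> 0 \<Longrightarrow> g\<^sub>0 \<le> g"
  shows "nov_val a = ereal g\<^sub>0"
proof -
  have "(LEAST g. a g \<noteq> 0) = g\<^sub>0" by (rule Least_equality) (use assms in auto)
  then show ?thesis using assms by (auto simp: nov_val_def)
qed

lemma nov_val_monom: "c \<noteq> 0 \<Longrightarrow> nov_val (nov_monom c g) = ereal g"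
  by (rule nov_val_eqI) (auto simp: nov_monom_def split: if_splits)

lemma nov_val_nonzero_cases:
  assumes "left_finite a" "a \<noteq> (\<lambda>g. 0)"
  obtains g\<^sub>0 where "nov_val a = ereal g\<^sub>0" "a g\<^sub>0 \<noteq> 0" "\<And>g. a g \<noteq> 0 \<Longrightarrow> g\<^sub>0 \<le> g"
proof -
  obtain g where "a g \<noteq> 0" using assms(2) by auto
  then obtain g\<^sub>0 where "a g\<^sub>0 \<noteq> 0" "\<And>g. a g \<noteq> 0 \<Longrightarrow> g\<^sub>0 \<le> g"
    using left_finite_least assms(1) by metis
  then show thesis using that nov_val_eqI by metis
qed

lemma nov_val_neq_MInfty [simp]: "nov_val a \<noteq> -\<infinity>"
  by (simp add: nov_val_def)

lemma nov_val_eq_PInfty_iff: "nov_val a = \<infinity> \<longleftrightarrow> a = (\<lambda>g. 0)"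
  by (simp add: nov_val_def)

text \<open>Vanishing of coefficients is stable under linear combinations over the ground field, so
  valuation bounds are put in this form.\<close>

lemma nov_val_ge_iff:
  assumes "left_finite a"
  shows "ereal c \<le> nov_val a \<longleftrightarrow> (\<forall>g<c. a g = 0)"
proof (cases "a = (\<lambda>g. 0)")
  case False
  obtain g\<^sub>0 where "nov_val a = ereal g\<^sub>0" "a g\<^sub>0 \<noteq> 0" "\<And>g. a g \<noteq> 0 \<Longrightarrow> g\<^sub>0 \<le> g"
    using nov_val_nonzero_cases[OF assms False] by metis
  then show ?thesis by (metis ereal_less_eq(3) leD leI order.strict_trans2)
qed simp

lemma nov_val_gt_iff:
  assumes "left_finite a"
  shows "ereal c < nov_val a \<longleftrightarrow> (\<forall>g\<le>c. a g = 0)"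
proof (cases "a = (\<lambda>g. 0)")
  case False
  obtain g\<^sub>0 where "nov_val a = ereal g\<^sub>0" "a g\<^sub>0 \<noteq> 0" "\<And>g. a g \<noteq> 0 \<Longrightarrow> g\<^sub>0 \<le> g"
    using nov_val_nonzero_cases[OF assms False] by metis
  then show ?thesis by (metis ereal_less(2) less_ereal.simps(1) leD leI order.trans)
qed simp

lemma nov_val_add:
  fixes a b :: "real \<Rightarrow> 'k::field"
  assumes "left_finite a" "left_finite b"
  shows "min (nov_val a) (nov_val b) \<le> nov_val (\<lambda>g. a g + b g)"
proof (rule ccontr)
  assume *: "\<not> ?thesis"
  then have "nov_val (\<lambda>g. a g + b g) \<noteq> \<infinity>" by auto
  then obtain r where r: "nov_val (\<lambda>g. a g + b g) = ereal r"
    using nov_val_neq_MInfty by (metis ereal_cases)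
  with * have "ereal r < min (nov_val a) (nov_val b)" by (simp only: not_le)
  then have "ereal r < nov_val a" "ereal r < nov_val b" by (simp_all only: min_less_iff_conj)
  with assms have "ereal r < nov_val (\<lambda>g. a g + b g)"
    by (simp add: nov_val_gt_iff left_finite_add)
  with r show False by simp
qed

text \<open>At the sum of the two least exponents just one pair of terms contributes, and its
  product is nonzero in a field.\<close>

lemma nov_val_convolution:
  assumes "left_finite a" "left_finite b"
  shows "nov_val (convolution a b) = nov_val a + nov_val b"
proof (cases "a = (\<lambda>g. 0) \<or> b = (\<lambda>g. 0)")
  case True
  then have "convolution a b = (\<lambda>g. 0)" by (auto simp: convolution_def)
  with True show ?thesis by auto
next
  case False
  obtain g where g: "nov_val a = ereal g" "a g \<noteq> 0" "\<And>h. a h \<noteq> 0 \<Longrightarrow> g \<le> h"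
    using nov_val_nonzero_cases[OF assms(1)] False by metis
  obtain g' where g': "nov_val b = ereal g'" "b g' \<noteq> 0" "\<And>h. b h \<noteq> 0 \<Longrightarrow> g' \<le> h"
    using nov_val_nonzero_cases[OF assms(2)] False by metis
  have "nov_val (convolution a b) = ereal (g + g')"
  proof (rule nov_val_eqI)
    have "convolution a b (g + g') = (\<Sum>h\<in>{g}. a h * b (g + g' - h))"
    proof (rule convolution_eq)
      fix h assume "a h \<noteq> 0" "b (g + g' - h) \<noteq> 0"
      then show "h \<in> {g}" using g(3)[of h] g'(3)[of "g + g' - h"] by auto
    qed simp
    then show "convolution a b (g + g') \<noteq> 0" using g g' by simp
    show "g + g' \<le> h" if "convolution a b h \<noteq> 0" for h
      using convolution_nonzeroD[OF that] g(3) g'(3) by fastforce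
  qed
  then show ?thesis using g g' by simp
qed

section \<open>Extension of scalars\<close>

text \<open>Agreement of the operations of the two rings enters in \<open>emb_coordinates\<close>,
  where coordinates over \<open>R\<close> are compared with coordinates over
  \<open>S\<close>.\<close>

locale scalar_extension = module R M + S: cring S
  for R :: "'a ring" and M :: "('a, 'c) module" and S :: "'a ring" +
  assumes carrier_subset: "carrier R \<subseteq> carrier S"
begin

abbreviation "E \<equiv> extend_scalars R S M"
abbreviation "Fr \<equiv> tensor_free S M"
abbreviation "Rel \<equiv> tensor_rel R S M"
abbreviation "cls \<equiv> tensor_class R S M"

definition tens :: "'c \<Rightarrow> 'a \<Rightarrow> ('c \<times> 'a \<Rightarrow>\<^sub>0 int) set" where
  "tens x a = cls (frag_of (x, a))"

text \<open>The generating set inside \<open>tensor_rel\<close>, named so that an inclusion of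
  \<open>Rel\<close> in a subgroup can be tested on it.\<close>

definition tensor_generators :: "('c \<times> 'a \<Rightarrow>\<^sub>0 int) set" where
  "tensor_generators =
    {frag_of (x \<oplus>\<^bsub>M\<^esub> y, a) - frag_of (x, a) - frag_of (y, a) | x y a.
        x \<in> carrier M \<and> y \<in> carrier M \<and> a \<in> carrier S} \<union>
     {frag_of (x, a \<oplus>\<^bsub>S\<^esub> b) - frag_of (x, a) - frag_of (x, b) | x a b.
        x \<in> carrier M \<and> a \<in> carrier S \<and> b \<in> carrier S} \<union>
     {frag_of (c \<odot>\<^bsub>M\<^esub> x, a) - frag_of (x, c \<otimes>\<^bsub>S\<^esub> a) | c x a.
        c \<in> carrier R \<and> x \<in> carrier M \<and> a \<in> carrier S}"

lemma Rel_eq: "Rel = generate Fr tensor_generators"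
  by (simp add: tensor_rel_def tensor_generators_def)

lemma carrier_Fr_diff: "z \<in> carrier Fr \<Longrightarrow> w \<in> carrier Fr \<Longrightarrow> z - w \<in> carrier Fr"
  using keys_diff[of z w] by auto

lemma tensor_generators_subset: "tensor_generators \<subseteq> carrier Fr"
proof
  fix z assume "z \<in> tensor_generators"
  then show "z \<in> carrier Fr"
    unfolding tensor_generators_def
    by (elim UnE CollectE exE conjE; hypsubst; intro carrier_Fr_diff frag_of_in_free_Abelian_group[THEN iffD2] SigmaI)
      (use carrier_subset in auto)
qed

lemma subgroup_Rel: "subgroup Rel Fr"
  unfolding Rel_eq by (rule group.generate_is_subgroup[OF group_free_Abelian_group tensor_generators_subset])

lemma normal_Rel: "Rel \<lhd> Fr"
  using abelian_free_Abelian_group subgroup_Rel comm_group.normal_iff_subgroup by blast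

lemma Rel_carrier: "z \<in> Rel \<Longrightarrow> z \<in> carrier Fr"
  using subgroup.mem_carrier[OF subgroup_Rel] .

lemma Rel_zero: "0 \<in> Rel"
  using subgroup.one_closed[OF subgroup_Rel] by simp

lemma Rel_add: "z \<in> Rel \<Longrightarrow> w \<in> Rel \<Longrightarrow> z + w \<in> Rel"
  using subgroup.m_closed[OF subgroup_Rel] by simp

lemma Rel_uminus: "z \<in> Rel \<Longrightarrow> - z \<in> Rel"
  using subgroup.m_inv_closed[OF subgroup_Rel, of z] Rel_carrier[of z] by simp

lemma Rel_diff: "z \<in> Rel \<Longrightarrow> w \<in> Rel \<Longrightarrow> z - w \<in> Rel"
  using Rel_add[of z "- w"] Rel_uminus[of w] by simp

text \<open>The test for maps out of the tensor product to be well defined: \<open>H\<close> is a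
  preimage of the target relations, or a kernel.\<close>

lemma Rel_subsetI:
  assumes "subgroup H Fr" "tensor_generators \<subseteq> H"
  shows "Rel \<subseteq> H"
  unfolding Rel_eq by (rule group.generate_subgroup_incl[OF group_free_Abelian_group assms(2,1)])

lemma generator_in_Rel: "z \<in> tensor_generators \<Longrightarrow> z \<in> Rel"
  unfolding Rel_eq by (rule generate.incl)

lemma carrier_Fr_uminus: "z \<in> carrier Fr \<Longrightarrow> - z \<in> carrier Fr"
  by simp

lemma carrier_Fr_add: "z \<in> carrier Fr \<Longrightarrow> w \<in> carrier Fr \<Longrightarrow> z + w \<in> carrier Fr"
  using keys_add[of z w] by auto

lemma cls_eq: "cls z = {w. w - z \<in> Rel}"
  unfolding tensor_class_def r_coset_def
proof (intro Set.set_eqI iffI)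
  fix w assume "w \<in> {w. w - z \<in> Rel}"
  then show "w \<in> (\<Union>h\<in>Rel. {h \<otimes>\<^bsub>Fr\<^esub> z})" by (auto intro!: bexI[of _ "w - z"])
qed auto

lemma cls_eq_iff: "cls z = cls w \<longleftrightarrow> z - w \<in> Rel"
proof
  assume "cls z = cls w"
  moreover have "z \<in> cls z" by (simp add: cls_eq Rel_zero)
  ultimately show "z - w \<in> Rel" by (auto simp: cls_eq)
next
  assume *: "z - w \<in> Rel"
  show "cls z = cls w"
    unfolding cls_eq
  proof (intro Collect_cong iffI)
    fix v
    show "v - w \<in> Rel" if "v - z \<in> Rel" using Rel_add[OF that *] by simp
    show "v - z \<in> Rel" if "v - w \<in> Rel" using Rel_diff[OF that *] by simp
  qed
qed

lemma carrier_E: "carrier E = cls ` carrier Fr"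
  by (auto simp: extend_scalars_def FactGroup_def RCOSETS_def tensor_class_def)

lemma carrier_E_cases:
  assumes "X \<in> carrier E"
  obtains z where "z \<in> carrier Fr" "X = cls z"
  using assms carrier_E by auto

lemma cls_closed: "z \<in> carrier Fr \<Longrightarrow> cls z \<in> carrier E"
  by (simp add: carrier_E)

lemma tens_closed [intro, simp]: "x \<in> carrier M \<Longrightarrow> a \<in> carrier S \<Longrightarrow> tens x a \<in> carrier E"
  unfolding tens_def by (rule cls_closed) simp

lemma cls_add: "z \<in> carrier Fr \<Longrightarrow> w \<in> carrier Fr \<Longrightarrow> cls z \<oplus>\<^bsub>E\<^esub> cls w = cls (z + w)"
  unfolding tensor_class_def using normal.rcos_sum[OF normal_Rel, of z w]
  by (simp add: extend_scalars_def FactGroup_def)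

lemma zero_E: "\<zero>\<^bsub>E\<^esub> = cls 0"
  by (simp add: extend_scalars_def FactGroup_def cls_eq)

text \<open>Scalar multiplication and extended maps are defined as unions over all representatives
  of a class. If relations go to relations, all members of such a union coincide, and any one
  representative computes it.\<close>

lemma cls_UN:
  assumes z: "z \<in> carrier Fr" and "\<And>w. w \<in> Rel \<Longrightarrow> frag_extend f w \<in> tensor_rel R' S' M'"
    and "\<And>a b. a - b \<in> tensor_rel R' S' M' \<Longrightarrow> tensor_class R' S' M' a = tensor_class R' S' M' b"
  shows "(\<Union>w\<in>cls z. tensor_class R' S' M' (frag_extend f w)) = tensor_class R' S' M' (frag_extend f z)"
proof -
  define T where "T w = tensor_class R' S' M' (frag_extend f w)" for w
  have T: "T w = T z" if "w \<in> cls z" for w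
    using assms(2)[of "w - z"] that unfolding T_def by (intro assms(3)) (simp add: cls_eq frag_extend_diff)
  have "z \<in> cls z" by (simp add: cls_eq Rel_zero)
  then have "\<Union> (T ` cls z) = T z" using T by blast
  then show ?thesis by (simp add: T_def)
qed

definition scale :: "'a \<Rightarrow> ('c \<times> 'a \<Rightarrow>\<^sub>0 int) \<Rightarrow> ('c \<times> 'a \<Rightarrow>\<^sub>0 int)" where
  "scale s = frag_extend (\<lambda>(x, a). frag_of (x, s \<otimes>\<^bsub>S\<^esub> a))"

lemma frag_extend_closed:
  assumes "z \<in> carrier (free_Abelian_group A)" "\<And>p. p \<in> A \<Longrightarrow> f p \<in> carrier (free_Abelian_group B)"
  shows "frag_extend f z \<in> carrier (free_Abelian_group B)"
proof -
  have "(\<Union>p\<in>Poly_Mapping.keys z. Poly_Mapping.keys (f p)) \<subseteq> B"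
    using assms unfolding carrier_free_Abelian_group_iff by blast
  then show ?thesis
    unfolding carrier_free_Abelian_group_iff using keys_frag_extend by (rule order.trans[rotated])
qed

lemma subgroup_vimage_frag_extend:
  assumes H: "subgroup H (free_Abelian_group B)"
  shows "subgroup {z \<in> carrier Fr. frag_extend f z \<in> H} Fr"
proof (rule group.subgroupI[OF group_free_Abelian_group])
  have "frag_extend f 0 \<in> H" using subgroup.one_closed[OF H] by simp
  moreover have "(0 :: ('c \<times> 'a) \<Rightarrow>\<^sub>0 int) \<in> carrier Fr" by simp
  ultimately show "{z \<in> carrier Fr. frag_extend f z \<in> H} \<noteq> {}" by blast
  fix z assume z: "z \<in> {z \<in> carrier Fr. frag_extend f z \<in> H}"
  then show "inv\<^bsub>Fr\<^esub> z \<in> {z \<in> carrier Fr. frag_extend f z \<in> H}"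
    using subgroup.m_inv_closed[OF H, of "frag_extend f z"] subgroup.mem_carrier[OF H, of "frag_extend f z"]
    by (simp add: frag_extend_minus)
  fix w assume w: "w \<in> {z \<in> carrier Fr. frag_extend f z \<in> H}"
  show "z \<otimes>\<^bsub>Fr\<^esub> w \<in> {z \<in> carrier Fr. frag_extend f z \<in> H}"
    using z w carrier_Fr_add[of z w] subgroup.m_closed[OF H, of "frag_extend f z" "frag_extend f w"]
    by (simp add: frag_extend_add)
qed auto

text \<open>Scaling the second entries sends each kind of generating relation to one of the same
  kind; for the relation that moves scalars across, this is commutativity of
  \<open>S\<close>.\<close>

lemma scale_Rel:
  assumes s: "s \<in> carrier S" and "z \<in> Rel"
  shows "scale s z \<in> Rel"
proof -
  have "Rel \<subseteq> {z \<in> carrier Fr. scale s z \<in> Rel}"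
    unfolding scale_def
  proof (rule Rel_subsetI[OF subgroup_vimage_frag_extend[OF subgroup_Rel]], intro subsetI CollectI conjI)
    fix g assume g: "g \<in> tensor_generators"
    then show "g \<in> carrier Fr" using tensor_generators_subset by blast
    have "frag_extend (\<lambda>(x, a). frag_of (x, s \<otimes>\<^bsub>S\<^esub> a)) g \<in> tensor_generators"
      using g unfolding tensor_generators_def
    proof (elim UnE CollectE exE conjE, goal_cases)
      case (1 x y a)
      then show ?case using s by (intro UnI1 CollectI exI[of _ x] exI[of _ y] exI[of _ "s \<otimes>\<^bsub>S\<^esub> a"])
        (simp add: frag_extend_diff)
    next
      case (2 x a b)
      then show ?case using s
        by (intro UnI1[OF UnI2] CollectI exI[of _ x] exI[of _ "s \<otimes>\<^bsub>S\<^esub> a"] exI[of _ "s \<otimes>\<^bsub>S\<^esub> b"])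
          (simp add: frag_extend_diff S.r_distr)
    next
      case (3 c x a)
      moreover from this have "s \<otimes>\<^bsub>S\<^esub> (c \<otimes>\<^bsub>S\<^esub> a) = c \<otimes>\<^bsub>S\<^esub> (s \<otimes>\<^bsub>S\<^esub> a)"
        using s carrier_subset by (intro S.m_lcomm) auto
      ultimately show ?case using s
        by (intro UnI2 CollectI exI[of _ c] exI[of _ x] exI[of _ "s \<otimes>\<^bsub>S\<^esub> a"])
          (simp add: frag_extend_diff)
    qed
    then show "frag_extend (\<lambda>(x, a). frag_of (x, s \<otimes>\<^bsub>S\<^esub> a)) g \<in> Rel" by (rule generator_in_Rel)
  qed
  then show ?thesis using assms by blast
qed

lemma scale_closed: "s \<in> carrier S \<Longrightarrow> z \<in> carrier Fr \<Longrightarrow> scale s z \<in> carrier Fr"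
  unfolding scale_def by (rule frag_extend_closed) auto

lemma cls_smult:
  assumes "s \<in> carrier S" "z \<in> carrier Fr"
  shows "s \<odot>\<^bsub>E\<^esub> cls z = cls (scale s z)"
proof -
  have "s \<odot>\<^bsub>E\<^esub> cls z = (\<Union>w\<in>cls z. cls (scale s w))"
    by (simp add: extend_scalars_def scale_def)
  also have "\<dots> = cls (scale s z)"
    unfolding scale_def
    by (rule cls_UN[OF assms(2)]) (use scale_Rel[OF assms(1)] in \<open>simp_all add: scale_def cls_eq_iff\<close>)
  finally show ?thesis .
qed

lemma abelian_group_E: "abelian_group E"
proof (rule abelian_groupI)
  show "X \<oplus>\<^bsub>E\<^esub> Y \<in> carrier E" if "X \<in> carrier E" "Y \<in> carrier E" for X Y
    using that by (elim carrier_E_cases) (simp only: cls_add cls_closed carrier_Fr_add)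
  show "\<zero>\<^bsub>E\<^esub> \<in> carrier E" unfolding zero_E by (rule cls_closed) simp
  show "X \<oplus>\<^bsub>E\<^esub> Y \<oplus>\<^bsub>E\<^esub> Z = X \<oplus>\<^bsub>E\<^esub> (Y \<oplus>\<^bsub>E\<^esub> Z)"
    if "X \<in> carrier E" "Y \<in> carrier E" "Z \<in> carrier E" for X Y Z
    using that by (elim carrier_E_cases) (simp only: cls_add carrier_Fr_add add.assoc)
  show "X \<oplus>\<^bsub>E\<^esub> Y = Y \<oplus>\<^bsub>E\<^esub> X" if "X \<in> carrier E" "Y \<in> carrier E" for X Y
    using that by (elim carrier_E_cases) (simp only: cls_add add.commute)
  show "\<zero>\<^bsub>E\<^esub> \<oplus>\<^bsub>E\<^esub> X = X" if "X \<in> carrier E" for X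
  proof -
    have "0 \<in> carrier Fr" by simp
    with that show ?thesis by (elim carrier_E_cases) (simp only: zero_E cls_add add_0)
  qed
  show "\<exists>Y\<in>carrier E. Y \<oplus>\<^bsub>E\<^esub> X = \<zero>\<^bsub>E\<^esub>" if X: "X \<in> carrier E" for X
  proof -
    obtain z where z: "z \<in> carrier Fr" "X = cls z" using X by (rule carrier_E_cases)
    then show ?thesis
      by (intro bexI[of _ "cls (- z)"] cls_closed carrier_Fr_uminus)
        (simp_all only: zero_E cls_add carrier_Fr_uminus add.left_inverse)
  qed
qed

lemma tens_smult [simp]:
  "s \<in> carrier S \<Longrightarrow> x \<in> carrier M \<Longrightarrow> a \<in> carrier S \<Longrightarrow> s \<odot>\<^bsub>E\<^esub> tens x a = tens x (s \<otimes>\<^bsub>S\<^esub> a)"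
  unfolding tens_def by (subst cls_smult) (auto simp: scale_def)

lemma tens_add_left:
  assumes "x \<in> carrier M" "y \<in> carrier M" "a \<in> carrier S"
  shows "tens (x \<oplus>\<^bsub>M\<^esub> y) a = tens x a \<oplus>\<^bsub>E\<^esub> tens y a"
proof -
  have "frag_of (x \<oplus>\<^bsub>M\<^esub> y, a) - frag_of (x, a) - frag_of (y, a) \<in> Rel"
    by (rule generator_in_Rel) (use assms in \<open>auto simp: tensor_generators_def\<close>)
  then show ?thesis
    using assms by (simp add: tens_def cls_add cls_eq_iff diff_diff_add)
qed

lemma tens_add_right:
  assumes "x \<in> carrier M" "a \<in> carrier S" "b \<in> carrier S"
  shows "tens x (a \<oplus>\<^bsub>S\<^esub> b) = tens x a \<oplus>\<^bsub>E\<^esub> tens x b"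
proof -
  have "frag_of (x, a \<oplus>\<^bsub>S\<^esub> b) - frag_of (x, a) - frag_of (x, b) \<in> Rel"
    by (rule generator_in_Rel) (use assms in \<open>auto simp: tensor_generators_def\<close>)
  then show ?thesis
    using assms by (simp add: tens_def cls_add cls_eq_iff diff_diff_add)
qed

lemma tens_smult_left:
  assumes "c \<in> carrier R" "x \<in> carrier M" "a \<in> carrier S"
  shows "tens (c \<odot>\<^bsub>M\<^esub> x) a = tens x (c \<otimes>\<^bsub>S\<^esub> a)"
proof -
  have "frag_of (c \<odot>\<^bsub>M\<^esub> x, a) - frag_of (x, c \<otimes>\<^bsub>S\<^esub> a) \<in> Rel"
    by (rule generator_in_Rel) (use assms in \<open>auto simp: tensor_generators_def\<close>)
  then show ?thesis by (simp add: tens_def cls_eq_iff)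
qed

lemma tens_zero_right: "x \<in> carrier M \<Longrightarrow> tens x \<zero>\<^bsub>S\<^esub> = \<zero>\<^bsub>E\<^esub>"
proof -
  interpret E: abelian_group E by (rule abelian_group_E)
  assume x: "x \<in> carrier M"
  then have "tens x \<zero>\<^bsub>S\<^esub> \<oplus>\<^bsub>E\<^esub> tens x \<zero>\<^bsub>S\<^esub> = tens x \<zero>\<^bsub>S\<^esub>"
    using tens_add_right[of x "\<zero>\<^bsub>S\<^esub>" "\<zero>\<^bsub>S\<^esub>"] by simp
  then show ?thesis using x by (simp add: E.add.l_cancel_one)
qed

text \<open>Negatives of free generators thus become elementary tensors, which spares
  \<open>tensor_induct\<close> a case for negatives.\<close>

lemma tens_uminus: "x \<in> carrier M \<Longrightarrow> a \<in> carrier S \<Longrightarrow> tens x (\<ominus>\<^bsub>S\<^esub> a) = cls (- frag_of (x, a))"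
proof -
  interpret E: abelian_group E by (rule abelian_group_E)
  assume xa: "x \<in> carrier M" "a \<in> carrier S"
  then have c: "frag_of (x, a) \<in> carrier Fr" by simp
  have "tens x (\<ominus>\<^bsub>S\<^esub> a) \<oplus>\<^bsub>E\<^esub> tens x a = \<zero>\<^bsub>E\<^esub>"
    using xa by (simp add: tens_add_right[symmetric] S.l_neg tens_zero_right)
  moreover have "cls (- frag_of (x, a)) \<oplus>\<^bsub>E\<^esub> tens x a = \<zero>\<^bsub>E\<^esub>"
    unfolding tens_def zero_E by (subst cls_add[OF carrier_Fr_uminus[OF c] c]) simp
  ultimately show ?thesis
    using xa cls_closed[OF carrier_Fr_uminus[OF c]]
    by (metis E.minus_equality tens_closed S.a_inv_closed)
qed

lemma tensor_induct [consumes 1, case_names zero tens add]: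
  assumes X: "X \<in> carrier E"
    and zero: "P \<zero>\<^bsub>E\<^esub>"
    and tens: "\<And>x a. x \<in> carrier M \<Longrightarrow> a \<in> carrier S \<Longrightarrow> P (tens x a)"
    and add: "\<And>X Y. X \<in> carrier E \<Longrightarrow> Y \<in> carrier E \<Longrightarrow> P X \<Longrightarrow> P Y \<Longrightarrow> P (X \<oplus>\<^bsub>E\<^esub> Y)"
  shows "P X"
proof -
  obtain z where z: "z \<in> carrier Fr" "X = cls z" using X by (rule carrier_E_cases)
  from z(1) have "Poly_Mapping.keys z \<subseteq> carrier M \<times> carrier S" by simp
  \<comment> \<open>\<open>frag_induction\<close> builds elements by differences, while
    \<open>P\<close> is closed under sums; so the claim is carried for \<open>- z\<close> along with
    \<open>z\<close>.\<close>
  then have "z \<in> carrier Fr \<and> P (cls z) \<and> P (cls (- z))"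
  proof (induction z rule: frag_induction)
    case zero
    then show ?case using \<open>P \<zero>\<^bsub>E\<^esub>\<close> by (simp add: zero_E)
  next
    case (one p)
    obtain x a where p: "p = (x, a)" "x \<in> carrier M" "a \<in> carrier S" using one by auto
    then show ?case
      using tens[of x a] tens[of x "\<ominus>\<^bsub>S\<^esub> a"] by (simp add: tens_uminus) (simp add: tens_def)
  next
    case (diff z w)
    then have zw: "z \<in> carrier Fr" "w \<in> carrier Fr" by blast+
    then have neg: "- z \<in> carrier Fr" "- w \<in> carrier Fr" using carrier_Fr_uminus by blast+
    have "P (cls z \<oplus>\<^bsub>E\<^esub> cls (- w))" "P (cls (- z) \<oplus>\<^bsub>E\<^esub> cls w)"
      using diff zw neg by (auto intro!: add cls_closed simp del: carrier_free_Abelian_group_iff)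
    moreover have "z + - w = z - w" "- z + w = - (z - w)" by simp_all
    ultimately show ?case
      using zw neg carrier_Fr_diff[OF zw] by (simp only: cls_add simp_thms)
  qed
  then show ?thesis using z by simp
qed

lemma smult_add_E:
  assumes "s \<in> carrier S" "X \<in> carrier E" "Y \<in> carrier E"
  shows "s \<odot>\<^bsub>E\<^esub> (X \<oplus>\<^bsub>E\<^esub> Y) = s \<odot>\<^bsub>E\<^esub> X \<oplus>\<^bsub>E\<^esub> s \<odot>\<^bsub>E\<^esub> Y"
proof -
  have "scale s (z + w) = scale s z + scale s w" for z w by (simp add: scale_def frag_extend_add)
  with assms show ?thesis
    by (elim carrier_E_cases) (simp only: cls_add cls_smult scale_closed carrier_Fr_add)
qed

lemma smult_zero_E: "s \<in> carrier S \<Longrightarrow> s \<odot>\<^bsub>E\<^esub> \<zero>\<^bsub>E\<^esub> = \<zero>\<^bsub>E\<^esub>"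
  unfolding zero_E by (subst cls_smult) (simp_all add: scale_def)

lemma smult_closed_E: "s \<in> carrier S \<Longrightarrow> X \<in> carrier E \<Longrightarrow> s \<odot>\<^bsub>E\<^esub> X \<in> carrier E"
  by (elim carrier_E_cases) (simp only: cls_smult cls_closed scale_closed)

lemma module_E: "module S E"
proof -
  interpret E: abelian_group E by (rule abelian_group_E)
  show ?thesis
  proof (rule moduleI)
    show "(s \<oplus>\<^bsub>S\<^esub> t) \<odot>\<^bsub>E\<^esub> X = s \<odot>\<^bsub>E\<^esub> X \<oplus>\<^bsub>E\<^esub> t \<odot>\<^bsub>E\<^esub> X"
      if "s \<in> carrier S" "t \<in> carrier S" "X \<in> carrier E" for s t X
      using that(3)
    proof (induction X rule: tensor_induct)
      case (add X Y)
      then show ?case using that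
        by (simp add: smult_add_E smult_closed_E E.a_ac)
    qed (use that in \<open>simp_all add: smult_zero_E tens_add_right S.l_distr\<close>)
    show "(s \<otimes>\<^bsub>S\<^esub> t) \<odot>\<^bsub>E\<^esub> X = s \<odot>\<^bsub>E\<^esub> (t \<odot>\<^bsub>E\<^esub> X)"
      if "s \<in> carrier S" "t \<in> carrier S" "X \<in> carrier E" for s t X
      using that(3) by (induction X rule: tensor_induct)
        (use that in \<open>simp_all add: smult_zero_E S.m_assoc smult_add_E smult_closed_E\<close>)
    show "\<one>\<^bsub>S\<^esub> \<odot>\<^bsub>E\<^esub> X = X" if "X \<in> carrier E" for X
      using that by (induction X rule: tensor_induct) (simp_all add: smult_zero_E smult_add_E)
  qed (simp_all add: smult_closed_E smult_add_E abelian_group_E S.is_cring)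
qed

text \<open>The universal property of the tensor product with target \<open>S\<close>. The free
  group supplies a homomorphism with prescribed values on pairs, and linearity of \<phi> makes it
  vanish on the relations. Applied to coordinate functions it yields the independence of the vectors
  \<open>w \<otimes> 1\<close>.\<close>

lemma extend_functional:
  assumes \<phi>: "\<phi> \<in> carrier M \<rightarrow> carrier S"
    and \<phi>_add: "\<And>x y. x \<in> carrier M \<Longrightarrow> y \<in> carrier M \<Longrightarrow> \<phi> (x \<oplus>\<^bsub>M\<^esub> y) = \<phi> x \<oplus>\<^bsub>S\<^esub> \<phi> y"
    and \<phi>_smult: "\<And>c x. c \<in> carrier R \<Longrightarrow> x \<in> carrier M \<Longrightarrow> \<phi> (c \<odot>\<^bsub>M\<^esub> x) = c \<otimes>\<^bsub>S\<^esub> \<phi> x"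
  obtains \<psi> where "\<psi> \<in> carrier E \<rightarrow> carrier S"
    "\<And>X Y. X \<in> carrier E \<Longrightarrow> Y \<in> carrier E \<Longrightarrow> \<psi> (X \<oplus>\<^bsub>E\<^esub> Y) = \<psi> X \<oplus>\<^bsub>S\<^esub> \<psi> Y"
    "\<And>s X. s \<in> carrier S \<Longrightarrow> X \<in> carrier E \<Longrightarrow> \<psi> (s \<odot>\<^bsub>E\<^esub> X) = s \<otimes>\<^bsub>S\<^esub> \<psi> X"
    "\<And>x a. x \<in> carrier M \<Longrightarrow> a \<in> carrier S \<Longrightarrow> \<psi> (tens x a) = \<phi> x \<otimes>\<^bsub>S\<^esub> a"
proof -
  interpret E: abelian_group E by (rule abelian_group_E)
  have "(\<lambda>(x, a). \<phi> x \<otimes>\<^bsub>S\<^esub> a) ` (carrier M \<times> carrier S) \<subseteq> carrier (add_monoid S)"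
    using \<phi> by auto
  from comm_group.free_Abelian_group_universal[OF S.a_comm_group this]
  obtain h where h: "h \<in> hom Fr (add_monoid S)"
    and "\<And>p. p \<in> carrier M \<times> carrier S \<Longrightarrow> h (frag_of p) = (\<lambda>(x, a). \<phi> x \<otimes>\<^bsub>S\<^esub> a) p"
    by metis
  then have h_of: "h (frag_of (x, a)) = \<phi> x \<otimes>\<^bsub>S\<^esub> a" if "x \<in> carrier M" "a \<in> carrier S" for x a
    using that by force
  interpret h: group_hom Fr "add_monoid S" h
    by (intro group_hom.intro group_hom_axioms.intro group_free_Abelian_group S.add.is_group h)
  have h_closed: "h z \<in> carrier S" if "z \<in> carrier Fr" for z using h.hom_closed[OF that] by simp
  have h_add: "h (z + w) = h z \<oplus>\<^bsub>S\<^esub> h w" if "z \<in> carrier Fr" "w \<in> carrier Fr" for z w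
    using h.hom_mult[OF that] by simp
  have h_diff: "h (z - w) = h z \<ominus>\<^bsub>S\<^esub> h w" if "z \<in> carrier Fr" "w \<in> carrier Fr" for z w
    using h_add[OF carrier_Fr_diff[OF that] that(2)] h_closed that carrier_Fr_diff[OF that]
    by (metis S.add.inv_solve_right S.minus_eq diff_add_cancel)
  have "Rel \<subseteq> kernel Fr (add_monoid S) h"
  proof (rule Rel_subsetI[OF h.subgroup_kernel])
    show "tensor_generators \<subseteq> kernel Fr (add_monoid S) h"
    proof
      fix g assume g: "g \<in> tensor_generators"
      have "h g = \<zero>\<^bsub>S\<^esub>"
        using g unfolding tensor_generators_def
      proof (elim UnE CollectE exE conjE, goal_cases)
        case (1 x y a)
        have "h g = (\<phi> x \<oplus>\<^bsub>S\<^esub> \<phi> y) \<otimes>\<^bsub>S\<^esub> a \<ominus>\<^bsub>S\<^esub> \<phi> x \<otimes>\<^bsub>S\<^esub> a \<ominus>\<^bsub>S\<^esub> \<phi> y \<otimes>\<^bsub>S\<^esub> a"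
          using 1 by (simp add: h_diff h_of carrier_Fr_diff \<phi>_add del: carrier_free_Abelian_group_iff add: frag_of_in_free_Abelian_group)
        moreover have "\<phi> x \<in> carrier S" "\<phi> y \<in> carrier S" using 1 \<phi> by auto
        ultimately show ?case using 1(4) by (simp only:) algebra
      next
        case (2 x a b)
        have "h g = \<phi> x \<otimes>\<^bsub>S\<^esub> (a \<oplus>\<^bsub>S\<^esub> b) \<ominus>\<^bsub>S\<^esub> \<phi> x \<otimes>\<^bsub>S\<^esub> a \<ominus>\<^bsub>S\<^esub> \<phi> x \<otimes>\<^bsub>S\<^esub> b"
          using 2 by (simp add: h_diff h_of carrier_Fr_diff del: carrier_free_Abelian_group_iff add: frag_of_in_free_Abelian_group)
        moreover have "\<phi> x \<in> carrier S" using 2 \<phi> by auto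
        ultimately show ?case using 2(3,4) by (simp only:) algebra
      next
        case (3 c x a)
        then have c: "c \<in> carrier S" using carrier_subset by auto
        have "h g = (c \<otimes>\<^bsub>S\<^esub> \<phi> x) \<otimes>\<^bsub>S\<^esub> a \<ominus>\<^bsub>S\<^esub> \<phi> x \<otimes>\<^bsub>S\<^esub> (c \<otimes>\<^bsub>S\<^esub> a)"
          using 3 c by (simp add: h_diff h_of \<phi>_smult del: carrier_free_Abelian_group_iff add: frag_of_in_free_Abelian_group)
        moreover have "\<phi> x \<in> carrier S" using 3 \<phi> by auto
        ultimately show ?case using 3(4) c by (simp only:) algebra
      qed
      moreover have "g \<in> carrier Fr" using g tensor_generators_subset by blast
      ultimately show "g \<in> kernel Fr (add_monoid S) h" by (simp add: kernel_def)
    qed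
  qed
  then have h_Rel: "h z = \<zero>\<^bsub>S\<^esub>" if "z \<in> Rel" for z using that by (auto simp: kernel_def)
  \<comment> \<open>The choice of representative is immaterial, since \<open>h\<close> vanishes on
    \<open>Rel\<close>.\<close>
  define \<psi> where "\<psi> X = h (SOME z. z \<in> carrier Fr \<and> X = cls z)" for X
  have \<psi>: "\<psi> (cls z) = h z" if z: "z \<in> carrier Fr" for z
  proof -
    define w where "w = (SOME w. w \<in> carrier Fr \<and> cls z = cls w)"
    have w: "w \<in> carrier Fr \<and> cls z = cls w"
      unfolding w_def by (rule someI[of _ z]) (use z in simp)
    then have "z - w \<in> Rel" by (simp add: cls_eq_iff)
    then have "h z \<ominus>\<^bsub>S\<^esub> h w = \<zero>\<^bsub>S\<^esub>" using h_diff[of z w] h_Rel z w by simp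
    then have "h z = h w" using h_closed z w by simp
    then show ?thesis by (simp add: \<psi>_def w_def)
  qed
  show thesis
  proof
    show "\<psi> \<in> carrier E \<rightarrow> carrier S"
      by (rule Pi_I, elim carrier_E_cases) (simp only: \<psi> h_closed)
    show tens: "\<psi> (tens x a) = \<phi> x \<otimes>\<^bsub>S\<^esub> a" if "x \<in> carrier M" "a \<in> carrier S" for x a
      unfolding tens_def using that by (subst \<psi>) (simp_all add: h_of)
    show add: "\<psi> (X \<oplus>\<^bsub>E\<^esub> Y) = \<psi> X \<oplus>\<^bsub>S\<^esub> \<psi> Y" if "X \<in> carrier E" "Y \<in> carrier E" for X Y
      using that by (elim carrier_E_cases) (simp only: cls_add \<psi> h_add carrier_Fr_add)
    have closed: "\<psi> X \<in> carrier S" if "X \<in> carrier E" for X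
      using that by (elim carrier_E_cases) (simp only: \<psi> h_closed)
    show "\<psi> (s \<odot>\<^bsub>E\<^esub> X) = s \<otimes>\<^bsub>S\<^esub> \<psi> X" if s: "s \<in> carrier S" and X: "X \<in> carrier E" for s X
      using X
    proof (induction X rule: tensor_induct)
      case zero
      have "\<psi> \<zero>\<^bsub>E\<^esub> = \<zero>\<^bsub>S\<^esub>" using \<psi>[of 0] h_Rel[OF Rel_zero] by (simp add: zero_E)
      then show ?case using s by (simp add: smult_zero_E)
    next
      case (tens x a)
      then have "\<phi> x \<in> carrier S" using \<phi> by auto
      with tens show ?case using s by (simp add: \<open>\<And>x a. _ \<Longrightarrow> _ \<Longrightarrow> \<psi> (tens x a) = _\<close> S.m_lcomm)
    next
      case (add X Y)
      then show ?case using s closed by (simp add: smult_add_E smult_closed_E \<open>\<And>X Y. _ \<Longrightarrow> _ \<Longrightarrow> \<psi> (X \<oplus>\<^bsub>E\<^esub> Y) = _\<close> S.r_distr)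
    qed
  qed
qed

end

section \<open>Extension of a linear map to the tensor products\<close>

locale scalar_extension_hom = M: scalar_extension R M S + N: scalar_extension R N S + f: mod_hom R M N f
  for R :: "'a ring" and M :: "('a, 'c) module" and N :: "('a, 'd) module" and S :: "'a ring"
    and f :: "'c \<Rightarrow> 'd"
begin

abbreviation "fS \<equiv> extend_map R S N f"

lemma push_Rel:
  assumes "z \<in> M.Rel"
  shows "frag_extend (\<lambda>(x, a). frag_of (f x, a)) z \<in> N.Rel"
proof -
  have "M.Rel \<subseteq> {z \<in> carrier M.Fr. frag_extend (\<lambda>(x, a). frag_of (f x, a)) z \<in> N.Rel}"
  proof (rule M.Rel_subsetI[OF M.subgroup_vimage_frag_extend[OF N.subgroup_Rel]], intro subsetI CollectI conjI)
    fix g assume g: "g \<in> M.tensor_generators"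
    then show "g \<in> carrier M.Fr" using M.tensor_generators_subset by blast
    have "frag_extend (\<lambda>(x, a). frag_of (f x, a)) g \<in> N.tensor_generators"
      using g unfolding M.tensor_generators_def N.tensor_generators_def
    proof (elim UnE CollectE exE conjE, goal_cases)
      case (1 x y a)
      then show ?case by (intro UnI1 CollectI exI[of _ "f x"] exI[of _ "f y"] exI[of _ a])
        (simp add: frag_extend_diff)
    next
      case (2 x a b)
      then show ?case by (intro UnI1[OF UnI2] CollectI exI[of _ "f x"] exI[of _ a] exI[of _ b])
        (simp add: frag_extend_diff)
    next
      case (3 c x a)
      then show ?case by (intro UnI2 CollectI exI[of _ c] exI[of _ "f x"] exI[of _ a])
        (simp add: frag_extend_diff)
    qed
    then show "frag_extend (\<lambda>(x, a). frag_of (f x, a)) g \<in> N.Rel" by (rule N.generator_in_Rel)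
  qed
  then show ?thesis using assms by blast
qed

lemma extend_map_cls:
  "z \<in> carrier M.Fr \<Longrightarrow> fS (M.cls z) = N.cls (frag_extend (\<lambda>(x, a). frag_of (f x, a)) z)"
  unfolding extend_map_def by (rule M.cls_UN) (simp_all add: push_Rel N.cls_eq_iff)

lemma extend_map_closed: "X \<in> carrier M.E \<Longrightarrow> fS X \<in> carrier N.E"
proof (elim M.carrier_E_cases)
  fix z assume "z \<in> carrier M.Fr" "X = M.cls z"
  moreover from this have "frag_extend (\<lambda>(x, a). frag_of (f x, a)) z \<in> carrier N.Fr"
    by (intro M.frag_extend_closed) auto
  ultimately show ?thesis by (simp only: extend_map_cls N.cls_closed)
qed

lemma extend_map_tens:
  "x \<in> carrier M \<Longrightarrow> a \<in> carrier S \<Longrightarrow> fS (M.tens x a) = N.tens (f x) a"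
  unfolding M.tens_def N.tens_def by (subst extend_map_cls) simp_all

lemma extend_map_add:
  assumes "X \<in> carrier M.E" "Y \<in> carrier M.E"
  shows "fS (X \<oplus>\<^bsub>M.E\<^esub> Y) = fS X \<oplus>\<^bsub>N.E\<^esub> fS Y"
proof -
  have "frag_extend (\<lambda>(x, a). frag_of (f x, a)) z \<in> carrier N.Fr" if "z \<in> carrier M.Fr" for z
    using that by (intro M.frag_extend_closed) auto
  with assms show ?thesis
    by (elim M.carrier_E_cases) (simp only: extend_map_cls M.cls_add N.cls_add M.carrier_Fr_add frag_extend_add)
qed

lemma extend_map_zero: "fS \<zero>\<^bsub>M.E\<^esub> = \<zero>\<^bsub>N.E\<^esub>"
  unfolding M.zero_E N.zero_E by (subst extend_map_cls) simp_all

lemma mod_hom_extend_map: "mod_hom S M.E N.E fS"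
proof (intro mod_hom.intro mod_hom_axioms.intro M.module_E N.module_E)
  have "fS (s \<odot>\<^bsub>M.E\<^esub> X) = s \<odot>\<^bsub>N.E\<^esub> fS X" if s: "s \<in> carrier S" and X: "X \<in> carrier M.E" for s X
    using X
  proof (induction X rule: M.tensor_induct)
    case zero
    then show ?case using s by (simp add: M.smult_zero_E N.smult_zero_E extend_map_zero)
  next
    case (tens x a)
    then show ?case using s by (simp add: extend_map_tens)
  next
    case (add X Y)
    then show ?case using s
      by (simp add: M.smult_add_E N.smult_add_E extend_map_add extend_map_closed M.smult_closed_E)
  qed
  then show "fS \<in> module_hom S M.E N.E"
    by (simp add: module_hom_def extend_map_closed extend_map_add)
qed

end

text \<open>From here on the field is used through its abstract ring structure; rewriting its
  operations into functions would get in the way of the module laws.\<close>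

declare mult_novikov [simp del] add_novikov [simp del] zero_novikov [simp del]

section \<open>Linear combinations of lists\<close>

text \<open>Coefficients are attached to positions rather than to vectors as in
  \<open>lincomb\<close>, so that lists with repetitions, such as the image of a basis under a
  linear map, are covered.\<close>

definition lcomb :: "('a, 'c, 'd) module_scheme \<Rightarrow> (nat \<Rightarrow> 'a) \<Rightarrow> 'c list \<Rightarrow> 'c" where
  "lcomb V a ws = (\<Oplus>\<^bsub>V\<^esub>i\<in>{..<length ws}. a i \<odot>\<^bsub>V\<^esub> (ws ! i))"

lemma Pi_lessThan_Suc: "a \<in> {..<Suc n} \<rightarrow> A \<longleftrightarrow> a \<in> {..<n} \<rightarrow> A \<and> a n \<in> A"
  by (auto simp: Pi_def less_Suc_eq)

context module
begin

lemma nth_in_carrier: "set ws \<subseteq> carrier M \<Longrightarrow> i < length ws \<Longrightarrow> ws ! i \<in> carrier M"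
  using nth_mem by blast

lemma lcomb_Nil [simp]: "lcomb M a [] = \<zero>\<^bsub>M\<^esub>"
  by (simp add: lcomb_def)

lemma lcomb_closed [intro]:
  assumes "set ws \<subseteq> carrier M" "a \<in> {..<length ws} \<rightarrow> carrier R"
  shows "lcomb M a ws \<in> carrier M"
  unfolding lcomb_def by (rule M.finsum_closed) (use assms nth_in_carrier in auto)

lemma lcomb_cong:
  assumes "set ws \<subseteq> carrier M" "b \<in> {..<length ws} \<rightarrow> carrier R" "\<And>i. i < length ws \<Longrightarrow> a i = b i"
  shows "lcomb M a ws = lcomb M b ws"
  unfolding lcomb_def by (rule M.finsum_cong') (use assms nth_in_carrier in auto)

lemma lcomb_snoc:
  assumes "set ws \<subseteq> carrier M" "w \<in> carrier M" "a \<in> {..<Suc (length ws)} \<rightarrow> carrier R"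
  shows "lcomb M a (ws @ [w]) = lcomb M a ws \<oplus>\<^bsub>M\<^esub> a (length ws) \<odot>\<^bsub>M\<^esub> w"
proof -
  have *: "(\<lambda>i. a i \<odot>\<^bsub>M\<^esub> (ws @ [w]) ! i) \<in> {..<length ws} \<rightarrow> carrier M"
    using assms nth_in_carrier by (auto simp: nth_append Pi_lessThan_Suc)
  have "lcomb M a (ws @ [w]) =
    a (length ws) \<odot>\<^bsub>M\<^esub> w \<oplus>\<^bsub>M\<^esub> (\<Oplus>\<^bsub>M\<^esub>i\<in>{..<length ws}. a i \<odot>\<^bsub>M\<^esub> ((ws @ [w]) ! i))"
    unfolding lcomb_def using assms * by (simp add: lessThan_Suc Pi_lessThan_Suc)
  also have "(\<Oplus>\<^bsub>M\<^esub>i\<in>{..<length ws}. a i \<odot>\<^bsub>M\<^esub> ((ws @ [w]) ! i)) = lcomb M a ws"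
    unfolding lcomb_def
    by (rule M.finsum_cong') (use assms nth_in_carrier in \<open>auto simp: nth_append Pi_lessThan_Suc\<close>)
  finally show ?thesis
    using assms lcomb_closed[of ws a] by (simp add: M.a_comm Pi_lessThan_Suc)
qed

lemma lcomb_add:
  assumes "set ws \<subseteq> carrier M" "a \<in> {..<length ws} \<rightarrow> carrier R" "b \<in> {..<length ws} \<rightarrow> carrier R"
  shows "lcomb M (\<lambda>i. a i \<oplus>\<^bsub>R\<^esub> b i) ws = lcomb M a ws \<oplus>\<^bsub>M\<^esub> lcomb M b ws"
proof -
  have "lcomb M (\<lambda>i. a i \<oplus>\<^bsub>R\<^esub> b i) ws =
    (\<Oplus>\<^bsub>M\<^esub>i\<in>{..<length ws}. a i \<odot>\<^bsub>M\<^esub> (ws ! i) \<oplus>\<^bsub>M\<^esub> b i \<odot>\<^bsub>M\<^esub> (ws ! i))"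
    unfolding lcomb_def
    by (rule M.finsum_cong') (use assms nth_in_carrier in \<open>auto simp: smult_l_distr Pi_iff\<close>)
  also have "\<dots> = lcomb M a ws \<oplus>\<^bsub>M\<^esub> lcomb M b ws"
    unfolding lcomb_def by (rule M.finsum_addf) (use assms nth_in_carrier in auto)
  finally show ?thesis .
qed

lemma lcomb_smult:
  assumes "set ws \<subseteq> carrier M" "a \<in> {..<length ws} \<rightarrow> carrier R" "c \<in> carrier R"
  shows "lcomb M (\<lambda>i. c \<otimes>\<^bsub>R\<^esub> a i) ws = c \<odot>\<^bsub>M\<^esub> lcomb M a ws"
proof -
  have "lcomb M (\<lambda>i. c \<otimes>\<^bsub>R\<^esub> a i) ws = (\<Oplus>\<^bsub>M\<^esub>i\<in>{..<length ws}. c \<odot>\<^bsub>M\<^esub> (a i \<odot>\<^bsub>M\<^esub> (ws ! i)))"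
    unfolding lcomb_def
    by (rule M.finsum_cong') (use assms nth_in_carrier in \<open>auto simp: smult_assoc1 Pi_iff\<close>)
  also have "\<dots> = c \<odot>\<^bsub>M\<^esub> lcomb M a ws"
    unfolding lcomb_def by (rule finsum_smult[symmetric]) (use assms nth_in_carrier in auto)
  finally show ?thesis .
qed

lemma lcomb_diff:
  assumes "set ws \<subseteq> carrier M" "a \<in> {..<length ws} \<rightarrow> carrier R" "b \<in> {..<length ws} \<rightarrow> carrier R"
  shows "lcomb M (\<lambda>i. a i \<ominus>\<^bsub>R\<^esub> b i) ws = lcomb M a ws \<ominus>\<^bsub>M\<^esub> lcomb M b ws"
proof -
  have "lcomb M (\<lambda>i. a i \<ominus>\<^bsub>R\<^esub> b i) ws = lcomb M (\<lambda>i. a i \<oplus>\<^bsub>R\<^esub> (\<ominus>\<^bsub>R\<^esub> \<one>\<^bsub>R\<^esub>) \<otimes>\<^bsub>R\<^esub> b i) ws"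
    by (rule lcomb_cong) (use assms in \<open>auto simp: Pi_iff R.minus_eq R.l_minus\<close>)
  also have "\<dots> = lcomb M a ws \<oplus>\<^bsub>M\<^esub> (\<ominus>\<^bsub>R\<^esub> \<one>\<^bsub>R\<^esub>) \<odot>\<^bsub>M\<^esub> lcomb M b ws"
    using assms by (subst lcomb_add) (auto simp: Pi_iff lcomb_smult)
  also have "\<dots> = lcomb M a ws \<ominus>\<^bsub>M\<^esub> lcomb M b ws"
    using lcomb_closed[OF assms(1,3)] by (simp add: M.minus_eq smult_l_minus)
  finally show ?thesis .
qed

lemma lcomb_zero:
  assumes "set ws \<subseteq> carrier M" "\<And>i. i < length ws \<Longrightarrow> a i = \<zero>\<^bsub>R\<^esub>"
  shows "lcomb M a ws = \<zero>\<^bsub>M\<^esub>"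
  unfolding lcomb_def by (rule M.add.finprod_one_eqI) (use assms nth_in_carrier in auto)

lemma lcomb_unit:
  assumes "set ws \<subseteq> carrier M" "i < length ws" "c \<in> carrier R"
  shows "lcomb M (\<lambda>j. if j = i then c else \<zero>\<^bsub>R\<^esub>) ws = c \<odot>\<^bsub>M\<^esub> (ws ! i)"
proof -
  have "lcomb M (\<lambda>j. if j = i then c else \<zero>\<^bsub>R\<^esub>) ws =
    (\<Oplus>\<^bsub>M\<^esub>j\<in>{..<length ws}. if i = j then c \<odot>\<^bsub>M\<^esub> (ws ! j) else \<zero>\<^bsub>M\<^esub>)"
    unfolding lcomb_def by (rule M.finsum_cong') (use assms nth_in_carrier in auto)
  also have "\<dots> = c \<odot>\<^bsub>M\<^esub> (ws ! i)"
    by (rule M.add.finprod_singleton) (use assms nth_in_carrier in auto)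
  finally show ?thesis .
qed

lemma lcomb_append:
  assumes "set us \<subseteq> carrier M" "set xs \<subseteq> carrier M" "a \<in> {..<length us + length xs} \<rightarrow> carrier R"
  shows "lcomb M a (us @ xs) = lcomb M a us \<oplus>\<^bsub>M\<^esub> lcomb M (\<lambda>i. a (length us + i)) xs"
  using assms(2,3)
proof (induction xs rule: rev_induct)
  case Nil
  then show ?case using lcomb_closed[of us a] assms(1) by simp
next
  case (snoc x xs)
  have c: "lcomb M a us \<in> carrier M" "lcomb M (\<lambda>i. a (length us + i)) xs \<in> carrier M"
    "a (length us + length xs) \<in> carrier R" "x \<in> carrier M" "set xs \<subseteq> carrier M"
    using snoc.prems assms(1) by (auto intro!: lcomb_closed)
  have "lcomb M a (us @ xs @ [x]) = lcomb M a (us @ xs) \<oplus>\<^bsub>M\<^esub> a (length us + length xs) \<odot>\<^bsub>M\<^esub> x"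
    using lcomb_snoc[of "us @ xs" x a] snoc.prems assms(1) by simp
  also have "lcomb M a (us @ xs) = lcomb M a us \<oplus>\<^bsub>M\<^esub> lcomb M (\<lambda>i. a (length us + i)) xs"
    using snoc.prems by (intro snoc.IH) auto
  finally show ?case
    using c snoc.prems by (subst lcomb_snoc) (auto simp: M.a_assoc)
qed

text \<open>Change of coordinates: the row \<open>a\<close> is multiplied by the matrix
  \<open>P\<close>.\<close>

lemma lcomb_lcomb:
  assumes us: "set us \<subseteq> carrier M" and ws: "set ws \<subseteq> carrier M"
    and "a \<in> {..<length ws} \<rightarrow> carrier R"
    and "\<And>j. j < length ws \<Longrightarrow> P j \<in> {..<length us} \<rightarrow> carrier R"
    and "\<And>j. j < length ws \<Longrightarrow> ws ! j = lcomb M (P j) us"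
  shows "lcomb M a ws = lcomb M (\<lambda>i. \<Oplus>\<^bsub>R\<^esub>j\<in>{..<length ws}. a j \<otimes>\<^bsub>R\<^esub> P j i) us"
  using assms(2-)
proof (induction ws rule: rev_induct)
  case Nil
  then show ?case using us by (simp add: lcomb_zero)
next
  case (snoc w ws)
  let ?n = "length ws"
  have a: "a \<in> {..<?n} \<rightarrow> carrier R" "a ?n \<in> carrier R" using snoc.prems(2) by (auto simp: Pi_lessThan_Suc)
  have P: "P j \<in> {..<length us} \<rightarrow> carrier R" if "j \<le> ?n" for j using snoc.prems(3)[of j] that by auto
  have w: "w = lcomb M (P ?n) us" using snoc.prems(4)[of ?n] by simp
  have w': "w \<in> carrier M" "set ws \<subseteq> carrier M" using snoc.prems(1) by auto
  let ?s = "\<lambda>n i. \<Oplus>\<^bsub>R\<^esub>j\<in>{..<n}. a j \<otimes>\<^bsub>R\<^esub> P j i"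
  have s: "?s ?n i \<in> carrier R" if "i < length us" for i
    using a P that by (intro R.finsum_closed) (auto simp: Pi_iff)
  have eq: "ws ! j = lcomb M (P j) us" if "j < ?n" for j
    using snoc.prems(4)[of j] that by (simp add: nth_append)
  have IH: "lcomb M a ws = lcomb M (?s ?n) us"
    by (intro snoc.IH) (use eq a P w' in auto)
  have "lcomb M a (ws @ [w]) = lcomb M (?s ?n) us \<oplus>\<^bsub>M\<^esub> a ?n \<odot>\<^bsub>M\<^esub> lcomb M (P ?n) us"
    using lcomb_snoc[of ws w a] snoc.prems(2) w' by (simp add: IH w[symmetric])
  also have "\<dots> = lcomb M (\<lambda>i. ?s ?n i \<oplus>\<^bsub>R\<^esub> a ?n \<otimes>\<^bsub>R\<^esub> P ?n i) us"
    using us a P s by (subst lcomb_add) (auto simp: lcomb_smult Pi_iff)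
  also have "\<dots> = lcomb M (?s (length (ws @ [w]))) us"
  proof (rule lcomb_cong[OF us])
    fix i assume i: "i < length us"
    have "?s (Suc ?n) i = a ?n \<otimes>\<^bsub>R\<^esub> P ?n i \<oplus>\<^bsub>R\<^esub> ?s ?n i"
      unfolding lessThan_Suc using a P i by (intro R.finsum_insert) (auto simp: Pi_iff)
    then show "?s ?n i \<oplus>\<^bsub>R\<^esub> a ?n \<otimes>\<^bsub>R\<^esub> P ?n i = ?s (length (ws @ [w])) i"
      using s[OF i] a P i by (simp add: R.a_comm Pi_iff)
  next
    show "?s (length (ws @ [w])) \<in> {..<length us} \<rightarrow> carrier R"
      using a P by (intro Pi_I R.finsum_closed) (auto simp: Pi_iff less_Suc_eq)
  qed
  finally show ?case .
qed

text \<open>\<open>finsum\<close> takes the whole record with its carrier as a parameter, so sums in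
  \<open>md N\<close> and in \<open>M\<close> are compared step by step along the list.\<close>

lemma lcomb_submodule:
  assumes N: "submodule R N M" and "set ws \<subseteq> N" "a \<in> {..<length ws} \<rightarrow> carrier R"
  shows "lcomb M a ws \<in> N" "lcomb (md N) a ws = lcomb M a ws"
proof -
  interpret N: module R "md N" using N by (rule submodule_is_module)
  have sub: "N \<subseteq> carrier M" using N by (rule submodule.subset)
  from assms(2,3) have "lcomb M a ws \<in> N \<and> lcomb (md N) a ws = lcomb M a ws"
  proof (induction ws rule: rev_induct)
    case Nil
    then show ?case using submodule.zero_closed[OF N] N.lcomb_Nil by simp
  next
    case (snoc w ws)
    have IH: "lcomb M a ws \<in> N" "lcomb (md N) a ws = lcomb M a ws"
      using snoc by (auto simp: Pi_lessThan_Suc)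
    have "lcomb M a (ws @ [w]) = lcomb M a ws \<oplus>\<^bsub>M\<^esub> a (length ws) \<odot>\<^bsub>M\<^esub> w"
      using snoc.prems sub by (intro lcomb_snoc) auto
    moreover have "lcomb (md N) a (ws @ [w]) = lcomb (md N) a ws \<oplus>\<^bsub>md N\<^esub> a (length ws) \<odot>\<^bsub>md N\<^esub> w"
      using snoc.prems by (intro N.lcomb_snoc) auto
    moreover have "a (length ws) \<odot>\<^bsub>M\<^esub> w \<in> N"
      using snoc.prems by (intro submodule.smult_closed[OF N]) auto
    ultimately show ?case using IH submodule.m_closed[OF N] by simp
  qed
  then show "lcomb M a ws \<in> N" "lcomb (md N) a ws = lcomb M a ws" by auto
qed

lemma span_set_eq:
  assumes ws: "set ws \<subseteq> carrier M"
  shows "span (set ws) = {lcomb M a ws | a. a \<in> {..<length ws} \<rightarrow> carrier R}" (is "_ = ?L")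
proof
  have "submodule R ?L M"
  proof (rule submodule.intro)
    show "module R M" by unfold_locales
    show "?L \<subseteq> carrier M" using lcomb_closed[OF ws] by auto
    show "v \<oplus>\<^bsub>M\<^esub> w \<in> ?L" if vw: "v \<in> ?L" "w \<in> ?L" for v w
    proof -
      obtain a b where ab: "v = lcomb M a ws" "w = lcomb M b ws"
        "a \<in> {..<length ws} \<rightarrow> carrier R" "b \<in> {..<length ws} \<rightarrow> carrier R" using vw by auto
      then have "v \<oplus>\<^bsub>M\<^esub> w = lcomb M (\<lambda>i. a i \<oplus>\<^bsub>R\<^esub> b i) ws" by (simp add: lcomb_add[OF ws])
      moreover have "(\<lambda>i. a i \<oplus>\<^bsub>R\<^esub> b i) \<in> {..<length ws} \<rightarrow> carrier R" using ab by auto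
      ultimately show ?thesis by blast
    qed
    show "\<zero>\<^bsub>M\<^esub> \<in> ?L"
      using lcomb_zero[OF ws, of "\<lambda>_. \<zero>\<^bsub>R\<^esub>"] by (intro CollectI exI[of _ "\<lambda>_. \<zero>\<^bsub>R\<^esub>"]) auto
    show "c \<odot>\<^bsub>M\<^esub> v \<in> ?L" if cv: "c \<in> carrier R" "v \<in> ?L" for c v
    proof -
      obtain a where a: "v = lcomb M a ws" "a \<in> {..<length ws} \<rightarrow> carrier R" using cv by auto
      then have "c \<odot>\<^bsub>M\<^esub> v = lcomb M (\<lambda>i. c \<otimes>\<^bsub>R\<^esub> a i) ws" using cv by (simp add: lcomb_smult[OF ws])
      moreover have "(\<lambda>i. c \<otimes>\<^bsub>R\<^esub> a i) \<in> {..<length ws} \<rightarrow> carrier R" using a cv by auto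
      ultimately show ?thesis by blast
    qed
  qed
  moreover have "set ws \<subseteq> ?L"
  proof
    fix w assume "w \<in> set ws"
    then obtain i where i: "i < length ws" "w = ws ! i" by (auto simp: in_set_conv_nth)
    then have "w = lcomb M (\<lambda>j. if j = i then \<one>\<^bsub>R\<^esub> else \<zero>\<^bsub>R\<^esub>) ws"
      using lcomb_unit[OF ws, of i "\<one>\<^bsub>R\<^esub>"] nth_in_carrier[OF ws] by simp
    then show "w \<in> ?L" by (intro CollectI exI[of _ "\<lambda>j. if j = i then \<one>\<^bsub>R\<^esub> else \<zero>\<^bsub>R\<^esub>"]) auto
  qed
  ultimately show "span (set ws) \<subseteq> ?L" by (rule span_is_subset[rotated])
  show "?L \<subseteq> span (set ws)"
    using lcomb_submodule(1)[OF span_is_submodule[OF ws] in_own_span[OF ws]] by auto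
qed

lemma span_set_cases:
  assumes "set ws \<subseteq> carrier M" "v \<in> span (set ws)"
  obtains a where "a \<in> {..<length ws} \<rightarrow> carrier R" "v = lcomb M a ws"
  using assms span_set_eq by auto

text \<open>The bridge to the combinations indexed by sets that underlie \<open>lin_indpt\<close>;
  distinctness matches positions with vectors.\<close>

lemma lincomb_eq_lcomb:
  assumes "set ws \<subseteq> carrier M" "distinct ws" "a \<in> set ws \<rightarrow> carrier R"
  shows "lincomb a (set ws) = lcomb M (\<lambda>i. a (ws ! i)) ws"
proof -
  have inj: "inj_on ((!) ws) {..<length ws}" using assms(2) by (simp add: inj_on_nth)
  have img: "(!) ws ` {..<length ws} = set ws" by (auto simp: set_conv_nth)
  have f: "(\<lambda>v. a v \<odot>\<^bsub>M\<^esub> v) \<in> (!) ws ` {..<length ws} \<rightarrow> carrier M"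
    unfolding img using assms by auto
  show ?thesis
    unfolding lincomb_def lcomb_def using M.finsum_reindex[OF f inj] by (simp only: img)
qed

end

lemma (in mod_hom) hom_lcomb:
  assumes "set ws \<subseteq> carrier M" "a \<in> {..<length ws} \<rightarrow> carrier R"
  shows "f (lcomb M a ws) = lcomb N a (map f ws)"
  using assms
proof (induction ws rule: rev_induct)
  case Nil
  then show ?case by (simp add: M.lcomb_Nil N.lcomb_Nil)
next
  case (snoc w ws)
  have "f (lcomb M a (ws @ [w])) = f (lcomb M a ws \<oplus>\<^bsub>M\<^esub> a (length ws) \<odot>\<^bsub>M\<^esub> w)"
    using snoc.prems by (subst M.lcomb_snoc) auto
  also have "\<dots> = lcomb N a (map f ws) \<oplus>\<^bsub>N\<^esub> a (length ws) \<odot>\<^bsub>N\<^esub> f w"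
    using snoc M.lcomb_closed[of ws a] by (auto simp: Pi_lessThan_Suc)
  also have "\<dots> = lcomb N a (map f ws @ [f w])"
    using snoc.prems by (subst N.lcomb_snoc) auto
  finally show ?case by simp
qed

section \<open>Orthogonal bases\<close>

lemma orthogonal_lcomb:
  "orthogonal \<Gamma> C \<l> ws \<longleftrightarrow> set ws \<subseteq> carrier C \<and>
    (\<forall>a \<in> {..<length ws} \<rightarrow> carrier (novikov \<Gamma>).
      \<l> (lcomb C a ws) = (SUP i\<in>{..<length ws}. \<l> (a i \<odot>\<^bsub>C\<^esub> (ws ! i))))"
  by (simp add: orthogonal_def lcomb_def)

context nonarch_normed_space
begin

abbreviation K :: "(real \<Rightarrow> 'k) ring" where "K \<equiv> novikov \<Gamma>"

lemma level_zero [simp]: "\<l> \<zero>\<^bsub>C\<^esub> = -\<infinity>"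
  using level_eq_MInfty_iff by simp

lemma level_real:
  assumes "x \<in> carrier C" "x \<noteq> \<zero>\<^bsub>C\<^esub>"
  obtains r where "\<l> x = ereal r"
  using assms level_not_PInfty level_eq_MInfty_iff by (metis ereal_cases)

lemma level_smult_mono:
  assumes "c \<in> carrier K" "x \<in> carrier C" "y \<in> carrier C" "\<l> x \<le> \<l> y"
  shows "\<l> (c \<odot>\<^bsub>C\<^esub> x) \<le> \<l> (c \<odot>\<^bsub>C\<^esub> y)"
  using assms by (simp add: level_smult ereal_minus_mono)

text \<open>The scalar \<open>- 1\<close> is a monomial with exponent \<open>0\<close>, hence of
  valuation \<open>0\<close>. One inequality, applied to \<open>x\<close> and to its negative, gives
  equality.\<close>

lemma level_uminus [simp]:
  assumes x: "x \<in> carrier C"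
  shows "\<l> (\<ominus>\<^bsub>C\<^esub> x) = \<l> x"
proof -
  have le: "\<l> (\<ominus>\<^bsub>C\<^esub> x) \<le> \<l> x" if "x \<in> carrier C" for x
  proof -
    let ?m = "\<ominus>\<^bsub>K\<^esub> \<one>\<^bsub>K\<^esub>"
    have "?m g = (if g = 0 then - 1 else 0)" for g
    proof -
      have "\<one>\<^bsub>K\<^esub> \<oplus>\<^bsub>K\<^esub> ?m = \<zero>\<^bsub>K\<^esub>" using R.r_neg[OF R.one_closed] .
      then have "\<one>\<^bsub>K\<^esub> g + ?m g = 0" by (simp add: fun_eq_iff add_novikov zero_novikov)
      then show ?thesis by (simp add: one_novikov add_eq_0_iff split: if_splits)
    qed
    then have "?m = nov_monom (- 1) 0" by (auto simp: nov_monom_def fun_eq_iff)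
    then have "nov_val ?m = ereal 0" by (simp add: nov_val_monom del: ereal_eq_0)
    moreover have "\<ominus>\<^bsub>C\<^esub> x = ?m \<odot>\<^bsub>C\<^esub> x" using that by (simp add: smult_l_minus)
    ultimately show ?thesis using that by (simp add: level_smult zero_ereal_def[symmetric])
  qed
  show ?thesis using le[of x] le[of "\<ominus>\<^bsub>C\<^esub> x"] x by (simp add: order.antisym)
qed

lemma level_diff: "x \<in> carrier C \<Longrightarrow> y \<in> carrier C \<Longrightarrow> \<l> (x \<ominus>\<^bsub>C\<^esub> y) \<le> max (\<l> x) (\<l> y)"
  using level_add[of x "\<ominus>\<^bsub>C\<^esub> y"] by (simp add: M.minus_eq)

lemma level_add_le: "x \<in> carrier C \<Longrightarrow> y \<in> carrier C \<Longrightarrow> \<l> x \<le> s \<Longrightarrow> \<l> y \<le> s \<Longrightarrow> \<l> (x \<oplus>\<^bsub>C\<^esub> y) \<le> s"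
  using level_add[of x y] by (metis max.bounded_iff order.trans)

lemma level_diff_le: "x \<in> carrier C \<Longrightarrow> y \<in> carrier C \<Longrightarrow> \<l> x \<le> s \<Longrightarrow> \<l> y \<le> s \<Longrightarrow> \<l> (x \<ominus>\<^bsub>C\<^esub> y) \<le> s"
  using level_diff[of x y] by (metis max.bounded_iff order.trans)

lemma level_lcomb_le:
  assumes "set ws \<subseteq> carrier C" "a \<in> {..<length ws} \<rightarrow> carrier K"
    and "\<And>i. i < length ws \<Longrightarrow> \<l> (a i \<odot>\<^bsub>C\<^esub> (ws ! i)) \<le> s"
  shows "\<l> (lcomb C a ws) \<le> s"
  using assms
proof (induction ws rule: rev_induct)
  case (snoc w ws)
  have "\<l> (lcomb C a ws) \<le> s"
  proof (rule snoc.IH)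
    show "\<l> (a i \<odot>\<^bsub>C\<^esub> (ws ! i)) \<le> s" if "i < length ws" for i
      using snoc.prems(3)[of i] that by (simp add: nth_append)
  qed (use snoc.prems in auto)
  moreover have "\<l> (a (length ws) \<odot>\<^bsub>C\<^esub> w) \<le> s" using snoc.prems(3)[of "length ws"] by simp
  moreover have "lcomb C a ws \<in> carrier C" "a (length ws) \<odot>\<^bsub>C\<^esub> w \<in> carrier C"
    using snoc.prems by (auto intro!: lcomb_closed)
  ultimately show ?case using snoc.prems by (subst lcomb_snoc) (auto intro: level_add_le)
qed simp

text \<open>The level of a sum never exceeds the maximum over its terms, so orthogonality only has
  to exclude cancellation: no term may exceed the sum.\<close>

lemma orthogonal_iff:
  assumes ws: "set ws \<subseteq> carrier C"
  shows "orthogonal \<Gamma> C \<l> ws \<longleftrightarrow>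
    (\<forall>a \<in> {..<length ws} \<rightarrow> carrier K. \<forall>i<length ws. \<l> (a i \<odot>\<^bsub>C\<^esub> (ws ! i)) \<le> \<l> (lcomb C a ws))"
  (is "_ \<longleftrightarrow> ?r")
proof
  assume "orthogonal \<Gamma> C \<l> ws"
  then show ?r by (auto simp: orthogonal_lcomb intro: SUP_upper)
next
  assume ?r
  have "\<l> (lcomb C a ws) = (SUP i\<in>{..<length ws}. \<l> (a i \<odot>\<^bsub>C\<^esub> (ws ! i)))"
    if a: "a \<in> {..<length ws} \<rightarrow> carrier K" for a
  proof (rule order.antisym)
    show "\<l> (lcomb C a ws) \<le> (SUP i\<in>{..<length ws}. \<l> (a i \<odot>\<^bsub>C\<^esub> (ws ! i)))"
      by (rule level_lcomb_le[OF ws a]) (auto intro: SUP_upper)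
    show "(SUP i\<in>{..<length ws}. \<l> (a i \<odot>\<^bsub>C\<^esub> (ws ! i))) \<le> \<l> (lcomb C a ws)"
      by (rule SUP_least) (use \<open>?r\<close> a in auto)
  qed
  then show "orthogonal \<Gamma> C \<l> ws" using ws by (simp add: orthogonal_lcomb)
qed

lemma orthogonal_le:
  assumes "orthogonal \<Gamma> C \<l> ws" "a \<in> {..<length ws} \<rightarrow> carrier K" "i < length ws"
  shows "\<l> (a i \<odot>\<^bsub>C\<^esub> (ws ! i)) \<le> \<l> (lcomb C a ws)"
  using assms orthogonal_iff[of ws] by (auto simp: orthogonal_lcomb)

text \<open>If the sum has level \<open>-\<infinity>\<close>, so has each term. The vectors
  themselves have finite level, so the coefficients have infinite valuation.\<close>

lemma orthogonal_independent:
  assumes orth: "orthogonal \<Gamma> C \<l> ws" and "\<zero>\<^bsub>C\<^esub> \<notin> set ws"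
    and a: "a \<in> {..<length ws} \<rightarrow> carrier K" and 0: "lcomb C a ws = \<zero>\<^bsub>C\<^esub>" and i: "i < length ws"
  shows "a i = \<zero>\<^bsub>K\<^esub>"
proof -
  have w: "ws ! i \<in> carrier C" "ws ! i \<noteq> \<zero>\<^bsub>C\<^esub>" and ai: "a i \<in> carrier K"
    using orth a i nth_mem[OF i] \<open>\<zero>\<^bsub>C\<^esub> \<notin> set ws\<close> unfolding orthogonal_lcomb by (blast, metis, blast)
  have "\<l> (a i \<odot>\<^bsub>C\<^esub> (ws ! i)) = -\<infinity>"
    using orthogonal_le[OF orth a i] by (simp add: 0)
  moreover obtain r where "\<l> (ws ! i) = ereal r" using level_real w by blast
  ultimately have "nov_val (a i) = \<infinity>"
    using level_smult[OF ai w(1)] by (cases "nov_val (a i)") auto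
  then show ?thesis by (simp add: nov_val_eq_PInfty_iff zero_novikov)
qed

text \<open>A repeated vector would allow a vanishing combination with the coefficient
  \<open>1\<close> at one of its positions and \<open>- 1\<close> at the other.\<close>

lemma orthogonal_distinct:
  assumes orth: "orthogonal \<Gamma> C \<l> ws" and nz: "\<zero>\<^bsub>C\<^esub> \<notin> set ws"
  shows "distinct ws"
proof (rule ccontr)
  assume "\<not> distinct ws"
  then obtain i j where ij: "i < length ws" "j < length ws" "i \<noteq> j" "ws ! i = ws ! j"
    by (auto simp: distinct_conv_nth)
  have ws: "set ws \<subseteq> carrier C" using orth by (simp add: orthogonal_lcomb)
  let ?u = "\<lambda>i j. if j = i then \<one>\<^bsub>K\<^esub> else \<zero>\<^bsub>K\<^esub>"
  let ?a = "\<lambda>k. ?u i k \<ominus>\<^bsub>K\<^esub> ?u j k"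
  have u: "?u i \<in> {..<length ws} \<rightarrow> carrier K" for i by auto
  have "lcomb C ?a ws = \<zero>\<^bsub>C\<^esub>"
    using ij ws nth_in_carrier[OF ws] u
    by (subst lcomb_diff[OF ws]) (simp_all add: lcomb_unit[OF ws] M.minus_eq M.r_neg)
  moreover have "?a \<in> {..<length ws} \<rightarrow> carrier K" by auto
  ultimately have "?a i = \<zero>\<^bsub>K\<^esub>" using orthogonal_independent[OF orth nz] ij(1) by blast
  then show False using ij(3) by (simp add: R.minus_eq)
qed

lemma orthogonal_lin_indpt:
  assumes orth: "orthogonal \<Gamma> C \<l> ws" and nz: "\<zero>\<^bsub>C\<^esub> \<notin> set ws"
  shows "lin_indpt (set ws)"
proof (rule finite_lin_indpt2)
  show ws: "set ws \<subseteq> carrier C" using orth by (simp add: orthogonal_lcomb)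
  fix a assume a: "a \<in> set ws \<rightarrow> carrier K" and 0: "lincomb a (set ws) = \<zero>\<^bsub>C\<^esub>"
  have "lcomb C (\<lambda>i. a (ws ! i)) ws = \<zero>\<^bsub>C\<^esub>"
    using lincomb_eq_lcomb[OF ws orthogonal_distinct[OF assms] a] 0 by simp
  moreover have "(\<lambda>i. a (ws ! i)) \<in> {..<length ws} \<rightarrow> carrier K" using a by auto
  ultimately have "a (ws ! i) = \<zero>\<^bsub>K\<^esub>" if "i < length ws" for i
    using orthogonal_independent[OF assms] that by blast
  then show "\<forall>v\<in>set ws. a v = \<zero>\<^bsub>K\<^esub>" by (auto simp: in_set_conv_nth)
qed simp

text \<open>Nonzero orthogonal vectors are automatically distinct and independent. For the basis
  changes below it remains to check orthogonality, nonvanishing and spanning.\<close>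

lemma orthogonal_basis_iff:
  "orthogonal_basis \<Gamma> C \<l> ws \<longleftrightarrow>
    orthogonal \<Gamma> C \<l> ws \<and> \<zero>\<^bsub>C\<^esub> \<notin> set ws \<and> span (set ws) = carrier C"
  using orthogonal_distinct orthogonal_lin_indpt vs_zero_lin_dep[of "set ws"]
  unfolding orthogonal_basis_def basis_def by (auto simp: orthogonal_lcomb)

lemma orthogonal_basis_carrier: "orthogonal_basis \<Gamma> C \<l> ws \<Longrightarrow> set ws \<subseteq> carrier C"
  by (simp add: orthogonal_basis_def orthogonal_lcomb)

lemma orthogonal_basis_nth:
  assumes "orthogonal_basis \<Gamma> C \<l> ws" "i < length ws"
  shows "ws ! i \<in> carrier C" "ws ! i \<noteq> \<zero>\<^bsub>C\<^esub>"
  using assms nth_mem[of i ws] orthogonal_basis_carrier[of ws] unfolding orthogonal_basis_iff by (blast, metis)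

lemma orthogonal_basis_cases:
  assumes "orthogonal_basis \<Gamma> C \<l> ws" "v \<in> carrier C"
  obtains a where "a \<in> {..<length ws} \<rightarrow> carrier K" "v = lcomb C a ws"
  using assms span_set_cases[of ws v] by (auto simp: orthogonal_basis_iff orthogonal_lcomb)

lemma lcomb_inject:
  assumes "orthogonal_basis \<Gamma> C \<l> ws" "a \<in> {..<length ws} \<rightarrow> carrier K" "b \<in> {..<length ws} \<rightarrow> carrier K"
    and "lcomb C a ws = lcomb C b ws" "i < length ws"
  shows "a i = b i"
proof -
  have ws: "set ws \<subseteq> carrier C" using assms(1) by (rule orthogonal_basis_carrier)
  have "lcomb C (\<lambda>i. a i \<ominus>\<^bsub>K\<^esub> b i) ws = \<zero>\<^bsub>C\<^esub>"
    using lcomb_closed[OF ws assms(3)] assms by (simp add: lcomb_diff[OF ws] M.minus_eq M.r_neg)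
  moreover have "(\<lambda>i. a i \<ominus>\<^bsub>K\<^esub> b i) \<in> {..<length ws} \<rightarrow> carrier K" using assms by auto
  ultimately have "a i \<ominus>\<^bsub>K\<^esub> b i = \<zero>\<^bsub>K\<^esub>"
    using assms orthogonal_independent[of ws "\<lambda>i. a i \<ominus>\<^bsub>K\<^esub> b i" i] by (auto simp: orthogonal_basis_iff)
  then show ?thesis using assms by (simp add: Pi_iff)
qed

lemma nonarch_normed_space_subspace:
  assumes "submodule K U C"
  shows "nonarch_normed_space \<Gamma> (C\<lparr>carrier := U\<rparr>) \<l>"
proof -
  have "subspace K U C" using assms vectorspace_axioms by (simp add: subspace_def)
  then have "vectorspace K (C\<lparr>carrier := U\<rparr>)" by (rule subspace_is_vs)
  moreover have "U \<subseteq> carrier C" using assms by (rule submodule.subset)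
  ultimately show ?thesis
    unfolding nonarch_normed_space_def nonarch_normed_space_axioms_def
    using level_not_PInfty level_eq_MInfty_iff level_smult level_add by (auto simp: subset_iff)
qed

lemma orthogonal_subspace_iff:
  assumes "submodule K U C"
  shows "orthogonal \<Gamma> (C\<lparr>carrier := U\<rparr>) \<l> ws \<longleftrightarrow> set ws \<subseteq> U \<and> orthogonal \<Gamma> C \<l> ws"
  using submodule.subset[OF assms] lcomb_submodule(2)[OF assms, of ws] unfolding orthogonal_lcomb by auto

text \<open>Orthogonality and span do not depend on the ambient space, so bases of kernels and
  images can be tested in the space that contains them.\<close>

lemma orthogonal_basis_subspace_iff:
  assumes U: "submodule K U C"
  shows "orthogonal_basis \<Gamma> (C\<lparr>carrier := U\<rparr>) \<l> ws \<longleftrightarrow>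
    orthogonal \<Gamma> C \<l> ws \<and> \<zero>\<^bsub>C\<^esub> \<notin> set ws \<and> span (set ws) = U"
proof -
  interpret U: nonarch_normed_space \<Gamma> "C\<lparr>carrier := U\<rparr>" \<l> using U by (rule nonarch_normed_space_subspace)
  have sub: "set ws \<subseteq> U" if "orthogonal \<Gamma> C \<l> ws" "span (set ws) = U"
    using in_own_span[of "set ws"] that by (auto simp: orthogonal_lcomb)
  show ?thesis
    unfolding U.orthogonal_basis_iff orthogonal_subspace_iff[OF U]
    using sub span_li_not_depend(1)[OF _ U, of "set ws"] by auto
qed

end

section \<open>Elementary changes of an orthogonal basis\<close>

context module
begin

lemma finsum_smult_left:
  assumes "finite I" "a \<in> I \<rightarrow> carrier R" "v \<in> carrier M"
  shows "(\<Oplus>\<^bsub>R\<^esub>i\<in>I. a i) \<odot>\<^bsub>M\<^esub> v = (\<Oplus>\<^bsub>M\<^esub>i\<in>I. a i \<odot>\<^bsub>M\<^esub> v)"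
  using assms
proof (induction I)
  case (insert i I)
  then have "(\<Oplus>\<^bsub>M\<^esub>i\<in>insert i I. a i \<odot>\<^bsub>M\<^esub> v) = a i \<odot>\<^bsub>M\<^esub> v \<oplus>\<^bsub>M\<^esub> (\<Oplus>\<^bsub>M\<^esub>i\<in>I. a i \<odot>\<^bsub>M\<^esub> v)"
    by (intro M.finsum_insert) auto
  with insert show ?case by (simp add: smult_l_distr)
qed simp

text \<open>All corrections are multiples of the same vector \<open>v\<close>, so they collect into
  one coefficient.\<close>

lemma lcomb_shear:
  assumes ws: "set ws \<subseteq> carrier M" and v: "v \<in> carrier M"
    and a: "a \<in> {..<length ws} \<rightarrow> carrier R" and c: "c \<in> {..<length ws} \<rightarrow> carrier R"
  shows "lcomb M a (map (\<lambda>j. ws ! j \<ominus>\<^bsub>M\<^esub> c j \<odot>\<^bsub>M\<^esub> v) [0..<length ws]) =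
    lcomb M a ws \<ominus>\<^bsub>M\<^esub> (\<Oplus>\<^bsub>R\<^esub>j\<in>{..<length ws}. a j \<otimes>\<^bsub>R\<^esub> c j) \<odot>\<^bsub>M\<^esub> v"
proof -
  let ?n = "length ws"
  have w: "ws ! j \<in> carrier M" if "j < ?n" for j using nth_in_carrier[OF ws that] .
  have ac: "a j \<in> carrier R" "c j \<in> carrier R" if "j < ?n" for j using a c that by auto
  have s: "(\<Oplus>\<^bsub>R\<^esub>j\<in>{..<?n}. a j \<otimes>\<^bsub>R\<^esub> c j) \<in> carrier R" using ac by (intro R.finsum_closed) auto
  have "lcomb M a (map (\<lambda>j. ws ! j \<ominus>\<^bsub>M\<^esub> c j \<odot>\<^bsub>M\<^esub> v) [0..<?n])
      \<oplus>\<^bsub>M\<^esub> (\<Oplus>\<^bsub>M\<^esub>j\<in>{..<?n}. (a j \<otimes>\<^bsub>R\<^esub> c j) \<odot>\<^bsub>M\<^esub> v) =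
    (\<Oplus>\<^bsub>M\<^esub>j\<in>{..<?n}. a j \<odot>\<^bsub>M\<^esub> (ws ! j \<ominus>\<^bsub>M\<^esub> c j \<odot>\<^bsub>M\<^esub> v) \<oplus>\<^bsub>M\<^esub> (a j \<otimes>\<^bsub>R\<^esub> c j) \<odot>\<^bsub>M\<^esub> v)"
    unfolding lcomb_def using ac w v
    by (subst M.finsum_addf) (auto intro!: arg_cong2[of _ _ _ _ "(\<oplus>\<^bsub>M\<^esub>)"] M.finsum_cong')
  also have "\<dots> = lcomb M a ws"
    unfolding lcomb_def
  proof (rule M.finsum_cong'[OF refl])
    fix j assume "j \<in> {..<?n}"
    then have j: "j < ?n" by simp
    have "a j \<odot>\<^bsub>M\<^esub> (ws ! j \<ominus>\<^bsub>M\<^esub> c j \<odot>\<^bsub>M\<^esub> v) = a j \<odot>\<^bsub>M\<^esub> (ws ! j) \<ominus>\<^bsub>M\<^esub> (a j \<otimes>\<^bsub>R\<^esub> c j) \<odot>\<^bsub>M\<^esub> v"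
      using ac[OF j] w[OF j] v by (simp add: M.minus_eq smult_r_distr smult_r_minus smult_assoc1)
    then show "a j \<odot>\<^bsub>M\<^esub> (ws ! j \<ominus>\<^bsub>M\<^esub> c j \<odot>\<^bsub>M\<^esub> v) \<oplus>\<^bsub>M\<^esub> (a j \<otimes>\<^bsub>R\<^esub> c j) \<odot>\<^bsub>M\<^esub> v = a j \<odot>\<^bsub>M\<^esub> (ws ! j)"
      using ac[OF j] w[OF j] v by (simp add: M.minus_eq M.a_assoc M.l_neg)
  qed (use ac w in auto)
  finally have eq: "lcomb M a (map (\<lambda>j. ws ! j \<ominus>\<^bsub>M\<^esub> c j \<odot>\<^bsub>M\<^esub> v) [0..<?n])
      \<oplus>\<^bsub>M\<^esub> (\<Oplus>\<^bsub>R\<^esub>j\<in>{..<?n}. a j \<otimes>\<^bsub>R\<^esub> c j) \<odot>\<^bsub>M\<^esub> v = lcomb M a ws"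
    using ac v by (subst finsum_smult_left) auto
  have "lcomb M a (map (\<lambda>j. ws ! j \<ominus>\<^bsub>M\<^esub> c j \<odot>\<^bsub>M\<^esub> v) [0..<?n]) \<in> carrier M"
    using ac w v a by (intro lcomb_closed) auto
  then show ?thesis
    using s v by (simp add: eq[symmetric] M.minus_eq M.a_assoc M.r_neg)
qed

lemma lcomb_update_zero:
  assumes "set ws \<subseteq> carrier M" "v \<in> carrier M" "a \<in> {..<length ws} \<rightarrow> carrier R" "a i = \<zero>\<^bsub>R\<^esub>"
  shows "lcomb M a (ws[i := v]) = lcomb M a ws"
proof -
  have "a j \<odot>\<^bsub>M\<^esub> (ws[i := v] ! j) = a j \<odot>\<^bsub>M\<^esub> (ws ! j)" if "j < length ws" for j
    using that assms nth_in_carrier[OF assms(1)] by (cases "j = i") auto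
  then show ?thesis
    unfolding lcomb_def using assms nth_in_carrier[OF assms(1)] by (intro M.finsum_cong') auto
qed

lemma lcomb_isolate:
  assumes "set ws \<subseteq> carrier M" "a \<in> {..<length ws} \<rightarrow> carrier R" "i < length ws"
  shows "lcomb M a ws = lcomb M (a(i := \<zero>\<^bsub>R\<^esub>)) ws \<oplus>\<^bsub>M\<^esub> a i \<odot>\<^bsub>M\<^esub> (ws ! i)"
proof -
  have "lcomb M a ws = lcomb M (\<lambda>j. (a(i := \<zero>\<^bsub>R\<^esub>)) j \<oplus>\<^bsub>R\<^esub> (if j = i then a i else \<zero>\<^bsub>R\<^esub>)) ws"
    by (rule lcomb_cong) (use assms in \<open>auto simp: Pi_iff\<close>)
  also have "\<dots> = lcomb M (a(i := \<zero>\<^bsub>R\<^esub>)) ws \<oplus>\<^bsub>M\<^esub> a i \<odot>\<^bsub>M\<^esub> (ws ! i)"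
    by (subst lcomb_add) (use assms in \<open>auto simp: lcomb_unit Pi_iff\<close>)
  finally show ?thesis .
qed

lemma lcomb_update:
  assumes "set ws \<subseteq> carrier M" "v \<in> carrier M" "a \<in> {..<length ws} \<rightarrow> carrier R" "i < length ws"
  shows "lcomb M a (ws[i := v]) = lcomb M (a(i := \<zero>\<^bsub>R\<^esub>)) ws \<oplus>\<^bsub>M\<^esub> a i \<odot>\<^bsub>M\<^esub> v"
proof -
  have "set (ws[i := v]) \<subseteq> carrier M" using assms set_update_subset_insert[of ws i v] by auto
  then have "lcomb M a (ws[i := v]) = lcomb M (a(i := \<zero>\<^bsub>R\<^esub>)) (ws[i := v]) \<oplus>\<^bsub>M\<^esub> a i \<odot>\<^bsub>M\<^esub> (ws[i := v] ! i)"
    using assms by (intro lcomb_isolate) auto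
  moreover have "a(i := \<zero>\<^bsub>R\<^esub>) \<in> {..<length ws} \<rightarrow> carrier R" using assms by auto
  ultimately show ?thesis
    using assms lcomb_update_zero[of ws v "a(i := \<zero>\<^bsub>R\<^esub>)" i] by simp
qed

lemma span_mono_submodule:
  assumes "set ws \<subseteq> span (set ws')" "set ws' \<subseteq> carrier M"
  shows "span (set ws) \<subseteq> span (set ws')"
  using assms span_is_subset span_is_submodule by blast

lemma span_diff:
  assumes "S \<subseteq> carrier M" "v \<in> span S" "w \<in> span S"
  shows "v \<ominus>\<^bsub>M\<^esub> w \<in> span S"
proof -
  have sub: "submodule R (span S) M" using assms(1) by (rule span_is_submodule)
  have "v \<in> carrier M" "w \<in> carrier M" using span_is_subset2[OF assms(1)] assms by auto
  then have "v \<ominus>\<^bsub>M\<^esub> w = v \<oplus>\<^bsub>M\<^esub> (\<ominus>\<^bsub>R\<^esub> \<one>\<^bsub>R\<^esub>) \<odot>\<^bsub>M\<^esub> w" by (simp add: M.minus_eq smult_l_minus)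
  also have "\<dots> \<in> span S"
    using assms by (intro submodule.m_closed[OF sub] submodule.smult_closed[OF sub]) auto
  finally show ?thesis .
qed

end

context nonarch_normed_space
begin

text \<open>In terms of the old basis, a combination of the new vectors keeps its coefficients away
  from \<open>j\<^sub>0\<close>, so it dominates those terms. They dominate the accumulated multiple
  of \<open>ys ! j\<^sub>0\<close> by the hypothesis on levels, and subtracting that multiple
  controls the term at \<open>j\<^sub>0\<close> too.\<close>

lemma orthogonal_basis_shear:
  assumes ob: "orthogonal_basis \<Gamma> C \<l> ys" and j\<^sub>0: "j\<^sub>0 < length ys"
    and c: "c \<in> {..<length ys} \<rightarrow> carrier K" and c0: "c j\<^sub>0 = \<zero>\<^bsub>K\<^esub>"
    and le: "\<And>j. j < length ys \<Longrightarrow> \<l> (c j \<odot>\<^bsub>C\<^esub> (ys ! j\<^sub>0)) \<le> \<l> (ys ! j)"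
  shows "orthogonal_basis \<Gamma> C \<l> (map (\<lambda>j. ys ! j \<ominus>\<^bsub>C\<^esub> c j \<odot>\<^bsub>C\<^esub> (ys ! j\<^sub>0)) [0..<length ys])"
proof -
  let ?n = "length ys" and ?v = "ys ! j\<^sub>0"
  let ?ys = "map (\<lambda>j. ys ! j \<ominus>\<^bsub>C\<^esub> c j \<odot>\<^bsub>C\<^esub> ?v) [0..<?n]"
  have ys: "set ys \<subseteq> carrier C" using ob by (rule orthogonal_basis_carrier)
  have v: "?v \<in> carrier C" using orthogonal_basis_nth[OF ob j\<^sub>0] by simp
  have y: "ys ! j \<in> carrier C" "c j \<in> carrier K" if "j < ?n" for j
    using orthogonal_basis_nth[OF ob that] c that by auto
  have ys': "set ?ys \<subseteq> carrier C" using y v by auto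
  have orth: "orthogonal \<Gamma> C \<l> ys" using ob by (simp add: orthogonal_basis_def)
  \<comment> \<open>The bound is first proved for the old vectors; the new ones have no larger
    level.\<close>
  have key: "\<l> (a i \<odot>\<^bsub>C\<^esub> (ys ! i)) \<le> \<l> (lcomb C a ?ys)"
    if a: "a \<in> {..<?n} \<rightarrow> carrier K" and i: "i < ?n" for a i
  proof -
    define t where "t = (\<Oplus>\<^bsub>K\<^esub>j\<in>{..<?n}. a j \<otimes>\<^bsub>K\<^esub> c j)"
    have t: "t \<in> carrier K" unfolding t_def using a y by (intro R.finsum_closed) auto
    let ?u = "\<lambda>j. if j = j\<^sub>0 then t else \<zero>\<^bsub>K\<^esub>"
    let ?b = "\<lambda>j. a j \<ominus>\<^bsub>K\<^esub> ?u j"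
    have u: "?u \<in> {..<?n} \<rightarrow> carrier K" using t by auto
    have b: "?b \<in> {..<?n} \<rightarrow> carrier K" using a t by auto
    have "lcomb C a ?ys = lcomb C ?b ys"
      unfolding lcomb_shear[OF ys v a c] t_def[symmetric]
      using lcomb_diff[OF ys a u] lcomb_unit[OF ys j\<^sub>0 t] by simp
    then have bs: "\<l> (?b j \<odot>\<^bsub>C\<^esub> (ys ! j)) \<le> \<l> (lcomb C a ?ys)" if "j < ?n" for j
      using orthogonal_le[OF orth b that] by simp
    have bj: "?b j = a j" if "j \<noteq> j\<^sub>0" "j < ?n" for j using that a by (auto simp: R.minus_eq Pi_iff)
    show ?thesis
    proof (cases "i = j\<^sub>0")
      case False
      then show ?thesis using bs[OF i] bj[OF False i] by simp
    next
      case True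
      have "\<l> (t \<odot>\<^bsub>C\<^esub> ?v) \<le> \<l> (lcomb C a ?ys)"
      proof -
        \<comment> \<open>Written as a combination of copies of one vector, the accumulated
          correction can be bounded term by term.\<close>
        have "t \<odot>\<^bsub>C\<^esub> ?v = lcomb C (\<lambda>j. a j \<otimes>\<^bsub>K\<^esub> c j) (replicate ?n ?v)"
          unfolding t_def lcomb_def using a y v
          by (subst finsum_smult_left) (auto intro!: M.finsum_cong' smult_closed simp: Pi_iff)
        also have "\<l> \<dots> \<le> \<l> (lcomb C a ?ys)"
        proof (rule level_lcomb_le)
          fix j assume "j < length (replicate ?n ?v)"
          then have j: "j < ?n" by simp
          show "\<l> ((a j \<otimes>\<^bsub>K\<^esub> c j) \<odot>\<^bsub>C\<^esub> (replicate ?n ?v ! j)) \<le> \<l> (lcomb C a ?ys)"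
          proof (cases "j = j\<^sub>0")
            case True
            then show ?thesis using a j v c0 by (auto simp: Pi_iff)
          next
            case False
            have "\<l> (a j \<odot>\<^bsub>C\<^esub> (c j \<odot>\<^bsub>C\<^esub> ?v)) \<le> \<l> (a j \<odot>\<^bsub>C\<^esub> (ys ! j))"
              using a y[OF j] v le[OF j] j by (intro level_smult_mono) auto
            also have "\<dots> \<le> \<l> (lcomb C a ?ys)" using bs[OF j] bj[OF False j] by simp
            finally show ?thesis using a y[OF j] v j by (simp add: smult_assoc1 Pi_iff)
          qed
        qed (use a y v in auto)
        finally show ?thesis .
      qed
      moreover have bj\<^sub>0: "a j\<^sub>0 \<ominus>\<^bsub>K\<^esub> t \<in> carrier K" "a j\<^sub>0 \<in> carrier K" using a t j\<^sub>0 by auto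
      moreover have "a j\<^sub>0 \<odot>\<^bsub>C\<^esub> ?v = (a j\<^sub>0 \<ominus>\<^bsub>K\<^esub> t) \<odot>\<^bsub>C\<^esub> ?v \<oplus>\<^bsub>C\<^esub> t \<odot>\<^bsub>C\<^esub> ?v"
      proof -
        have "a j\<^sub>0 = a j\<^sub>0 \<ominus>\<^bsub>K\<^esub> t \<oplus>\<^bsub>K\<^esub> t" using bj\<^sub>0 t by (simp add: R.minus_eq R.a_assoc R.l_neg)
        then show ?thesis using bj\<^sub>0 t v smult_l_distr[of "a j\<^sub>0 \<ominus>\<^bsub>K\<^esub> t" t ?v] by simp
      qed
      ultimately show ?thesis
        using level_add_le[of "(a j\<^sub>0 \<ominus>\<^bsub>K\<^esub> t) \<odot>\<^bsub>C\<^esub> ?v" "t \<odot>\<^bsub>C\<^esub> ?v"] bs[OF j\<^sub>0] t v True by simp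
    qed
  qed
  have nz: "?ys ! i \<noteq> \<zero>\<^bsub>C\<^esub>" if i: "i < ?n" for i
  proof
    assume 0: "?ys ! i = \<zero>\<^bsub>C\<^esub>"
    let ?u = "\<lambda>j. if j = i then \<one>\<^bsub>K\<^esub> else \<zero>\<^bsub>K\<^esub>"
    have "lcomb C ?u ?ys = \<one>\<^bsub>K\<^esub> \<odot>\<^bsub>C\<^esub> (?ys ! i)" by (rule lcomb_unit[OF ys']) (use i in auto)
    then have "lcomb C ?u ?ys = \<zero>\<^bsub>C\<^esub>" by (simp add: 0)
    moreover have "\<l> (?u i \<odot>\<^bsub>C\<^esub> (ys ! i)) \<le> \<l> (lcomb C ?u ?ys)" using i by (intro key) auto
    ultimately have "\<l> (ys ! i) = -\<infinity>" using y[OF i] by simp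
    then show False using orthogonal_basis_nth[OF ob i] level_eq_MInfty_iff by simp
  qed
  have "orthogonal \<Gamma> C \<l> ?ys"
    unfolding orthogonal_iff[OF ys']
  proof (intro ballI allI impI)
    fix a i assume a: "a \<in> {..<length ?ys} \<rightarrow> carrier K" and "i < length ?ys"
    then have i: "i < ?n" by simp
    have "\<l> (?ys ! i) \<le> \<l> (ys ! i)" using i y[OF i] v le[OF i] by (simp add: level_diff_le)
    then have "\<l> (a i \<odot>\<^bsub>C\<^esub> (?ys ! i)) \<le> \<l> (a i \<odot>\<^bsub>C\<^esub> (ys ! i))"
      using a y[OF i] v i by (intro level_smult_mono) (auto simp: Pi_iff)
    also have "\<dots> \<le> \<l> (lcomb C a ?ys)" using a i by (intro key) auto
    finally show "\<l> (a i \<odot>\<^bsub>C\<^esub> (?ys ! i)) \<le> \<l> (lcomb C a ?ys)" .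
  qed
  moreover have "\<zero>\<^bsub>C\<^esub> \<notin> set ?ys"
  proof
    assume "\<zero>\<^bsub>C\<^esub> \<in> set ?ys"
    then obtain i where "i < length ?ys" "?ys ! i = \<zero>\<^bsub>C\<^esub>" unfolding in_set_conv_nth by blast
    then show False using nz[of i] by simp
  qed
  moreover have "span (set ?ys) = carrier C"
  proof -
    have sub: "submodule K (span (set ?ys)) C" using ys' by (rule span_is_submodule)
    have mem: "?ys ! j \<in> span (set ?ys)" if "j < ?n" for j
      by (rule subsetD[OF in_own_span[OF ys'] nth_mem]) (use that in simp)
    have "?ys ! j\<^sub>0 = ?v" using j\<^sub>0 v c0 by (simp add: M.minus_eq)
    then have v': "?v \<in> span (set ?ys)" using mem[OF j\<^sub>0] by simp
    have "ys ! j \<in> span (set ?ys)" if j: "j < ?n" for j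
    proof -
      have "ys ! j = ?ys ! j \<oplus>\<^bsub>C\<^esub> c j \<odot>\<^bsub>C\<^esub> ?v"
        using y[OF j] v j by (simp add: M.minus_eq M.a_assoc M.l_neg)
      also have "\<dots> \<in> span (set ?ys)"
        using mem[OF j] v' y[OF j] by (intro submodule.m_closed[OF sub] submodule.smult_closed[OF sub])
      finally show ?thesis .
    qed
    then have "set ys \<subseteq> span (set ?ys)" by (auto simp: in_set_conv_nth)
    then have "span (set ys) \<subseteq> span (set ?ys)" using ys' by (rule span_mono_submodule)
    then show ?thesis using ob span_is_subset2[OF ys'] by (auto simp: orthogonal_basis_iff)
  qed
  ultimately show ?thesis by (simp only: orthogonal_basis_iff simp_thms)
qed

text \<open>The term at \<open>i\<^sub>0\<close> dominates the new vector, and the other new vectors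
  do not involve \<open>xs ! i\<^sub>0\<close>. A combination of the new basis therefore shows the
  coefficient of the new vector undisturbed at position \<open>i\<^sub>0\<close>, and this bounds
  what the new vector contributes elsewhere.\<close>

lemma orthogonal_basis_replace:
  assumes ob: "orthogonal_basis \<Gamma> C \<l> xs" and i\<^sub>0: "i\<^sub>0 < length xs"
    and b: "b \<in> {..<length xs} \<rightarrow> carrier K" and b0: "b i\<^sub>0 \<noteq> \<zero>\<^bsub>K\<^esub>"
    and le: "\<And>i. i < length xs \<Longrightarrow> \<l> (b i \<odot>\<^bsub>C\<^esub> (xs ! i)) \<le> \<l> (b i\<^sub>0 \<odot>\<^bsub>C\<^esub> (xs ! i\<^sub>0))"
  shows "orthogonal_basis \<Gamma> C \<l> (xs[i\<^sub>0 := lcomb C b xs])"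
proof -
  let ?n = "length xs" and ?v = "lcomb C b xs"
  let ?xs = "xs[i\<^sub>0 := ?v]"
  have xs: "set xs \<subseteq> carrier C" using ob by (rule orthogonal_basis_carrier)
  have v: "?v \<in> carrier C" using xs b by (rule lcomb_closed)
  have x: "xs ! i \<in> carrier C" "b i \<in> carrier K" if "i < ?n" for i
    using orthogonal_basis_nth[OF ob that] b that by auto
  have xs': "set ?xs \<subseteq> carrier C" using xs v set_update_subset_insert[of xs i\<^sub>0 ?v] by auto
  have orth: "orthogonal \<Gamma> C \<l> xs" and nz: "\<zero>\<^bsub>C\<^esub> \<notin> set xs" using ob by (auto simp: orthogonal_basis_iff)
  have "?v \<noteq> \<zero>\<^bsub>C\<^esub>" using orthogonal_independent[OF orth nz b _ i\<^sub>0] b0 by blast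
  then have nz': "\<zero>\<^bsub>C\<^esub> \<notin> set ?xs" using nz set_update_subset_insert[of xs i\<^sub>0 ?v] by auto
  have "\<l> ?v \<le> \<l> (b i\<^sub>0 \<odot>\<^bsub>C\<^esub> (xs ! i\<^sub>0))" using xs b le by (rule level_lcomb_le)
  have "orthogonal \<Gamma> C \<l> ?xs"
    unfolding orthogonal_iff[OF xs']
  proof (intro ballI allI impI)
    fix a i assume "a \<in> {..<length ?xs} \<rightarrow> carrier K" "i < length ?xs"
    then have a: "a \<in> {..<?n} \<rightarrow> carrier K" and i: "i < ?n" by auto
    have ai: "a i \<in> carrier K" "a i\<^sub>0 \<in> carrier K" using a i i\<^sub>0 by auto
    define s where "s = \<l> (lcomb C a ?xs)"
    let ?a = "\<lambda>i. (a(i\<^sub>0 := \<zero>\<^bsub>K\<^esub>)) i \<oplus>\<^bsub>K\<^esub> a i\<^sub>0 \<otimes>\<^bsub>K\<^esub> b i"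
    have a': "?a \<in> {..<?n} \<rightarrow> carrier K" using a b ai by (auto simp: Pi_iff)
    have "lcomb C a ?xs = lcomb C ?a xs"
      unfolding lcomb_update[OF xs v a i\<^sub>0] lcomb_smult[OF xs b ai(2), symmetric]
      using a b ai by (intro lcomb_add[OF xs, symmetric]) (auto simp: Pi_iff)
    then have s: "\<l> (?a j \<odot>\<^bsub>C\<^esub> (xs ! j)) \<le> s" if "j < ?n" for j
      using orthogonal_le[OF orth a' that] by (simp add: s_def)
    have a0: "\<l> (a i\<^sub>0 \<odot>\<^bsub>C\<^esub> (b i\<^sub>0 \<odot>\<^bsub>C\<^esub> (xs ! i\<^sub>0))) \<le> s"
      using s[OF i\<^sub>0] ai x[OF i\<^sub>0] by (simp add: smult_assoc1)
    have "\<l> (a i \<odot>\<^bsub>C\<^esub> (?xs ! i)) \<le> s"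
    proof (cases "i = i\<^sub>0")
      case True
      have "\<l> (a i\<^sub>0 \<odot>\<^bsub>C\<^esub> ?v) \<le> \<l> (a i\<^sub>0 \<odot>\<^bsub>C\<^esub> (b i\<^sub>0 \<odot>\<^bsub>C\<^esub> (xs ! i\<^sub>0)))"
        using ai v x[OF i\<^sub>0] \<open>\<l> ?v \<le> _\<close> by (intro level_smult_mono) auto
      then show ?thesis using a0 True i\<^sub>0 by simp
    next
      case False
      \<comment> \<open>The old coordinate at \<open>i\<close> is \<open>a i\<close> plus a multiple
        of \<open>b i\<close>; the latter is dominated by the term at \<open>i\<^sub>0\<close> and
        can be subtracted again.\<close>
      have "\<l> (a i\<^sub>0 \<odot>\<^bsub>C\<^esub> (b i \<odot>\<^bsub>C\<^esub> (xs ! i))) \<le> \<l> (a i\<^sub>0 \<odot>\<^bsub>C\<^esub> (b i\<^sub>0 \<odot>\<^bsub>C\<^esub> (xs ! i\<^sub>0)))"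
        using ai x[OF i] x[OF i\<^sub>0] le[OF i] by (intro level_smult_mono) auto
      then have "\<l> (a i\<^sub>0 \<odot>\<^bsub>C\<^esub> (b i \<odot>\<^bsub>C\<^esub> (xs ! i))) \<le> s" using a0 by (rule order.trans)
      moreover have "a i \<odot>\<^bsub>C\<^esub> (xs ! i) = ?a i \<odot>\<^bsub>C\<^esub> (xs ! i) \<ominus>\<^bsub>C\<^esub> a i\<^sub>0 \<odot>\<^bsub>C\<^esub> (b i \<odot>\<^bsub>C\<^esub> (xs ! i))"
        using False ai x[OF i] by (simp add: smult_l_distr smult_assoc1 M.minus_eq M.a_assoc M.r_neg)
      moreover have "?a i \<odot>\<^bsub>C\<^esub> (xs ! i) \<in> carrier C" using a' i x[OF i] by (intro smult_closed) (auto simp: Pi_iff)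
      ultimately have "\<l> (a i \<odot>\<^bsub>C\<^esub> (xs ! i)) \<le> s"
        using level_diff_le[of "?a i \<odot>\<^bsub>C\<^esub> (xs ! i)" "a i\<^sub>0 \<odot>\<^bsub>C\<^esub> (b i \<odot>\<^bsub>C\<^esub> (xs ! i))"]
          s[OF i] ai x[OF i] x[OF i\<^sub>0] by simp
      then show ?thesis using False by simp
    qed
    then show "\<l> (a i \<odot>\<^bsub>C\<^esub> (?xs ! i)) \<le> \<l> (lcomb C a ?xs)" by (simp add: s_def)
  qed
  moreover have "span (set ?xs) = carrier C"
  proof -
    have sub: "submodule K (span (set ?xs)) C" using xs' by (rule span_is_submodule)
    have mem: "?xs ! j \<in> span (set ?xs)" if "j < ?n" for j
      by (rule subsetD[OF in_own_span[OF xs'] nth_mem]) (use that in simp)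
    let ?b = "b(i\<^sub>0 := \<zero>\<^bsub>K\<^esub>)"
    have b': "?b \<in> {..<?n} \<rightarrow> carrier K" using b by auto
    have "lcomb C ?b xs = lcomb C ?b ?xs"
      using lcomb_update_zero[OF xs v b', of i\<^sub>0] by simp
    also have "\<dots> \<in> span (set ?xs)"
      using b' by (intro lcomb_submodule(1)[OF sub in_own_span[OF xs']]) simp
    finally have rest: "lcomb C ?b xs \<in> span (set ?xs)" .
    have "?v \<in> span (set ?xs)" using mem[OF i\<^sub>0] i\<^sub>0 by simp
    with rest have "?v \<ominus>\<^bsub>C\<^esub> lcomb C ?b xs \<in> span (set ?xs)" using xs' by (intro span_diff)
    moreover have "?v \<ominus>\<^bsub>C\<^esub> lcomb C ?b xs = b i\<^sub>0 \<odot>\<^bsub>C\<^esub> (xs ! i\<^sub>0)"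
    proof -
      have c: "lcomb C ?b xs \<in> carrier C" "b i\<^sub>0 \<odot>\<^bsub>C\<^esub> (xs ! i\<^sub>0) \<in> carrier C"
        using xs b' x[OF i\<^sub>0] by auto
      have "?v = lcomb C ?b xs \<oplus>\<^bsub>C\<^esub> b i\<^sub>0 \<odot>\<^bsub>C\<^esub> (xs ! i\<^sub>0)" using xs b i\<^sub>0 by (rule lcomb_isolate)
      then show ?thesis using c by (metis M.a_comm M.add.inv_solve_right M.minus_eq M.a_closed)
    qed
    ultimately have "b i\<^sub>0 \<odot>\<^bsub>C\<^esub> (xs ! i\<^sub>0) \<in> span (set ?xs)" by simp
    moreover have "b i\<^sub>0 \<in> Units K" using b0 x[OF i\<^sub>0] by (simp add: field_Units)
    ultimately have "inv\<^bsub>K\<^esub> (b i\<^sub>0) \<odot>\<^bsub>C\<^esub> (b i\<^sub>0 \<odot>\<^bsub>C\<^esub> (xs ! i\<^sub>0)) \<in> span (set ?xs)"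
      using submodule.smult_closed[OF sub R.Units_inv_closed] by blast
    then have x0: "xs ! i\<^sub>0 \<in> span (set ?xs)"
      using \<open>b i\<^sub>0 \<in> Units K\<close> x[OF i\<^sub>0]
      by (metis R.Units_inv_closed R.Units_l_inv smult_assoc1 smult_one)
    have "xs ! i \<in> span (set ?xs)" if "i < ?n" for i
      using x0 mem[OF that] by (cases "i = i\<^sub>0") auto
    then have "set xs \<subseteq> span (set ?xs)" by (auto simp: in_set_conv_nth)
    then have "span (set xs) \<subseteq> span (set ?xs)" using xs' by (rule span_mono_submodule)
    then show ?thesis using ob span_is_subset2[OF xs'] by (auto simp: orthogonal_basis_iff)
  qed
  ultimately show ?thesis using nz' by (simp only: orthogonal_basis_iff simp_thms)
qed

text \<open>Coefficients are extended by zero. The detour through combinations indexed by sets makes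
  the order irrelevant, so the same fact covers sublists and permutations.\<close>

lemma orthogonal_subset:
  assumes orth: "orthogonal \<Gamma> C \<l> ws" and dist: "distinct ws" "distinct ws'" and sub: "set ws' \<subseteq> set ws"
  shows "orthogonal \<Gamma> C \<l> ws'"
proof -
  have ws: "set ws \<subseteq> carrier C" using orth by (simp add: orthogonal_lcomb)
  then have ws': "set ws' \<subseteq> carrier C" using sub by auto
  show ?thesis
    unfolding orthogonal_iff[OF ws']
  proof (intro ballI allI impI)
    fix a i assume a: "a \<in> {..<length ws'} \<rightarrow> carrier K" and i: "i < length ws'"
    have inj: "inj_on ((!) ws') {..<length ws'}" using dist by (simp add: inj_on_nth)
    define b where "b w = (if w \<in> set ws' then a (inv_into {..<length ws'} ((!) ws') w) else \<zero>\<^bsub>K\<^esub>)" for w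
    have b_nth: "b (ws' ! j) = a j" if "j < length ws'" for j
      using inv_into_f_f[OF inj, of j] that by (simp add: b_def)
    have bw': "b \<in> set ws' \<rightarrow> carrier K"
      using b_nth a by (auto simp: in_set_conv_nth Pi_iff)
    then have bw: "b \<in> set ws \<rightarrow> carrier K" by (auto simp: b_def Pi_iff)
    have "lcomb C a ws' = lcomb C (\<lambda>j. b (ws' ! j)) ws'"
      using a b_nth bw' by (intro lcomb_cong[OF ws']) auto
    also have "\<dots> = lincomb b (set ws')" using lincomb_eq_lcomb[OF ws' dist(2) bw'] by simp
    also have "\<dots> = lincomb b (set ws' \<union> (set ws - set ws'))"
      by (rule lincomb_clean[symmetric]) (use ws' ws bw' in \<open>auto simp: b_def\<close>)
    also have "set ws' \<union> (set ws - set ws') = set ws" using sub by auto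
    also have "lincomb b (set ws) = lcomb C (\<lambda>j. b (ws ! j)) ws"
      using lincomb_eq_lcomb[OF ws dist(1) bw] .
    finally have eq: "lcomb C a ws' = lcomb C (\<lambda>j. b (ws ! j)) ws" .
    obtain k where k: "k < length ws" "ws ! k = ws' ! i"
      using sub nth_mem[OF i] by (metis in_set_conv_nth subsetD)
    have "\<l> (b (ws ! k) \<odot>\<^bsub>C\<^esub> (ws ! k)) \<le> \<l> (lcomb C (\<lambda>j. b (ws ! j)) ws)"
      using bw k by (intro orthogonal_le[OF orth]) auto
    then show "\<l> (a i \<odot>\<^bsub>C\<^esub> (ws' ! i)) \<le> \<l> (lcomb C a ws')"
      using k b_nth[OF i] by (simp add: eq)
  qed
qed

lemma orthogonal_basis_permute:
  assumes ob: "orthogonal_basis \<Gamma> C \<l> ws" and "distinct ws'" "set ws' = set ws"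
  shows "orthogonal_basis \<Gamma> C \<l> ws'"
  using assms orthogonal_subset[of ws ws'] unfolding orthogonal_basis_def by simp

lemma orthogonal_basis_part:
  assumes "orthogonal_basis \<Gamma> C \<l> ws"
  shows "orthogonal \<Gamma> C \<l> (take r ws)" "\<zero>\<^bsub>C\<^esub> \<notin> set (take r ws)"
    "orthogonal \<Gamma> C \<l> (drop r ws)" "\<zero>\<^bsub>C\<^esub> \<notin> set (drop r ws)"
proof -
  have "orthogonal \<Gamma> C \<l> ws" "distinct ws" "\<zero>\<^bsub>C\<^esub> \<notin> set ws"
    using assms by (auto simp: orthogonal_basis_iff orthogonal_distinct)
  then show "orthogonal \<Gamma> C \<l> (take r ws)" "\<zero>\<^bsub>C\<^esub> \<notin> set (take r ws)"
    "orthogonal \<Gamma> C \<l> (drop r ws)" "\<zero>\<^bsub>C\<^esub> \<notin> set (drop r ws)"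
    using orthogonal_subset[of ws] set_take_subset[of r ws] set_drop_subset[of r ws] by auto
qed

end

section \<open>Existence of singular value decompositions\<close>

locale nonarch_linear_map =
  C: nonarch_normed_space \<Gamma> C \<l>C + D: nonarch_normed_space \<Gamma> D \<l>D + A: linear_map "novikov \<Gamma>" C D A
  for \<Gamma> :: "real set" and C :: "(real \<Rightarrow> 'k::field, 'c) module" and \<l>C :: "'c \<Rightarrow> ereal"
    and D :: "(real \<Rightarrow> 'k, 'd) module" and \<l>D :: "'d \<Rightarrow> ereal" and A :: "'c \<Rightarrow> 'd"
begin

abbreviation K :: "(real \<Rightarrow> 'k) ring" where "K \<equiv> novikov \<Gamma>"

text \<open>The conditions on the vectors alone, with \<open>r\<close> as a parameter in place of
  the rank and without kernel or image. This form can be produced by elimination and carried through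
  an extension of scalars; \<open>is_svd_iff\<close> recovers the rest.\<close>

definition svd_data :: "nat \<Rightarrow> 'c list \<Rightarrow> 'd list \<Rightarrow> bool" where
  "svd_data r ys xs \<longleftrightarrow>
    orthogonal_basis \<Gamma> C \<l>C ys \<and> orthogonal_basis \<Gamma> D \<l>D xs \<and> r \<le> length ys \<and> r \<le> length xs \<and>
    (\<forall>i<r. A (ys ! i) = xs ! i) \<and> (\<forall>i<length ys. r \<le> i \<longrightarrow> A (ys ! i) = \<zero>\<^bsub>D\<^esub>) \<and>
    (\<forall>i j. i \<le> j \<longrightarrow> j < r \<longrightarrow> \<l>C (ys ! j) - \<l>D (xs ! j) \<le> \<l>C (ys ! i) - \<l>D (xs ! i))"

text \<open>The state of the elimination: the pivots found so far are the pairs \<open>(j, \<sigma> j)\<close> with \<open>j \<in> P\<close>, and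
  row \<open>j\<close> of the matrix of \<open>A\<close> is \<open>B j\<close> for the remaining \<open>j\<close>.\<close>

definition elimination :: "'c list \<Rightarrow> 'd list \<Rightarrow> nat set \<Rightarrow> (nat \<Rightarrow> nat) \<Rightarrow> (nat \<Rightarrow> nat \<Rightarrow> real \<Rightarrow> 'k) \<Rightarrow> bool" where
  "elimination ys xs P \<sigma> B \<longleftrightarrow>
    orthogonal_basis \<Gamma> C \<l>C ys \<and> orthogonal_basis \<Gamma> D \<l>D xs \<and>
    P \<subseteq> {..<length ys} \<and> inj_on \<sigma> P \<and> \<sigma> ` P \<subseteq> {..<length xs} \<and>
    (\<forall>j\<in>P. A (ys ! j) = xs ! \<sigma> j) \<and>
    (\<forall>j<length ys. j \<notin> P \<longrightarrow> B j \<in> {..<length xs} \<rightarrow> carrier K \<and> A (ys ! j) = lcomb D (B j) xs \<and>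
      (\<forall>i\<in>\<sigma> ` P. B j i = \<zero>\<^bsub>K\<^esub>))"

text \<open>Minimality of the gap is used twice. Against the other entries of the pivot column it
  gives the bound required by \<open>orthogonal_basis_shear\<close>, against those of the pivot row
  the bound required by \<open>orthogonal_basis_replace\<close>. The column is a new one, because
  unfinished rows vanish in the old pivot columns, so earlier pivots survive.\<close>

lemma elimination_step:
  assumes el: "elimination ys xs P \<sigma> B" and j\<^sub>1: "j\<^sub>1 < length ys" "j\<^sub>1 \<notin> P" "A (ys ! j\<^sub>1) \<noteq> \<zero>\<^bsub>D\<^esub>"
  obtains ys' xs' j\<^sub>0 i\<^sub>0 B' where "elimination ys' xs' (insert j\<^sub>0 P) (\<sigma>(j\<^sub>0 := i\<^sub>0)) B'"
    "j\<^sub>0 < length ys" "j\<^sub>0 \<notin> P" "length ys' = length ys"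
proof -
  let ?n = "length ys" and ?m = "length xs"
  have oby: "orthogonal_basis \<Gamma> C \<l>C ys" and obx: "orthogonal_basis \<Gamma> D \<l>D xs"
    and P: "P \<subseteq> {..<?n}" and inj: "inj_on \<sigma> P" and \<sigma>: "\<sigma> ` P \<subseteq> {..<?m}"
    and AP: "\<And>j. j \<in> P \<Longrightarrow> A (ys ! j) = xs ! \<sigma> j"
    using el by (auto simp: elimination_def)
  have B: "B j \<in> {..<?m} \<rightarrow> carrier K" and AB: "A (ys ! j) = lcomb D (B j) xs"
    and B0: "\<And>i. i \<in> \<sigma> ` P \<Longrightarrow> B j i = \<zero>\<^bsub>K\<^esub>" if "j < ?n" "j \<notin> P" for j
    using el that by (auto simp: elimination_def)
  have ys: "set ys \<subseteq> carrier C" using oby by (rule C.orthogonal_basis_carrier)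
  have xs: "set xs \<subseteq> carrier D" using obx by (rule D.orthogonal_basis_carrier)
  have y: "ys ! j \<in> carrier C" "ys ! j \<noteq> \<zero>\<^bsub>C\<^esub>" if "j < ?n" for j
    using C.orthogonal_basis_nth[OF oby that] .
  have x: "xs ! i \<in> carrier D" "xs ! i \<noteq> \<zero>\<^bsub>D\<^esub>" if "i < ?m" for i
    using D.orthogonal_basis_nth[OF obx that] .
  define Q where "Q = {(j, i). j < ?n \<and> j \<notin> P \<and> i < ?m \<and> B j i \<noteq> \<zero>\<^bsub>K\<^esub>}"
  \<comment> \<open>The nonzero entries in \<open>Q\<close> have finite levels, so the minimum is
    taken over real numbers; \<open>lx\<close> and \<open>ly\<close> lead back to the extended
    reals.\<close>
  define gap where "gap p = real_of_ereal (\<l>C (ys ! fst p)) -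
    real_of_ereal (\<l>D (B (fst p) (snd p) \<odot>\<^bsub>D\<^esub> (xs ! snd p)))" for p
  have "finite Q" by (rule finite_subset[of _ "{..<?n} \<times> {..<?m}"]) (auto simp: Q_def)
  moreover have "Q \<noteq> {}"
  proof
    assume "Q = {}"
    then have "B j\<^sub>1 i = \<zero>\<^bsub>K\<^esub>" if "i < ?m" for i using that j\<^sub>1 by (auto simp: Q_def)
    then have "lcomb D (B j\<^sub>1) xs = \<zero>\<^bsub>D\<^esub>" by (intro D.lcomb_zero xs)
    then show False using j\<^sub>1 AB by simp
  qed
  ultimately have "Min (gap ` Q) \<in> gap ` Q" "\<And>q. q \<in> Q \<Longrightarrow> Min (gap ` Q) \<le> gap q" by auto
  then obtain p where p: "p \<in> Q" "\<And>q. q \<in> Q \<Longrightarrow> gap p \<le> gap q" by auto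
  obtain j\<^sub>0 i\<^sub>0 where p_eq: "p = (j\<^sub>0, i\<^sub>0)" by (cases p)
  have j\<^sub>0: "j\<^sub>0 < ?n" "j\<^sub>0 \<notin> P" and i\<^sub>0: "i\<^sub>0 < ?m" and b0: "B j\<^sub>0 i\<^sub>0 \<noteq> \<zero>\<^bsub>K\<^esub>"
    using p(1) by (auto simp: Q_def p_eq)
  have i\<^sub>0P: "i\<^sub>0 \<notin> \<sigma> ` P" using B0[OF j\<^sub>0] b0 by blast
  have Bc: "B j i \<in> carrier K" if "j < ?n" "j \<notin> P" "i < ?m" for j i using B[OF that(1,2)] that(3) by auto
  have lx: "\<exists>r. \<l>D (B j i \<odot>\<^bsub>D\<^esub> (xs ! i)) = ereal r" if "(j, i) \<in> Q" for j i
  proof -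
    have *: "j < ?n" "j \<notin> P" "i < ?m" "B j i \<noteq> \<zero>\<^bsub>K\<^esub>" using that by (auto simp: Q_def)
    obtain r where "\<l>D (xs ! i) = ereal r" using D.level_real x[OF *(3)] by blast
    moreover have "nov_val (B j i) \<noteq> \<infinity>" using *(4) by (simp add: nov_val_eq_PInfty_iff zero_novikov)
    then obtain v where "nov_val (B j i) = ereal v" by (cases "nov_val (B j i)") auto
    ultimately show ?thesis using D.level_smult[OF Bc[OF *(1-3)] x(1)[OF *(3)]] by simp
  qed
  have ly: "\<exists>r. \<l>C (ys ! j) = ereal r" if "j < ?n" for j using C.level_real y[OF that] by blast
  have min: "\<l>C (ys ! j\<^sub>0) - \<l>D (B j\<^sub>0 i\<^sub>0 \<odot>\<^bsub>D\<^esub> (xs ! i\<^sub>0)) \<le> \<l>C (ys ! j) - \<l>D (B j i \<odot>\<^bsub>D\<^esub> (xs ! i))"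
    if q: "(j, i) \<in> Q" for j i
  proof -
    have "j < ?n" using q by (simp add: Q_def)
    then obtain r\<^sub>1 r\<^sub>2 r\<^sub>3 r\<^sub>4 where "\<l>C (ys ! j\<^sub>0) = ereal r\<^sub>1" "\<l>C (ys ! j) = ereal r\<^sub>2"
      "\<l>D (B j\<^sub>0 i\<^sub>0 \<odot>\<^bsub>D\<^esub> (xs ! i\<^sub>0)) = ereal r\<^sub>3" "\<l>D (B j i \<odot>\<^bsub>D\<^esub> (xs ! i)) = ereal r\<^sub>4"
      using ly j\<^sub>0 lx[OF q] lx[of j\<^sub>0 i\<^sub>0] p(1) p_eq by metis
    then show ?thesis using p(2)[OF q] by (simp add: gap_def p_eq)
  qed
  have u: "B j\<^sub>0 i\<^sub>0 \<in> Units K" using b0 Bc[OF j\<^sub>0 i\<^sub>0] by (simp add: C.field_Units)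
  \<comment> \<open>The factor that clears column \<open>i\<^sub>0\<close> in row \<open>j\<close>.
    It is zero for the finished rows and the pivot row, which stay as they are.\<close>
  define c where "c j = (if j \<in> P \<or> j = j\<^sub>0 then \<zero>\<^bsub>K\<^esub> else B j i\<^sub>0 \<otimes>\<^bsub>K\<^esub> inv\<^bsub>K\<^esub> (B j\<^sub>0 i\<^sub>0))" for j
  have c: "c \<in> {..<?n} \<rightarrow> carrier K" using Bc i\<^sub>0 u by (auto simp: c_def)
  \<comment> \<open>In the pivot column the two entries differ by the factor \<open>c j\<close>, so
    comparing their gaps compares \<open>c j\<close> times the pivot vector with
    \<open>ys ! j\<close>.\<close>
  have cB: "c j \<otimes>\<^bsub>K\<^esub> B j\<^sub>0 i\<^sub>0 = B j i\<^sub>0" if "j < ?n" "j \<notin> P" "j \<noteq> j\<^sub>0" for j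
    using that Bc[OF that(1,2) i\<^sub>0] Bc[OF j\<^sub>0 i\<^sub>0] u by (simp add: c_def C.R.m_assoc)
  have c_le: "\<l>C (c j \<odot>\<^bsub>C\<^esub> (ys ! j\<^sub>0)) \<le> \<l>C (ys ! j)" if j: "j < ?n" for j
  proof (cases "j \<in> P \<or> j = j\<^sub>0 \<or> B j i\<^sub>0 = \<zero>\<^bsub>K\<^esub>")
    case True
    then have "c j = \<zero>\<^bsub>K\<^esub>" using u by (auto simp: c_def)
    then show ?thesis using y[OF j\<^sub>0(1)] by simp
  next
    case False
    then have q: "(j, i\<^sub>0) \<in> Q" using j i\<^sub>0 by (auto simp: Q_def)
    have cj: "c j \<in> carrier K" using c j by auto
    have "\<l>D (B j i\<^sub>0 \<odot>\<^bsub>D\<^esub> (xs ! i\<^sub>0)) = \<l>D (c j \<odot>\<^bsub>D\<^esub> (B j\<^sub>0 i\<^sub>0 \<odot>\<^bsub>D\<^esub> (xs ! i\<^sub>0)))"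
      using False j cB[of j] cj Bc[OF j\<^sub>0 i\<^sub>0] x[OF i\<^sub>0] by (simp flip: D.smult_assoc1)
    also have "\<dots> = \<l>D (B j\<^sub>0 i\<^sub>0 \<odot>\<^bsub>D\<^esub> (xs ! i\<^sub>0)) - nov_val (c j)"
      using cj Bc[OF j\<^sub>0 i\<^sub>0] x[OF i\<^sub>0] by (intro D.level_smult) auto
    finally have 1: "\<l>D (B j i\<^sub>0 \<odot>\<^bsub>D\<^esub> (xs ! i\<^sub>0)) = \<l>D (B j\<^sub>0 i\<^sub>0 \<odot>\<^bsub>D\<^esub> (xs ! i\<^sub>0)) - nov_val (c j)" .
    have 2: "\<l>C (c j \<odot>\<^bsub>C\<^esub> (ys ! j\<^sub>0)) = \<l>C (ys ! j\<^sub>0) - nov_val (c j)"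
      using cj y[OF j\<^sub>0(1)] by (intro C.level_smult) auto
    obtain r\<^sub>1 r\<^sub>2 r\<^sub>3 r\<^sub>4 where r: "\<l>C (ys ! j\<^sub>0) = ereal r\<^sub>1" "\<l>C (ys ! j) = ereal r\<^sub>2"
      "\<l>D (B j\<^sub>0 i\<^sub>0 \<odot>\<^bsub>D\<^esub> (xs ! i\<^sub>0)) = ereal r\<^sub>3" "\<l>D (B j i\<^sub>0 \<odot>\<^bsub>D\<^esub> (xs ! i\<^sub>0)) = ereal r\<^sub>4"
      using ly j j\<^sub>0 lx[OF q] lx[of j\<^sub>0 i\<^sub>0] p(1) p_eq by metis
    then obtain v where "nov_val (c j) = ereal v" using 1 by (cases "nov_val (c j)") auto
    then show ?thesis using 1 2 r min[OF q] by simp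
  qed
  let ?ys = "map (\<lambda>j. ys ! j \<ominus>\<^bsub>C\<^esub> c j \<odot>\<^bsub>C\<^esub> (ys ! j\<^sub>0)) [0..<?n]"
  let ?v = "lcomb D (B j\<^sub>0) xs"
  let ?xs = "xs[i\<^sub>0 := ?v]"
  have v: "?v \<in> carrier D" using xs B[OF j\<^sub>0] by (rule D.lcomb_closed)
  have oby': "orthogonal_basis \<Gamma> C \<l>C ?ys"
    by (rule C.orthogonal_basis_shear[OF oby j\<^sub>0(1) c _ c_le]) (simp_all add: c_def)
  have obx': "orthogonal_basis \<Gamma> D \<l>D ?xs"
  \<comment> \<open>Within the pivot row the source vector is the same, so the least gap belongs to
    the term of largest level.\<close>
  proof (rule D.orthogonal_basis_replace[OF obx i\<^sub>0 B[OF j\<^sub>0] b0])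
    fix i assume i: "i < ?m"
    show "\<l>D (B j\<^sub>0 i \<odot>\<^bsub>D\<^esub> (xs ! i)) \<le> \<l>D (B j\<^sub>0 i\<^sub>0 \<odot>\<^bsub>D\<^esub> (xs ! i\<^sub>0))"
    proof (cases "B j\<^sub>0 i = \<zero>\<^bsub>K\<^esub>")
      case True
      then show ?thesis using x[OF i] by simp
    next
      case False
      then have q: "(j\<^sub>0, i) \<in> Q" using i j\<^sub>0 by (simp add: Q_def)
      obtain r\<^sub>1 r\<^sub>2 r\<^sub>3 where "\<l>C (ys ! j\<^sub>0) = ereal r\<^sub>1" "\<l>D (B j\<^sub>0 i\<^sub>0 \<odot>\<^bsub>D\<^esub> (xs ! i\<^sub>0)) = ereal r\<^sub>2"
        "\<l>D (B j\<^sub>0 i \<odot>\<^bsub>D\<^esub> (xs ! i)) = ereal r\<^sub>3"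
        using ly j\<^sub>0 lx[OF q] lx[of j\<^sub>0 i\<^sub>0] p(1) p_eq by metis
      then show ?thesis using min[OF q] by simp
    qed
  qed
  have y'_same: "?ys ! j = ys ! j" if "j \<in> insert j\<^sub>0 P" for j
  proof -
    have "j < ?n" using that P j\<^sub>0 by auto
    moreover have "c j = \<zero>\<^bsub>K\<^esub>" using that by (auto simp: c_def)
    ultimately show ?thesis using y j\<^sub>0 by (simp add: C.M.minus_eq)
  qed
  define B' where "B' j i = B j i \<ominus>\<^bsub>K\<^esub> c j \<otimes>\<^bsub>K\<^esub> B j\<^sub>0 i" for j i
  have "elimination ?ys ?xs (insert j\<^sub>0 P) (\<sigma>(j\<^sub>0 := i\<^sub>0)) B'"
    unfolding elimination_def
  proof (intro conjI oby' obx' ballI allI impI)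
    show "insert j\<^sub>0 P \<subseteq> {..<length ?ys}" using P j\<^sub>0 by auto
    show "inj_on (\<sigma>(j\<^sub>0 := i\<^sub>0)) (insert j\<^sub>0 P)"
      using inj i\<^sub>0P j\<^sub>0 by (auto simp: inj_on_def)
    show "(\<sigma>(j\<^sub>0 := i\<^sub>0)) ` insert j\<^sub>0 P \<subseteq> {..<length ?xs}" using \<sigma> i\<^sub>0 by auto
    show "A (?ys ! j) = ?xs ! (\<sigma>(j\<^sub>0 := i\<^sub>0)) j" if j: "j \<in> insert j\<^sub>0 P" for j
    proof (cases "j = j\<^sub>0")
      case True
      then show ?thesis using y'_same[OF j] AB[OF j\<^sub>0] i\<^sub>0 by simp
    next
      case False
      moreover from this j have "\<sigma> j \<noteq> i\<^sub>0" using i\<^sub>0P by auto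
      ultimately show ?thesis using y'_same[OF j] AP j by simp
    qed
    fix j assume "j < length ?ys" and jP: "j \<notin> insert j\<^sub>0 P"
    then have j: "j < ?n" "j \<notin> P" "j \<noteq> j\<^sub>0" by auto
    have cj: "c j \<in> carrier K" using c j by auto
    have cB0: "(\<lambda>i. c j \<otimes>\<^bsub>K\<^esub> B j\<^sub>0 i) \<in> {..<?m} \<rightarrow> carrier K" using cj Bc[OF j\<^sub>0] by auto
    have B'_closed: "B' j \<in> {..<?m} \<rightarrow> carrier K" using cB0 B[OF j(1,2)] by (auto simp: B'_def Pi_iff)
    then show "B' j \<in> {..<length ?xs} \<rightarrow> carrier K" by simp
    have B'0: "B' j i\<^sub>0 = \<zero>\<^bsub>K\<^esub>" using cB[OF j] Bc[OF j(1,2) i\<^sub>0] by (simp add: B'_def C.R.minus_eq C.R.r_neg)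
    have "A (?ys ! j) = A (ys ! j) \<ominus>\<^bsub>D\<^esub> c j \<odot>\<^bsub>D\<^esub> A (ys ! j\<^sub>0)"
      using j y[OF j(1)] y[OF j\<^sub>0(1)] cj by simp
    also have "\<dots> = lcomb D (B j) xs \<ominus>\<^bsub>D\<^esub> lcomb D (\<lambda>i. c j \<otimes>\<^bsub>K\<^esub> B j\<^sub>0 i) xs"
      using AB[OF j(1,2)] AB[OF j\<^sub>0] D.lcomb_smult[OF xs B[OF j\<^sub>0] cj] by simp
    also have "\<dots> = lcomb D (B' j) xs"
      unfolding B'_def using D.lcomb_diff[OF xs B[OF j(1,2)] cB0] by simp
    \<comment> \<open>The cleared coefficient at \<open>i\<^sub>0\<close> makes the exchange of that
      basis vector harmless.\<close>
    also have "\<dots> = lcomb D (B' j) ?xs"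
      using D.lcomb_update_zero[OF xs v B'_closed B'0] by simp
    finally show "A (?ys ! j) = lcomb D (B' j) ?xs" .
    show "B' j i = \<zero>\<^bsub>K\<^esub>" if "i \<in> (\<sigma>(j\<^sub>0 := i\<^sub>0)) ` insert j\<^sub>0 P" for i
    proof (cases "i = i\<^sub>0")
      case False
      then have "i \<in> \<sigma> ` P" using that by (auto split: if_splits)
      then show ?thesis using B0[OF j(1,2)] B0[OF j\<^sub>0] cj by (simp add: B'_def C.R.minus_eq)
    qed (simp add: B'0)
  qed
  then show thesis using that[of ?ys ?xs j\<^sub>0 i\<^sub>0 B'] j\<^sub>0 by simp
qed

text \<open>Each step turns one more row into a pivot row, so the number of remaining rows
  decreases.\<close>

lemma elimination_complete:
  assumes "elimination ys xs P \<sigma> B"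
  obtains ys' xs' P' \<sigma>' B' where "elimination ys' xs' P' \<sigma>' B'"
    "\<And>j. j < length ys' \<Longrightarrow> j \<notin> P' \<Longrightarrow> A (ys' ! j) = \<zero>\<^bsub>D\<^esub>"
proof -
  have "\<exists>ys' xs' P' \<sigma>' B'. elimination ys' xs' P' \<sigma>' B' \<and>
      (\<forall>j<length ys'. j \<notin> P' \<longrightarrow> A (ys' ! j) = \<zero>\<^bsub>D\<^esub>)"
    using assms
  proof (induction "card ({..<length ys} - P)" arbitrary: ys xs P \<sigma> B rule: less_induct)
    case less
    show ?case
    proof (cases "\<exists>j<length ys. j \<notin> P \<and> A (ys ! j) \<noteq> \<zero>\<^bsub>D\<^esub>")
      case True
      then obtain j\<^sub>1 where "j\<^sub>1 < length ys" "j\<^sub>1 \<notin> P" "A (ys ! j\<^sub>1) \<noteq> \<zero>\<^bsub>D\<^esub>" by blast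
      then obtain ys' xs' j\<^sub>0 i\<^sub>0 B' where *: "elimination ys' xs' (insert j\<^sub>0 P) (\<sigma>(j\<^sub>0 := i\<^sub>0)) B'"
        "j\<^sub>0 < length ys" "j\<^sub>0 \<notin> P" "length ys' = length ys"
        using elimination_step[OF less.prems] by metis
      have "{..<length ys} - insert j\<^sub>0 P = ({..<length ys} - P) - {j\<^sub>0}" by auto
      then have "card ({..<length ys'} - insert j\<^sub>0 P) < card ({..<length ys} - P)"
        using * by (simp only: *(4)) (intro card_Diff1_less; simp)
      from less.hyps[OF this *(1)] show ?thesis .
    qed (use less.prems in blast)
  qed
  then show thesis using that by blast
qed

text \<open>Elimination leaves the pivots in scattered positions. Listing them by decreasing gap,
  with the columns permuted along through \<sigma>, and appending the remaining indices puts both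
  bases into the required order.\<close>

lemma svd_data_exists:
  assumes oby: "orthogonal_basis \<Gamma> C \<l>C ys\<^sub>0" and obx: "orthogonal_basis \<Gamma> D \<l>D xs\<^sub>0"
  obtains r ys xs where "svd_data r ys xs"
proof -
  have "\<exists>b. b \<in> {..<length xs\<^sub>0} \<rightarrow> carrier K \<and> A (ys\<^sub>0 ! j) = lcomb D b xs\<^sub>0" if "j < length ys\<^sub>0" for j
    using D.orthogonal_basis_cases[OF obx, of "A (ys\<^sub>0 ! j)"] C.orthogonal_basis_nth[OF oby that] A.f_im by metis
  then obtain B where "\<And>j. j < length ys\<^sub>0 \<Longrightarrow>
      B j \<in> {..<length xs\<^sub>0} \<rightarrow> carrier K \<and> A (ys\<^sub>0 ! j) = lcomb D (B j) xs\<^sub>0" by metis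
  then have "elimination ys\<^sub>0 xs\<^sub>0 {} id B" using assms by (simp add: elimination_def)
  then obtain ys xs P \<sigma> B where el: "elimination ys xs P \<sigma> B"
    and 0: "\<And>j. j < length ys \<Longrightarrow> j \<notin> P \<Longrightarrow> A (ys ! j) = \<zero>\<^bsub>D\<^esub>"
    using elimination_complete by metis
  let ?n = "length ys" and ?m = "length xs"
  have oby: "orthogonal_basis \<Gamma> C \<l>C ys" and obx: "orthogonal_basis \<Gamma> D \<l>D xs"
    and P: "P \<subseteq> {..<?n}" and inj: "inj_on \<sigma> P" and \<sigma>: "\<sigma> ` P \<subseteq> {..<?m}"
    and AP: "\<And>j. j \<in> P \<Longrightarrow> A (ys ! j) = xs ! \<sigma> j"
    using el by (auto simp: elimination_def)
  have finP: "finite P" using P finite_subset by blast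
  define gap where "gap j = \<l>C (ys ! j) - \<l>D (xs ! \<sigma> j)" for j
  define ps where "ps = rev (sort_key gap (sorted_list_of_set P))"
  define js where "js = ps @ sorted_list_of_set ({..<?n} - P)"
  define ks where "ks = map \<sigma> ps @ sorted_list_of_set ({..<?m} - \<sigma> ` P)"
  have ps: "set ps = P" "distinct ps" using finP by (auto simp: ps_def)
  have js: "set js = {..<?n}" "distinct js" using ps P by (auto simp: js_def)
  have ks: "set ks = {..<?m}" "distinct ks" using ps \<sigma> inj by (auto simp: ks_def distinct_map)
  have sorted: "gap (ps ! j) \<le> gap (ps ! i)" if "i \<le> j" "j < length ps" for i j
  proof -
    have "sorted (rev (map gap ps))" by (simp add: ps_def rev_map)
    then show ?thesis using sorted_rev_nth_mono[of "map gap ps" i j] that by simp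
  qed
  have mem: "ps ! i \<in> P" if "i < length ps" for i using ps that nth_mem by blast
  have perm: "orthogonal_basis \<Gamma> C \<l>C (map ((!) ys) js)" "orthogonal_basis \<Gamma> D \<l>D (map ((!) xs) ks)"
  proof -
    have "distinct ys" "distinct xs" using oby obx by (auto simp: orthogonal_basis_def)
    then have "inj_on ((!) ys) {..<?n}" "inj_on ((!) xs) {..<?m}" by (auto simp: inj_on_nth)
    then show "orthogonal_basis \<Gamma> C \<l>C (map ((!) ys) js)" "orthogonal_basis \<Gamma> D \<l>D (map ((!) xs) ks)"
      using js ks
      by (auto intro!: C.orthogonal_basis_permute[OF oby] D.orthogonal_basis_permute[OF obx]
          simp: distinct_map set_conv_nth[of ys] set_conv_nth[of xs])
  qed
  have "svd_data (length ps) (map ((!) ys) js) (map ((!) xs) ks)"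
    unfolding svd_data_def
  proof (intro conjI perm allI impI)
    show "length ps \<le> length (map ((!) ys) js)" "length ps \<le> length (map ((!) xs) ks)"
      by (simp_all add: js_def ks_def)
    show "A (map ((!) ys) js ! i) = map ((!) xs) ks ! i" if "i < length ps" for i
      using that AP[OF mem[OF that]] by (simp add: js_def ks_def nth_append)
    show "A (map ((!) ys) js ! i) = \<zero>\<^bsub>D\<^esub>" if "i < length (map ((!) ys) js)" "length ps \<le> i" for i
    proof -
      have "js ! i \<notin> P"
        using that js(2) nth_mem[of "i - length ps" "sorted_list_of_set ({..<?n} - P)"]
        by (auto simp: js_def nth_append)
      moreover have "js ! i < ?n" using that js nth_mem[of i js] by auto
      ultimately show ?thesis using 0 that by simp
    qed
    show "\<l>C (map ((!) ys) js ! j) - \<l>D (map ((!) xs) ks ! j) \<le>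
        \<l>C (map ((!) ys) js ! i) - \<l>D (map ((!) xs) ks ! i)" if "i \<le> j" "j < length ps" for i j
      using that sorted[OF that] by (simp add: js_def ks_def nth_append gap_def)
  qed
  then show thesis by (rule that)
qed

end

section \<open>Image, kernel and rank of a map in decomposed form\<close>

lemma (in module) lcomb_all_zero:
  assumes "set ws \<subseteq> {\<zero>\<^bsub>M\<^esub>}" "a \<in> {..<length ws} \<rightarrow> carrier R"
  shows "lcomb M a ws = \<zero>\<^bsub>M\<^esub>"
proof -
  have "ws ! i = \<zero>\<^bsub>M\<^esub>" if "i < length ws" for i using assms(1) nth_mem[OF that] by blast
  then show ?thesis
    unfolding lcomb_def using assms(2) by (intro M.add.finprod_one_eqI) (auto simp: Pi_iff)
qed

context nonarch_linear_map
begin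

text \<open>In adapted bases the map just truncates the coordinates to the first \<open>r\<close>;
  image, kernel and rank are read off from this.\<close>

lemma svd_data_lcomb:
  assumes svd: "svd_data r ys xs" and a: "a \<in> {..<length ys} \<rightarrow> carrier K"
  shows "A (lcomb C a ys) = lcomb D a (take r xs)"
proof -
  have r: "r \<le> length ys" "r \<le> length xs" and ob: "orthogonal_basis \<Gamma> C \<l>C ys" "orthogonal_basis \<Gamma> D \<l>D xs"
    using svd by (auto simp: svd_data_def)
  have ys: "set ys \<subseteq> carrier C" and xs: "set xs \<subseteq> carrier D"
    using ob C.orthogonal_basis_carrier D.orthogonal_basis_carrier by auto
  have eq: "map A ys = take r xs @ map A (drop r ys)"
    using svd r by (intro nth_equalityI) (auto simp: svd_data_def nth_append)
  have z: "set (map A (drop r ys)) \<subseteq> {\<zero>\<^bsub>D\<^esub>}"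
  proof
    fix v assume "v \<in> set (map A (drop r ys))"
    then obtain i where i: "i < length (drop r ys)" "v = A (drop r ys ! i)" by (auto simp: in_set_conv_nth)
    then show "v \<in> {\<zero>\<^bsub>D\<^esub>}" using svd by (auto simp: svd_data_def)
  qed
  have tk: "set (take r xs) \<subseteq> carrier D" using xs set_take_subset[of r xs] by auto
  have "A (lcomb C a ys) = lcomb D a (take r xs @ map A (drop r ys))"
    using A.hom_lcomb[OF ys a] eq by simp
  also have "\<dots> = lcomb D a (take r xs) \<oplus>\<^bsub>D\<^esub> lcomb D (\<lambda>i. a (length (take r xs) + i)) (map A (drop r ys))"
    using tk z a r by (intro D.lcomb_append) auto
  also have "lcomb D (\<lambda>i. a (length (take r xs) + i)) (map A (drop r ys)) = \<zero>\<^bsub>D\<^esub>"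
    using z a r by (intro D.lcomb_all_zero) auto
  finally have "A (lcomb C a ys) = lcomb D a (take r xs) \<oplus>\<^bsub>D\<^esub> \<zero>\<^bsub>D\<^esub>" .
  moreover have "a \<in> {..<length (take r xs)} \<rightarrow> carrier K" using a r by auto
  ultimately show ?thesis using D.lcomb_closed[OF tk, of a] by simp
qed

lemma svd_data_im:
  assumes svd: "svd_data r ys xs"
  shows "A.im = D.span (set (take r xs))"
proof -
  have r: "r \<le> length ys" "r \<le> length xs" and ob: "orthogonal_basis \<Gamma> C \<l>C ys" "orthogonal_basis \<Gamma> D \<l>D xs"
    using svd by (auto simp: svd_data_def)
  have ys: "set ys \<subseteq> carrier C" using ob C.orthogonal_basis_carrier by auto
  have tk: "set (take r xs) \<subseteq> carrier D"
    using D.orthogonal_basis_carrier[OF ob(2)] set_take_subset[of r xs] by auto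
  show ?thesis
    unfolding D.span_set_eq[OF tk] A.im_def
  proof (intro equalityI subsetI)
    fix w assume "w \<in> A ` carrier C"
    then obtain v where v: "v \<in> carrier C" "w = A v" by auto
    then obtain a where a: "a \<in> {..<length ys} \<rightarrow> carrier K" "v = lcomb C a ys"
      using C.orthogonal_basis_cases[OF ob(1)] by metis
    then have "w = lcomb D a (take r xs)" using svd_data_lcomb[OF svd] v by simp
    moreover have "a \<in> {..<length (take r xs)} \<rightarrow> carrier K" using a r by auto
    ultimately show "w \<in> {lcomb D a (take r xs) |a. a \<in> {..<length (take r xs)} \<rightarrow> carrier K}" by blast
  next
    fix w assume "w \<in> {lcomb D a (take r xs) |a. a \<in> {..<length (take r xs)} \<rightarrow> carrier K}"
    then obtain a where a: "a \<in> {..<r} \<rightarrow> carrier K" "w = lcomb D a (take r xs)" using r by auto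
    let ?a = "\<lambda>i. if i < r then a i else \<zero>\<^bsub>K\<^esub>"
    have a': "?a \<in> {..<length ys} \<rightarrow> carrier K" using a by auto
    have "w = lcomb D ?a (take r xs)"
      unfolding a(2) by (rule D.lcomb_cong[OF tk]) (use a r in auto)
    then have "w = A (lcomb C ?a ys)" using svd_data_lcomb[OF svd a'] by simp
    moreover have "lcomb C ?a ys \<in> carrier C" using ys a' by (rule C.lcomb_closed)
    ultimately show "w \<in> A ` carrier C" by blast
  qed
qed

lemma svd_data_ker:
  assumes svd: "svd_data r ys xs"
  shows "A.ker = C.span (set (drop r ys))"
proof -
  have r: "r \<le> length ys" "r \<le> length xs" and ob: "orthogonal_basis \<Gamma> C \<l>C ys" "orthogonal_basis \<Gamma> D \<l>D xs"
    using svd by (auto simp: svd_data_def)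
  have ys: "set ys \<subseteq> carrier C" using ob C.orthogonal_basis_carrier by auto
  have dr: "set (drop r ys) \<subseteq> carrier C" "set (take r ys) \<subseteq> carrier C"
    using ys set_drop_subset[of r ys] set_take_subset[of r ys] by auto
  have sub: "submodule K A.ker C" by (rule A.ker_is_submodule)
  show ?thesis
  proof
    show "C.span (set (drop r ys)) \<subseteq> A.ker"
    proof (rule C.span_is_subset[OF _ sub])
      show "set (drop r ys) \<subseteq> A.ker"
      proof
        fix v assume "v \<in> set (drop r ys)"
        then obtain i where "i < length (drop r ys)" "v = drop r ys ! i" by (auto simp: in_set_conv_nth)
        then have "r + i < length ys" "v = ys ! (r + i)" using r by auto
        moreover from this have "v \<in> carrier C" using C.orthogonal_basis_nth[OF ob(1)] by simp
        ultimately show "v \<in> A.ker" using svd by (auto simp: A.ker_def svd_data_def)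
      qed
    qed
    show "A.ker \<subseteq> C.span (set (drop r ys))"
    proof
      fix v assume "v \<in> A.ker"
      then have v: "v \<in> carrier C" "A v = \<zero>\<^bsub>D\<^esub>" by (auto simp: A.ker_def)
      then obtain a where a: "a \<in> {..<length ys} \<rightarrow> carrier K" "v = lcomb C a ys"
        using C.orthogonal_basis_cases[OF ob(1)] by metis
      then have 0: "lcomb D a (take r xs) = \<zero>\<^bsub>D\<^esub>" using svd_data_lcomb[OF svd] v by simp
      have "a \<in> {..<length (take r xs)} \<rightarrow> carrier K" using a r by auto
      \<comment> \<open>The image is a combination of the first \<open>r\<close> target vectors,
        which are independent; so only the tail of the source basis remains.\<close>
      then have "a i = \<zero>\<^bsub>K\<^esub>" if "i < r" for i
        using D.orthogonal_independent[OF D.orthogonal_basis_part(1,2)[OF ob(2)] _ 0, of i] r that by simp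
      then have "lcomb C a (take r ys) = \<zero>\<^bsub>C\<^esub>" using r by (intro C.lcomb_zero dr) auto
      moreover have "lcomb C a (take r ys @ drop r ys) =
        lcomb C a (take r ys) \<oplus>\<^bsub>C\<^esub> lcomb C (\<lambda>i. a (length (take r ys) + i)) (drop r ys)"
        using a r by (intro C.lcomb_append dr) auto
      moreover have c: "(\<lambda>i. a (length (take r ys) + i)) \<in> {..<length (drop r ys)} \<rightarrow> carrier K"
        using a r by auto
      ultimately have "v = lcomb C (\<lambda>i. a (length (take r ys) + i)) (drop r ys)"
        using a(2) C.lcomb_closed[OF dr(1) c] by simp
      then show "v \<in> C.span (set (drop r ys))" unfolding C.span_set_eq[OF dr(1)] using c by blast
    qed
  qed
qed

lemma rank_svd_data:
  assumes svd: "svd_data r ys xs"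
  shows "rank_of \<Gamma> C D A = r"
proof -
  have r: "r \<le> length xs" and ob: "orthogonal_basis \<Gamma> D \<l>D xs" using svd by (auto simp: svd_data_def)
  have sub: "submodule K A.im D" by (rule A.im_is_submodule)
  interpret I: nonarch_normed_space \<Gamma> "D\<lparr>carrier := A.im\<rparr>" \<l>D
    using sub by (rule D.nonarch_normed_space_subspace)
  have "orthogonal_basis \<Gamma> (D\<lparr>carrier := A.im\<rparr>) \<l>D (take r xs)"
    unfolding D.orthogonal_basis_subspace_iff[OF sub]
    using D.orthogonal_basis_part[OF ob] svd_data_im[OF svd] by simp
  then have "distinct (take r xs)" "I.basis (set (take r xs))" by (auto simp: orthogonal_basis_def)
  then have "I.dim = r" using I.dim_basis[of "set (take r xs)"] r by (simp add: distinct_card)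
  then show ?thesis by (simp add: rank_of_def)
qed

text \<open>From right to left, kernel and image have been computed. From left to right,
  \<open>take\<close> and \<open>drop\<close> accept an index beyond the end of a list, so that
  \<open>r\<close> fits has to be derived: for \<open>xs\<close> by counting a basis of the image,
  for \<open>ys\<close> by rank and nullity.\<close>

lemma is_svd_iff: "is_svd \<Gamma> C \<l>C D \<l>D A ys xs \<longleftrightarrow> svd_data (rank_of \<Gamma> C D A) ys xs"
proof
  let ?r = "rank_of \<Gamma> C D A"
  have sub_im: "submodule K A.im D" by (rule A.im_is_submodule)
  have sub_ker: "submodule K A.ker C" by (rule A.ker_is_submodule)
  {
    assume svd: "svd_data ?r ys xs"
    have ob: "orthogonal_basis \<Gamma> C \<l>C ys" "orthogonal_basis \<Gamma> D \<l>D xs" using svd by (auto simp: svd_data_def)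
    have "orthogonal_basis \<Gamma> (C\<lparr>carrier := A.ker\<rparr>) \<l>C (drop ?r ys)"
      unfolding C.orthogonal_basis_subspace_iff[OF sub_ker]
      using C.orthogonal_basis_part[OF ob(1)] svd_data_ker[OF svd] by simp
    moreover have "orthogonal_basis \<Gamma> (D\<lparr>carrier := A.im\<rparr>) \<l>D (take ?r xs)"
      unfolding D.orthogonal_basis_subspace_iff[OF sub_im]
      using D.orthogonal_basis_part[OF ob(2)] svd_data_im[OF svd] by simp
    ultimately show "is_svd \<Gamma> C \<l>C D \<l>D A ys xs"
      using svd by (simp add: is_svd_def svd_data_def Let_def)
  }
  assume svd: "is_svd \<Gamma> C \<l>C D \<l>D A ys xs"
  then have ob: "orthogonal_basis \<Gamma> C \<l>C ys" "orthogonal_basis \<Gamma> D \<l>D xs"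
    and ker: "orthogonal_basis \<Gamma> (C\<lparr>carrier := A.ker\<rparr>) \<l>C (drop ?r ys)"
    and im: "orthogonal_basis \<Gamma> (D\<lparr>carrier := A.im\<rparr>) \<l>D (take ?r xs)"
    by (auto simp: is_svd_def Let_def)
  interpret I: nonarch_normed_space \<Gamma> "D\<lparr>carrier := A.im\<rparr>" \<l>D
    using sub_im by (rule D.nonarch_normed_space_subspace)
  have "I.dim = card (set (take ?r xs))"
    using im by (intro I.dim_basis) (auto simp: orthogonal_basis_def)
  moreover have "distinct (take ?r xs)" using im by (simp add: orthogonal_basis_def)
  ultimately have "?r = min ?r (length xs)" by (simp add: rank_of_def distinct_card min.commute)
  then have rx: "?r \<le> length xs" by simp
  have fin: "C.fin_dim"
    using ob(1) by (auto simp: C.fin_dim_def orthogonal_basis_def C.basis_def)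
  have "C.dim = card (set ys)"
    using ob(1) by (intro C.dim_basis) (auto simp: orthogonal_basis_def)
  also have "\<dots> = length ys" using ob(1) by (simp add: orthogonal_basis_def distinct_card)
  finally have ry: "?r \<le> length ys" using A.rank_nullity[OF fin] by (simp add: rank_of_def)
  have "A (ys ! i) = \<zero>\<^bsub>D\<^esub>" if i: "i < length ys" "?r \<le> i" for i
  proof -
    have "ys ! i \<in> set (drop ?r ys)"
      using i nth_mem[of "i - ?r" "drop ?r ys"] by simp
    moreover have "set (drop ?r ys) \<subseteq> A.ker"
      using ker C.in_own_span[of "set (drop ?r ys)"]
      by (auto simp: C.orthogonal_basis_subspace_iff[OF sub_ker] orthogonal_lcomb)
    ultimately show ?thesis by (auto simp: A.ker_def)
  qed
  then show "svd_data ?r ys xs"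
    using svd ob rx ry by (simp add: svd_data_def is_svd_def Let_def)
qed

end

section \<open>Uniqueness of the barcode\<close>

text \<open>Fewer homogeneous equations than unknowns over the ground field; the induction removes
  one equation together with one unknown.\<close>

lemma underdetermined_system:
  fixes M :: "'i \<Rightarrow> 'j \<Rightarrow> 'k::field"
  assumes "finite J" "finite I" "card J < card I"
  obtains c where "\<exists>i\<in>I. c i \<noteq> 0" "\<And>j. j \<in> J \<Longrightarrow> (\<Sum>i\<in>I. c i * M i j) = 0"
proof -
  have "\<exists>c. (\<exists>i\<in>I. c i \<noteq> 0) \<and> (\<forall>j\<in>J. (\<Sum>i\<in>I. c i * M i j) = 0)"
    using assms
  proof (induction J arbitrary: I M)
    case empty
    then show ?case by (intro exI[of _ "\<lambda>_. 1"]) (auto simp: card_gt_0_iff)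
  next
    case (insert j J)
    show ?case
    proof (cases "\<forall>i\<in>I. M i j = 0")
      case True
      have "card J < card I" using insert by simp
      with insert.IH[OF insert.prems(1)]
      obtain c where "\<exists>i\<in>I. c i \<noteq> 0" "\<forall>j\<in>J. (\<Sum>i\<in>I. c i * M i j) = 0" by blast
      moreover have "(\<Sum>i\<in>I. c i * M i j) = 0" using True by simp
      ultimately show ?thesis by blast
    next
      case False
      then obtain i\<^sub>0 where i\<^sub>0: "i\<^sub>0 \<in> I" "M i\<^sub>0 j \<noteq> 0" by blast
      let ?I = "I - {i\<^sub>0}"
      have fin: "finite ?I" and "card J < card ?I" using insert i\<^sub>0 by auto
      from insert.IH[OF this, of "\<lambda>i j'. M i j' - M i j / M i\<^sub>0 j * M i\<^sub>0 j'"]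
      obtain c where c: "\<exists>i\<in>?I. c i \<noteq> 0"
        "\<And>j'. j' \<in> J \<Longrightarrow> (\<Sum>i\<in>?I. c i * (M i j' - M i j / M i\<^sub>0 j * M i\<^sub>0 j')) = 0" by blast
      \<comment> \<open>The value \<open>- d\<close> for the unknown \<open>i\<^sub>0\<close> solves
        equation \<open>j\<close>; the smaller system has this value already substituted.\<close>
      define d where "d = (\<Sum>i\<in>?I. c i * M i j / M i\<^sub>0 j)"
      have sum: "(\<Sum>i\<in>I. (c(i\<^sub>0 := - d)) i * M i j') = (\<Sum>i\<in>?I. c i * (M i j' - M i j / M i\<^sub>0 j * M i\<^sub>0 j'))" for j'
      proof -
        have "(\<Sum>i\<in>I. (c(i\<^sub>0 := - d)) i * M i j') = - d * M i\<^sub>0 j' + (\<Sum>i\<in>?I. c i * M i j')"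
          using insert.prems(1) i\<^sub>0 by (subst sum.remove[of _ i\<^sub>0]) auto
        also have "- d * M i\<^sub>0 j' = - (\<Sum>i\<in>?I. c i * (M i j / M i\<^sub>0 j * M i\<^sub>0 j'))"
          by (simp add: d_def sum_distrib_right mult.assoc)
        finally show ?thesis by (simp add: right_diff_distrib sum_subtractf)
      qed
      have "(\<Sum>i\<in>I. (c(i\<^sub>0 := - d)) i * M i j) = 0"
        unfolding sum using i\<^sub>0 by simp
      moreover have "(\<Sum>i\<in>I. (c(i\<^sub>0 := - d)) i * M i j') = 0" if "j' \<in> J" for j'
        unfolding sum using c(2)[OF that] .
      moreover have "\<exists>i\<in>I. (c(i\<^sub>0 := - d)) i \<noteq> 0" using c(1) by auto
      ultimately show ?thesis by blast
    qed
  qed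
  then show thesis using that by blast
qed

context nonarch_normed_space
begin

text \<open>The bound stays strict because a finite maximum is attained;
  \<open>-\<infinity> < s\<close> takes care of the empty list.\<close>

lemma level_lcomb_less:
  assumes "set ws \<subseteq> carrier C" "a \<in> {..<length ws} \<rightarrow> carrier K" "-\<infinity> < s"
    and "\<And>i. i < length ws \<Longrightarrow> \<l> (a i \<odot>\<^bsub>C\<^esub> (ws ! i)) < s"
  shows "\<l> (lcomb C a ws) < s"
proof (cases "ws = []")
  case False
  let ?S = "(\<lambda>i. \<l> (a i \<odot>\<^bsub>C\<^esub> (ws ! i))) ` {..<length ws}"
  have ne: "?S \<noteq> {}" using False by auto
  have "\<l> (lcomb C a ws) \<le> Max ?S"
    by (rule level_lcomb_le[OF assms(1,2)]) (intro Max_ge; simp)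
  also have "Max ?S < s" using Max_in[OF _ ne] assms(4) by auto
  finally show ?thesis .
qed (use assms in simp)

text \<open>\<open>lead xs a j\<close> is the exponent at which the coefficient of \<open>xs ! j\<close> contributes to level \<open>a\<close>.\<close>

definition lead :: "'c list \<Rightarrow> real \<Rightarrow> nat \<Rightarrow> real" where
  "lead xs a j = real_of_ereal (\<l> (xs ! j)) - a"

lemma level_eq_lead:
  assumes "orthogonal_basis \<Gamma> C \<l> xs" "i < length xs"
  shows "\<l> (xs ! i) = ereal (lead xs a i + a)"
proof -
  obtain r where "\<l> (xs ! i) = ereal r" using level_real[OF orthogonal_basis_nth[OF assms]] .
  then show ?thesis by (simp add: lead_def)
qed

text \<open>Both conditions compare the valuation of \<open>c\<close> with \<open>lead\<close>. The
  difference between them is the coefficient at that one exponent, which records the vector modulo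
  lower level.\<close>

lemma level_smult_lead_le_iff:
  assumes ob: "orthogonal_basis \<Gamma> C \<l> xs" and i: "i < length xs" and c: "c \<in> carrier K"
  shows "\<l> (c \<odot>\<^bsub>C\<^esub> (xs ! i)) \<le> ereal a \<longleftrightarrow> (\<forall>g<lead xs a i. c g = 0)"
    and "\<l> (c \<odot>\<^bsub>C\<^esub> (xs ! i)) < ereal a \<longleftrightarrow> (\<forall>g\<le>lead xs a i. c g = 0)"
proof -
  have lf: "left_finite c" using c by (simp add: carrier_novikov_iff)
  have "\<l> (c \<odot>\<^bsub>C\<^esub> (xs ! i)) = ereal (lead xs a i + a) - nov_val c"
    using level_smult[OF c] orthogonal_basis_nth[OF ob i] level_eq_lead[OF ob i, of a] by simp
  then show "\<l> (c \<odot>\<^bsub>C\<^esub> (xs ! i)) \<le> ereal a \<longleftrightarrow> (\<forall>g<lead xs a i. c g = 0)"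
    "\<l> (c \<odot>\<^bsub>C\<^esub> (xs ! i)) < ereal a \<longleftrightarrow> (\<forall>g\<le>lead xs a i. c g = 0)"
    unfolding nov_val_ge_iff[OF lf, symmetric] nov_val_gt_iff[OF lf, symmetric]
    by (cases "nov_val c"; simp add: algebra_simps)+
qed

text \<open>A set \<open>W\<close> of vectors of level at most \<open>a\<close> is compared with its coefficients at the leading
  exponents; the number of basis vectors seen by \<open>W\<close> is a dimension over the ground field, hence
  does not depend on the basis.\<close>

lemma card_leading_le:
  assumes \<Gamma>: "subgroup \<Gamma> real_group"
    and ob: "orthogonal_basis \<Gamma> C \<l> xs" and ob': "orthogonal_basis \<Gamma> C \<l> xs'"
    and I: "I \<subseteq> {..<length xs}" and I': "I' \<subseteq> {..<length xs'}"
    and W: "\<And>v. v \<in> W \<Longrightarrow> \<l> v \<le> ereal a"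
    and IW: "\<And>i. i \<in> I \<Longrightarrow> lead xs a i \<in> \<Gamma> \<and> nov_monom 1 (lead xs a i) \<odot>\<^bsub>C\<^esub> (xs ! i) \<in> W"
    and I'W: "\<And>b j. b \<in> {..<length xs'} \<rightarrow> carrier K \<Longrightarrow> lcomb C b xs' \<in> W \<Longrightarrow>
      j < length xs' \<Longrightarrow> j \<notin> I' \<Longrightarrow> b j (lead xs' a j) = 0"
  shows "card I \<le> card I'"
proof (rule ccontr)
  let ?n = "length xs" and ?m = "length xs'"
  assume "\<not> card I \<le> card I'"
  then have card: "card I' < card I" by simp
  have fin: "finite I" "finite I'" using I I' finite_subset by blast+
  have xs: "set xs \<subseteq> carrier C" and xs': "set xs' \<subseteq> carrier C"
    using ob ob' orthogonal_basis_carrier by auto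
  have x: "xs ! i \<in> carrier C" if "i < ?n" for i using orthogonal_basis_nth[OF ob that] by simp
  have orth: "orthogonal \<Gamma> C \<l> xs" "orthogonal \<Gamma> C \<l> xs'" using ob ob' by (auto simp: orthogonal_basis_def)
  \<comment> \<open>Shifts \<open>xs ! i\<close> to level exactly \<open>a\<close>; positions
    outside \<open>I\<close> get the scalar zero so that the whole list can be kept.\<close>
  define t where "t i = (if i \<in> I then nov_monom 1 (lead xs a i) else \<zero>\<^bsub>K\<^esub>)" for i
  have t: "t i \<in> carrier K" for i using IW by (auto simp: t_def intro: nov_monom_closed)
  let ?ws = "map (\<lambda>i. t i \<odot>\<^bsub>C\<^esub> (xs ! i)) [0..<?n]"
  have ws: "set ?ws \<subseteq> carrier C" using t x by auto
  have "\<exists>b. b \<in> {..<?m} \<rightarrow> carrier K \<and> t i \<odot>\<^bsub>C\<^esub> (xs ! i) = lcomb C b xs'" if "i < ?n" for i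
    using orthogonal_basis_cases[OF ob', of "t i \<odot>\<^bsub>C\<^esub> (xs ! i)"] t x[OF that] by (metis smult_closed)
  then obtain P where P: "\<And>i. i < ?n \<Longrightarrow> P i \<in> {..<?m} \<rightarrow> carrier K"
    and tP: "\<And>i. i < ?n \<Longrightarrow> t i \<odot>\<^bsub>C\<^esub> (xs ! i) = lcomb C (P i) xs'" by metis
  \<comment> \<open>If \<open>I\<close> were the larger set, some nontrivial combination over the
    ground field would have no leading coefficients at the positions in \<open>I'\<close>.\<close>
  obtain c where c: "\<exists>i\<in>I. c i \<noteq> 0" and c0: "\<And>j. j \<in> I' \<Longrightarrow> (\<Sum>i\<in>I. c i * P i j (lead xs' a j)) = 0"
    using underdetermined_system[OF fin(2,1) card, of "\<lambda>i j. P i j (lead xs' a j)"] by metis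
  \<comment> \<open>The ground field sits in the Novikov field as the monomials with exponent
    \<open>0\<close>, which lie over every \<Gamma> and do not change levels unless they
    vanish.\<close>
  define d where "d i = nov_monom (if i \<in> I then c i else 0) 0" for i
  have d: "d i \<in> carrier K" for i
    unfolding d_def by (rule nov_monom_closed[OF subgroup_real_group_zero[OF \<Gamma>]])
  let ?v = "lcomb C d ?ws"
  have "?v = lcomb C (\<lambda>i. d i \<otimes>\<^bsub>K\<^esub> t i) xs"
    unfolding lcomb_def using d t x by (auto intro!: M.finsum_cong' simp: smult_assoc1)
  moreover obtain i\<^sub>1 where i\<^sub>1: "i\<^sub>1 \<in> I" "c i\<^sub>1 \<noteq> 0" using c by blast
  moreover have "\<l> ((d i\<^sub>1 \<otimes>\<^bsub>K\<^esub> t i\<^sub>1) \<odot>\<^bsub>C\<^esub> (xs ! i\<^sub>1)) = ereal a"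
  proof -
    have i\<^sub>1n: "i\<^sub>1 < ?n" using i\<^sub>1 I by auto
    have "\<l> ((d i\<^sub>1 \<otimes>\<^bsub>K\<^esub> t i\<^sub>1) \<odot>\<^bsub>C\<^esub> (xs ! i\<^sub>1)) = \<l> (xs ! i\<^sub>1) - nov_val (t i\<^sub>1) - nov_val (d i\<^sub>1)"
      using d t x[OF i\<^sub>1n] by (simp add: smult_assoc1 level_smult)
    then show ?thesis
      using i\<^sub>1 by (simp add: level_eq_lead[OF ob i\<^sub>1n, of a] t_def d_def nov_val_monom)
  qed
  ultimately have ge: "ereal a \<le> \<l> ?v"
    using orthogonal_le[OF orth(1), of "\<lambda>i. d i \<otimes>\<^bsub>K\<^esub> t i" i\<^sub>1] d t I by auto
  define \<mu> where "\<mu> j = (\<Oplus>\<^bsub>K\<^esub>i\<in>{..<length ?ws}. d i \<otimes>\<^bsub>K\<^esub> P i j)" for j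
  have v: "?v = lcomb C \<mu> xs'"
    unfolding \<mu>_def by (rule lcomb_lcomb[OF xs' ws]) (use d P tP in auto)
  have dP: "(\<lambda>i. d i \<otimes>\<^bsub>K\<^esub> P i j) \<in> {..<?n} \<rightarrow> carrier K" if "j < ?m" for j
    using d P that by (intro Pi_I R.m_closed) (auto simp: Pi_iff)
  have \<mu>: "\<mu> \<in> {..<?m} \<rightarrow> carrier K"
    unfolding \<mu>_def using dP by (intro Pi_I R.finsum_closed) auto
  have \<mu>_eq: "\<mu> j g = (\<Sum>i\<in>I. c i * P i j g)" if j: "j < ?m" for j g
  proof -
    have "\<mu> j g = (\<Sum>i<?n. (if i \<in> I then c i else 0) * P i j g)"
      unfolding \<mu>_def using finsum_novikov[OF \<Gamma> dP[OF j]]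
      by (simp add: mult_novikov d_def convolution_nov_monom)
    also have "\<dots> = (\<Sum>i\<in>I. c i * P i j g)"
      by (rule sum.mono_neutral_cong_right) (use I in auto)
    finally show ?thesis .
  qed
  \<comment> \<open>The contradiction: in the first basis the combination has a term of level
    \<open>a\<close> that cannot cancel, while in the second every term is strictly lower.
    Coefficients below the leading exponent vanish because the summands lie in \<open>W\<close>;
    those at it vanish by the choice of \<open>c\<close> or by the hypothesis on
    \<open>I'\<close>.\<close>
  have "\<l> (\<mu> j \<odot>\<^bsub>C\<^esub> (xs' ! j)) < ereal a" if j: "j < ?m" for j
  proof -
    have PW: "lcomb C (P i) xs' \<in> W" if "i \<in> I" for i
      using IW[OF that] tP[of i] I that by (auto simp: t_def)
    have "P i j g = 0" if "i \<in> I" "g < lead xs' a j" for i g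
    proof -
      have i: "i < ?n" using that I by auto
      have "\<l> (P i j \<odot>\<^bsub>C\<^esub> (xs' ! j)) \<le> \<l> (lcomb C (P i) xs')"
        using orthogonal_le[OF orth(2) P[OF i] j] .
      also have "\<dots> \<le> ereal a" using PW[OF that(1)] by (rule W)
      finally show ?thesis
        using level_smult_lead_le_iff(1)[OF ob' j, of "P i j"] P[OF i] j that by auto
    qed
    then have "\<mu> j g = 0" if "g < lead xs' a j" for g using that by (simp add: \<mu>_eq[OF j])
    moreover have "\<mu> j (lead xs' a j) = 0"
    proof (cases "j \<in> I'")
      case True
      then show ?thesis using c0 by (simp add: \<mu>_eq[OF j])
    next
      case False
      have "P i j (lead xs' a j) = 0" if "i \<in> I" for i
        using I'W[OF P PW[OF that] j False] that I by auto
      then show ?thesis by (simp add: \<mu>_eq[OF j])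
    qed
    ultimately have "\<forall>g\<le>lead xs' a j. \<mu> j g = 0" by (auto simp: order.order_iff_strict)
    then show ?thesis using level_smult_lead_le_iff(2)[OF ob' j, of "\<mu> j"] \<mu> j by auto
  qed
  then have "\<l> ?v < ereal a" unfolding v by (intro level_lcomb_less xs' \<mu>) auto
  with ge show False by simp
qed

text \<open>With \<open>W\<close> the full ball this counts all bars over the coset of
  \<open>a\<close>, finite or not. A position whose leading exponent is outside \<Gamma> carries no
  coefficient there.\<close>

lemma card_lead_le:
  assumes \<Gamma>: "subgroup \<Gamma> real_group"
    and ob: "orthogonal_basis \<Gamma> C \<l> xs" and ob': "orthogonal_basis \<Gamma> C \<l> xs'"
  shows "card {i. i < length xs \<and> lead xs a i \<in> \<Gamma>} \<le> card {i. i < length xs' \<and> lead xs' a i \<in> \<Gamma>}"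
proof (rule card_leading_le[OF \<Gamma> ob ob', where W = "{v. \<l> v \<le> ereal a}" and a = a])
  fix i assume "i \<in> {i. i < length xs \<and> lead xs a i \<in> \<Gamma>}"
  then have i: "i < length xs" "lead xs a i \<in> \<Gamma>" by auto
  have "\<l> (nov_monom 1 (lead xs a i) \<odot>\<^bsub>C\<^esub> (xs ! i)) \<le> ereal a"
    using i nov_monom_closed[OF i(2), of 1]
    by (subst level_smult_lead_le_iff[OF ob]) (auto simp: nov_monom_def)
  with i show "lead xs a i \<in> \<Gamma> \<and> nov_monom 1 (lead xs a i) \<odot>\<^bsub>C\<^esub> (xs ! i) \<in> {v. \<l> v \<le> ereal a}" by simp
next
  fix b j assume "b \<in> {..<length xs'} \<rightarrow> carrier K" "j < length xs'" "j \<notin> {i. i < length xs' \<and> lead xs' a i \<in> \<Gamma>}"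
  then show "b j (lead xs' a j) = 0" by (auto simp: Pi_iff carrier_novikov_iff)
qed auto

end

context nonarch_linear_map
begin

text \<open>The condition on \<open>lead\<close> says that the level of \<open>xs ! i\<close> lies
  in the coset of \<open>a\<close>.\<close>

definition short_bars :: "nat \<Rightarrow> 'c list \<Rightarrow> 'd list \<Rightarrow> real \<Rightarrow> ereal \<Rightarrow> nat set" where
  "short_bars r ys xs a L = {i. i < r \<and> D.lead xs a i \<in> \<Gamma> \<and> \<l>C (ys ! i) - \<l>D (xs ! i) \<le> L}"

text \<open>For a short bar the shift of \<open>ys ! i\<close> is a preimage of low enough level.
  Conversely, a preimage has at \<open>ys' ! j\<close> the same coefficient as its image at
  \<open>xs' ! j\<close>. If bar \<open>j\<close> is longer than \<open>L\<close>, orthogonality of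
  \<open>ys'\<close> forces the valuation of this coefficient above \<open>lead\<close>, so the bar
  is not seen.\<close>

lemma card_short_bars_le:
  assumes \<Gamma>: "subgroup \<Gamma> real_group" and svd: "svd_data r ys xs" and svd': "svd_data r' ys' xs'"
    and L: "L \<noteq> \<infinity>"
  shows "card (short_bars r ys xs a L) \<le> card (short_bars r' ys' xs' a L)"
proof -
  have r: "r \<le> length ys" "r \<le> length xs" and ob: "orthogonal_basis \<Gamma> C \<l>C ys" "orthogonal_basis \<Gamma> D \<l>D xs"
    using svd by (auto simp: svd_data_def)
  have r': "r' \<le> length ys'" "r' \<le> length xs'" and ob': "orthogonal_basis \<Gamma> C \<l>C ys'" "orthogonal_basis \<Gamma> D \<l>D xs'"
    using svd' by (auto simp: svd_data_def)
  have xs': "set xs' \<subseteq> carrier D" using ob' D.orthogonal_basis_carrier by auto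
  let ?W = "{v. \<l>D v \<le> ereal a \<and> (\<exists>u\<in>carrier C. A u = v \<and> \<l>C u \<le> ereal a + L)}"
  show ?thesis
  proof (rule D.card_leading_le[OF \<Gamma> ob(2) ob'(2), where W = ?W and a = a])
    show "short_bars r ys xs a L \<subseteq> {..<length xs}" "short_bars r' ys' xs' a L \<subseteq> {..<length xs'}"
      using r r' by (auto simp: short_bars_def)
    show "\<l>D v \<le> ereal a" if "v \<in> ?W" for v using that by simp
  next
    fix i assume "i \<in> short_bars r ys xs a L"
    then have i: "i < r" "D.lead xs a i \<in> \<Gamma>" "\<l>C (ys ! i) - \<l>D (xs ! i) \<le> L" by (auto simp: short_bars_def)
    let ?t = "nov_monom 1 (D.lead xs a i)"
    have t: "?t \<in> carrier K" using i by (intro nov_monom_closed)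
    have ix: "i < length xs" "i < length ys" using i r by auto
    have "\<l>D (?t \<odot>\<^bsub>D\<^esub> (xs ! i)) \<le> ereal a"
      using ix t by (subst D.level_smult_lead_le_iff[OF ob(2)]) (auto simp: nov_monom_def)
    moreover have y: "ys ! i \<in> carrier C" "ys ! i \<noteq> \<zero>\<^bsub>C\<^esub>" using C.orthogonal_basis_nth[OF ob(1)] ix by auto
    moreover have "A (?t \<odot>\<^bsub>C\<^esub> (ys ! i)) = ?t \<odot>\<^bsub>D\<^esub> (xs ! i)"
      using t y svd i by (simp add: svd_data_def)
    moreover have "\<l>C (?t \<odot>\<^bsub>C\<^esub> (ys ! i)) \<le> ereal a + L"
    proof -
      obtain s where s: "\<l>C (ys ! i) = ereal s" using C.level_real y by blast
      have "\<l>C (?t \<odot>\<^bsub>C\<^esub> (ys ! i)) = ereal (s - D.lead xs a i)"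
        using C.level_smult[OF t y(1)] by (simp add: s nov_val_monom)
      then show ?thesis
        using i(3) D.level_eq_lead[OF ob(2) ix(1), of a] s L by (cases L) auto
    qed
    ultimately show "D.lead xs a i \<in> \<Gamma> \<and> ?t \<odot>\<^bsub>D\<^esub> (xs ! i) \<in> ?W"
      using i t by (auto intro!: bexI[of _ "?t \<odot>\<^bsub>C\<^esub> (ys ! i)"])
  next
    fix b j assume b: "b \<in> {..<length xs'} \<rightarrow> carrier K" and "lcomb D b xs' \<in> ?W"
      and j: "j < length xs'" and nj: "j \<notin> short_bars r' ys' xs' a L"
    then obtain u where u: "u \<in> carrier C" "A u = lcomb D b xs'" "\<l>C u \<le> ereal a + L" by auto
    then obtain \<mu> where \<mu>: "\<mu> \<in> {..<length ys'} \<rightarrow> carrier K" "u = lcomb C \<mu> ys'"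
      using C.orthogonal_basis_cases[OF ob'(1)] by metis
    \<comment> \<open>Coordinates of the preimage from position \<open>r'\<close> on belong to the
      kernel and leave no trace in the image.\<close>
    let ?\<mu> = "\<lambda>i. if i < r' then \<mu> i else \<zero>\<^bsub>K\<^esub>"
    have \<mu>': "?\<mu> \<in> {..<length xs'} \<rightarrow> carrier K" using \<mu> r' by (auto simp: Pi_iff)
    have dr: "set (take r' xs') \<subseteq> carrier D" "set (drop r' xs') \<subseteq> carrier D"
      using xs' set_take_subset[of r' xs'] set_drop_subset[of r' xs'] by auto
    have "A u = lcomb D ?\<mu> xs'"
    proof -
      have "lcomb D ?\<mu> (take r' xs' @ drop r' xs') =
        lcomb D ?\<mu> (take r' xs') \<oplus>\<^bsub>D\<^esub> lcomb D (\<lambda>i. ?\<mu> (length (take r' xs') + i)) (drop r' xs')"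
        using \<mu>' r' by (intro D.lcomb_append dr) auto
      also have "lcomb D (\<lambda>i. ?\<mu> (length (take r' xs') + i)) (drop r' xs') = \<zero>\<^bsub>D\<^esub>"
        using r' by (intro D.lcomb_zero dr) auto
      also have "lcomb D ?\<mu> (take r' xs') = lcomb D \<mu> (take r' xs')"
        using \<mu> r' by (intro D.lcomb_cong dr) auto
      also have "\<dots> = A u" using svd_data_lcomb[OF svd' \<mu>(1)] \<mu>(2) by simp
      finally show ?thesis using u(1) by simp
    qed
    then have bj: "b j = ?\<mu> j" using D.lcomb_inject[OF ob'(2) b \<mu>' _ j] u by simp
    show "b j (D.lead xs' a j) = 0"
    proof (cases "j < r' \<and> D.lead xs' a j \<in> \<Gamma>")
      case False
      have "b j \<in> carrier K" using b j by auto
      show ?thesis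
      proof (cases "j < r'")
        case True
        with False have "D.lead xs' a j \<notin> \<Gamma>" by simp
        with \<open>b j \<in> carrier K\<close> show ?thesis unfolding carrier_novikov_iff by blast
      next
        case False
        then have "b j = \<zero>\<^bsub>K\<^esub>" using bj by simp
        then show ?thesis by (simp add: zero_novikov)
      qed
    next
      case True
      then have jr: "j < r'" "j < length ys'" and gt: "L < \<l>C (ys' ! j) - \<l>D (xs' ! j)"
        using nj r' by (auto simp: short_bars_def)
      have y: "ys' ! j \<in> carrier C" "ys' ! j \<noteq> \<zero>\<^bsub>C\<^esub>" using C.orthogonal_basis_nth[OF ob'(1) jr(2)] by auto
      obtain s where s: "\<l>C (ys' ! j) = ereal s" using C.level_real y by blast
      have \<mu>j: "\<mu> j \<in> carrier K" using \<mu> jr by auto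
      have "\<l>C (\<mu> j \<odot>\<^bsub>C\<^esub> (ys' ! j)) \<le> \<l>C u"
        using C.orthogonal_le[OF _ \<mu>(1) jr(2)] ob'(1) \<mu>(2) by (simp add: orthogonal_basis_def)
      also note u(3)
      finally have "ereal s - nov_val (\<mu> j) \<le> ereal a + L"
        using C.level_smult[OF \<mu>j y(1)] s by simp
      then have "ereal (D.lead xs' a j) < nov_val (\<mu> j)"
        using gt s D.level_eq_lead[OF ob'(2) j, of a] L by (cases L; cases "nov_val (\<mu> j)") auto
      then show ?thesis
        using nov_val_gt_iff[of "\<mu> j" "D.lead xs' a j"] \<mu>j bj jr by (auto simp: carrier_novikov_iff)
    qed
  qed
qed

end

text \<open>The multiplicity of \<open>(X, L)\<close> is the count with bound \<open>\<le> L\<close>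
  minus the count with bound \<open>< L\<close>. Since finitely many lengths occur, the strict count
  is the count with bound the largest length below \<open>L\<close>.\<close>

lemma mset_eq_of_card_le:
  fixes p q :: "nat \<Rightarrow> 'a \<times> 'b::linorder"
  assumes "\<And>X L. card {i. i < m \<and> fst (p i) = X \<and> snd (p i) \<le> L} = card {i. i < n \<and> fst (q i) = X \<and> snd (q i) \<le> L}"
  shows "mset (map p [0..<m]) = mset (map q [0..<n])"
proof (rule multiset_eqI)
  fix z :: "'a \<times> 'b"
  obtain X L where z: "z = (X, L)" by (cases z)
  \<comment> \<open>Lengths from both families are collected, so that one replacement bound serves
    both; if there is none below \<open>L\<close>, both strict counts are zero.\<close>
  define S where "S = {s \<in> (\<lambda>i. snd (p i)) ` {..<m} \<union> (\<lambda>i. snd (q i)) ` {..<n}. s < L}"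
  have S: "finite S" unfolding S_def by auto
  have less: "card {i. i < m \<and> fst (p i) = X \<and> snd (p i) < L} = card {i. i < n \<and> fst (q i) = X \<and> snd (q i) < L}"
  proof (cases "S = {}")
    case True
    then have "\<not> snd (p i) < L" if "i < m" for i using that by (auto simp: S_def)
    moreover have "\<not> snd (q i) < L" if "i < n" for i using that True by (auto simp: S_def)
    ultimately have "{i. i < m \<and> fst (p i) = X \<and> snd (p i) < L} = {}" "{i. i < n \<and> fst (q i) = X \<and> snd (q i) < L} = {}"
      by auto
    then show ?thesis by (simp only: card.empty)
  next
    case False
    have M: "Max S < L" using Max_in[OF S False] by (simp add: S_def)
    have "snd (p i) < L \<longleftrightarrow> snd (p i) \<le> Max S" if "i < m" for i
      using that M Max_ge[OF S, of "snd (p i)"] by (auto simp: S_def)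
    moreover have "snd (q i) < L \<longleftrightarrow> snd (q i) \<le> Max S" if "i < n" for i
      using that M Max_ge[OF S, of "snd (q i)"] by (auto simp: S_def)
    ultimately have "{i. i < m \<and> fst (p i) = X \<and> snd (p i) < L} = {i. i < m \<and> fst (p i) = X \<and> snd (p i) \<le> Max S}"
      "{i. i < n \<and> fst (q i) = X \<and> snd (q i) < L} = {i. i < n \<and> fst (q i) = X \<and> snd (q i) \<le> Max S}" by auto
    then show ?thesis using assms by simp
  qed
  have count: "count (mset (map f [0..<l])) z =
      card {i. i < l \<and> fst (f i) = X \<and> snd (f i) \<le> L} - card {i. i < l \<and> fst (f i) = X \<and> snd (f i) < L}"
    for f :: "nat \<Rightarrow> 'a \<times> 'b" and l
  proof -
    have "count (mset (map f [0..<l])) z = card {i. i < l \<and> f i = z}"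
      unfolding count_mset count_list_eq_length_filter length_filter_conv_card
      by (intro arg_cong[of _ _ card]) auto
    also have "{i. i < l \<and> f i = z} =
        {i. i < l \<and> fst (f i) = X \<and> snd (f i) \<le> L} - {i. i < l \<and> fst (f i) = X \<and> snd (f i) < L}"
      by (auto simp: z prod_eq_iff)
    also have "card \<dots> = card {i. i < l \<and> fst (f i) = X \<and> snd (f i) \<le> L} - card {i. i < l \<and> fst (f i) = X \<and> snd (f i) < L}"
      by (rule card_Diff_subset) auto
    finally show ?thesis .
  qed
  show "count (mset (map p [0..<m])) z = count (mset (map q [0..<n])) z"
    unfolding count using assms less by simp
qed

lemma coset_real_group: "\<Gamma> #>\<^bsub>real_group\<^esub> x = {h + x | h. h \<in> \<Gamma>}"
  by (auto simp: r_coset_def)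

lemma coset_real_group_eq_iff:
  assumes \<Gamma>: "subgroup \<Gamma> real_group"
  shows "\<Gamma> #>\<^bsub>real_group\<^esub> x = \<Gamma> #>\<^bsub>real_group\<^esub> y \<longleftrightarrow> x - y \<in> \<Gamma>"
proof
  assume "\<Gamma> #>\<^bsub>real_group\<^esub> x = \<Gamma> #>\<^bsub>real_group\<^esub> y"
  moreover have "x \<in> \<Gamma> #>\<^bsub>real_group\<^esub> x"
    using subgroup_real_group_zero[OF \<Gamma>] by (auto simp: coset_real_group intro!: exI[of _ 0])
  ultimately show "x - y \<in> \<Gamma>" by (auto simp: coset_real_group)
next
  assume xy: "x - y \<in> \<Gamma>"
  show "\<Gamma> #>\<^bsub>real_group\<^esub> x = \<Gamma> #>\<^bsub>real_group\<^esub> y"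
    unfolding coset_real_group
  proof (intro Set.set_eqI iffI; elim CollectE exE conjE)
    fix z h assume h: "z = h + x" "h \<in> \<Gamma>"
    then show "z \<in> {h + y | h. h \<in> \<Gamma>}"
      using subgroup_real_group_add[OF \<Gamma> h(2) xy] by (intro CollectI exI[of _ "h + (x - y)"]) auto
  next
    fix z h assume h: "z = h + y" "h \<in> \<Gamma>"
    then show "z \<in> {h + x | h. h \<in> \<Gamma>}"
      using subgroup_real_group_diff[OF \<Gamma> h(2) xy] by (intro CollectI exI[of _ "h - (x - y)"]) auto
  qed
qed

context nonarch_linear_map
begin

text \<open>An entry of \<open>svd_barcode\<close>, stated for a linear map alone so that uniqueness
  can be proved without reference to a complex.\<close>

definition bar :: "nat \<Rightarrow> 'c list \<Rightarrow> 'd list \<Rightarrow> nat \<Rightarrow> real set \<times> ereal" where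
  "bar r ys xs i = (\<Gamma> #>\<^bsub>real_group\<^esub> real_of_ereal (\<l>D (xs ! i)),
    if i < r then \<l>C (ys ! i) - \<l>D (xs ! i) else \<infinity>)"

theorem barcode_unique:
  assumes \<Gamma>: "subgroup \<Gamma> real_group" and svd: "svd_data r ys xs" and svd': "svd_data r' ys' xs'"
  shows "mset (map (bar r ys xs) [0..<length xs]) = mset (map (bar r' ys' xs') [0..<length xs'])"
proof (rule mset_eq_of_card_le)
  fix X L
  have r: "r \<le> length xs" and ob: "orthogonal_basis \<Gamma> D \<l>D xs" using svd by (auto simp: svd_data_def)
  have r': "r' \<le> length xs'" and ob': "orthogonal_basis \<Gamma> D \<l>D xs'" using svd' by (auto simp: svd_data_def)
  show "card {i. i < length xs \<and> fst (bar r ys xs i) = X \<and> snd (bar r ys xs i) \<le> L} =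
    card {i. i < length xs' \<and> fst (bar r' ys' xs' i) = X \<and> snd (bar r' ys' xs' i) \<le> L}"
  proof (cases "\<exists>a. X = \<Gamma> #>\<^bsub>real_group\<^esub> a")
    case True
    then obtain a where a: "X = \<Gamma> #>\<^bsub>real_group\<^esub> a" ..
    have fst: "fst (bar r ys xs i) = X \<longleftrightarrow> D.lead xs a i \<in> \<Gamma>" for r ys xs i
      by (simp add: bar_def a coset_real_group_eq_iff[OF \<Gamma>] D.lead_def)
    show ?thesis
    \<comment> \<open>Infinite bars appear only in the count for the bound
      \<open>\<infinity>\<close>, which takes all bars over the coset; every other bound sees finite
      bars alone.\<close>
    proof (cases "L = \<infinity>")
      case True
      then show ?thesis
        using D.card_lead_le[OF \<Gamma> ob ob', of a] D.card_lead_le[OF \<Gamma> ob' ob, of a] by (simp add: fst)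
    next
      case False
      have eq: "{i. i < length xs \<and> fst (bar r ys xs i) = X \<and> snd (bar r ys xs i) \<le> L} = short_bars r ys xs a L"
        if "r \<le> length xs" for r ys xs
        using that False unfolding fst short_bars_def by (auto simp: bar_def split: if_splits)
      show ?thesis
        unfolding eq[OF r] eq[OF r']
        using card_short_bars_le[OF \<Gamma> svd svd' False] card_short_bars_le[OF \<Gamma> svd' svd False]
        by (rule order.antisym)
    qed
  next
    case False
    then have "fst (bar r ys xs i) \<noteq> X" for r ys xs i by (auto simp: bar_def)
    then show ?thesis by simp
  qed
qed

end

section \<open>Extension of the filtration\<close>

context scalar_extension
begin

lemma tens_zero_left: "a \<in> carrier S \<Longrightarrow> tens \<zero>\<^bsub>M\<^esub> a = \<zero>\<^bsub>E\<^esub>"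
proof -
  interpret E: abelian_group E by (rule abelian_group_E)
  assume a: "a \<in> carrier S"
  then have "tens \<zero>\<^bsub>M\<^esub> a \<oplus>\<^bsub>E\<^esub> tens \<zero>\<^bsub>M\<^esub> a = tens \<zero>\<^bsub>M\<^esub> a"
    using tens_add_left[of "\<zero>\<^bsub>M\<^esub>" "\<zero>\<^bsub>M\<^esub>" a] by simp
  then show ?thesis using a by (simp add: E.add.l_cancel_one)
qed

abbreviation "emb x \<equiv> tens x \<one>\<^bsub>S\<^esub>"

lemma tens_lcomb:
  assumes "set ws \<subseteq> carrier M" "b \<in> {..<length ws} \<rightarrow> carrier R" and a: "a \<in> carrier S"
  shows "tens (lcomb M b ws) a = lcomb E (\<lambda>i. b i \<otimes>\<^bsub>S\<^esub> a) (map emb ws)"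
  using assms(1,2)
proof (induction ws rule: rev_induct)
  interpret E: module S E by (rule module_E)
  case Nil
  then show ?case using a by (simp add: tens_zero_left E.lcomb_Nil)
next
  interpret E: module S E by (rule module_E)
  case (snoc w ws)
  have w: "w \<in> carrier M" "set ws \<subseteq> carrier M" and bn: "b (length ws) \<in> carrier R"
    and b: "b \<in> {..<length ws} \<rightarrow> carrier R" using snoc.prems by (auto simp: Pi_lessThan_Suc)
  have bS: "b i \<in> carrier S" if "i < Suc (length ws)" for i using snoc.prems that carrier_subset by auto
  have "tens (lcomb M b (ws @ [w])) a = tens (lcomb M b ws \<oplus>\<^bsub>M\<^esub> b (length ws) \<odot>\<^bsub>M\<^esub> w) a"
    using snoc.prems w by (subst lcomb_snoc) auto
  also have "\<dots> = tens (lcomb M b ws) a \<oplus>\<^bsub>E\<^esub> tens w (b (length ws) \<otimes>\<^bsub>S\<^esub> a)"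
    using w bn b a lcomb_closed[OF w(2) b] by (simp add: tens_add_left tens_smult_left)
  also have "\<dots> = lcomb E (\<lambda>i. b i \<otimes>\<^bsub>S\<^esub> a) (map emb ws) \<oplus>\<^bsub>E\<^esub> (b (length ws) \<otimes>\<^bsub>S\<^esub> a) \<odot>\<^bsub>E\<^esub> emb w"
    using snoc.IH[OF w(2) b] w a bS[of "length ws"] by simp
  also have "\<dots> = lcomb E (\<lambda>i. b i \<otimes>\<^bsub>S\<^esub> a) (map emb ws @ [emb w])"
    using w a bS by (subst E.lcomb_snoc) auto
  finally show ?case by simp
qed

lemma emb_lcomb:
  assumes "set ws \<subseteq> carrier M" "b \<in> {..<length ws} \<rightarrow> carrier R"
  shows "emb (lcomb M b ws) = lcomb E b (map emb ws)"
proof -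
  interpret E: module S E by (rule module_E)
  have "emb (lcomb M b ws) = lcomb E (\<lambda>i. b i \<otimes>\<^bsub>S\<^esub> \<one>\<^bsub>S\<^esub>) (map emb ws)"
    using assms by (rule tens_lcomb) simp
  also have "\<dots> = lcomb E b (map emb ws)"
    by (rule E.lcomb_cong) (use assms carrier_subset in \<open>auto simp: Pi_iff subset_iff\<close>)
  finally show ?thesis .
qed

text \<open>An elementary tensor expands by expanding its first entry, and sums of expansions are
  expansions.\<close>

lemma emb_generates:
  assumes ws: "set ws \<subseteq> carrier M" and gen: "span (set ws) = carrier M" and X: "X \<in> carrier E"
  obtains a where "a \<in> {..<length ws} \<rightarrow> carrier S" "X = lcomb E a (map emb ws)"
proof -
  interpret E: module S E by (rule module_E)
  have ws': "set (map emb ws) \<subseteq> carrier E" using ws by auto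
  have "\<exists>a. a \<in> {..<length ws} \<rightarrow> carrier S \<and> X = lcomb E a (map emb ws)"
    using X
  proof (induction X rule: tensor_induct)
    case zero
    have "lcomb E (\<lambda>_. \<zero>\<^bsub>S\<^esub>) (map emb ws) = \<zero>\<^bsub>E\<^esub>" by (rule E.lcomb_zero[OF ws']) simp
    then show ?case by (intro exI[of _ "\<lambda>_. \<zero>\<^bsub>S\<^esub>"]) auto
  next
    case (tens x a)
    obtain b where b: "b \<in> {..<length ws} \<rightarrow> carrier R" "x = lcomb M b ws"
      using span_set_cases[OF ws, of x] tens gen by metis
    then have "tens x a = lcomb E (\<lambda>i. b i \<otimes>\<^bsub>S\<^esub> a) (map emb ws)" using tens_lcomb[OF ws] tens by simp
    moreover have "(\<lambda>i. b i \<otimes>\<^bsub>S\<^esub> a) \<in> {..<length ws} \<rightarrow> carrier S"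
      using b tens carrier_subset by (auto simp: Pi_iff)
    ultimately show ?case by blast
  next
    case (add X Y)
    then obtain a b where ab: "a \<in> {..<length ws} \<rightarrow> carrier S" "X = lcomb E a (map emb ws)"
      "b \<in> {..<length ws} \<rightarrow> carrier S" "Y = lcomb E b (map emb ws)" by blast
    then have "X \<oplus>\<^bsub>E\<^esub> Y = lcomb E (\<lambda>i. a i \<oplus>\<^bsub>S\<^esub> b i) (map emb ws)"
      using E.lcomb_add[OF ws', of a b] by simp
    moreover have "(\<lambda>i. a i \<oplus>\<^bsub>S\<^esub> b i) \<in> {..<length ws} \<rightarrow> carrier S" using ab by auto
    ultimately show ?case by blast
  qed
  then show thesis using that by blast
qed

text \<open>The presentation by generators and relations does not show that a combination of the
  vectors \<open>w \<otimes> 1\<close> is nonzero. A coordinate function of \<open>M\<close> is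
  linear, and its extension to the tensor product returns the corresponding coefficient.\<close>

lemma emb_coordinates:
  assumes ws: "set ws \<subseteq> carrier M" and gen: "span (set ws) = carrier M"
    and inject: "\<And>b c i. b \<in> {..<length ws} \<rightarrow> carrier R \<Longrightarrow> c \<in> {..<length ws} \<rightarrow> carrier R \<Longrightarrow>
      lcomb M b ws = lcomb M c ws \<Longrightarrow> i < length ws \<Longrightarrow> b i = c i"
    and compat: "\<And>x y. x \<in> carrier R \<Longrightarrow> y \<in> carrier R \<Longrightarrow> x \<oplus>\<^bsub>R\<^esub> y = x \<oplus>\<^bsub>S\<^esub> y"
      "\<And>x y. x \<in> carrier R \<Longrightarrow> y \<in> carrier R \<Longrightarrow> x \<otimes>\<^bsub>R\<^esub> y = x \<otimes>\<^bsub>S\<^esub> y"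
      "\<zero>\<^bsub>R\<^esub> = \<zero>\<^bsub>S\<^esub>" "\<one>\<^bsub>R\<^esub> = \<one>\<^bsub>S\<^esub>"
    and i: "i < length ws"
  obtains \<psi> where "\<And>a. a \<in> {..<length ws} \<rightarrow> carrier S \<Longrightarrow> \<psi> (lcomb E a (map emb ws)) = a i"
proof -
  interpret E: module S E by (rule module_E)
  define coord where "coord x = (SOME b. b \<in> {..<length ws} \<rightarrow> carrier R \<and> x = lcomb M b ws)" for x
  have coord: "coord x \<in> {..<length ws} \<rightarrow> carrier R \<and> x = lcomb M (coord x) ws" if "x \<in> carrier M" for x
  proof -
    have "x \<in> span (set ws)" using gen that by simp
    then obtain b where "b \<in> {..<length ws} \<rightarrow> carrier R" "x = lcomb M b ws" by (rule span_set_cases[OF ws])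
    then show ?thesis unfolding coord_def by (intro someI_ex[of "\<lambda>b. b \<in> {..<length ws} \<rightarrow> carrier R \<and> x = lcomb M b ws"]) blast
  qed
  have coord_eq: "coord (lcomb M b ws) i = b i" if b: "b \<in> {..<length ws} \<rightarrow> carrier R" for b
    using coord[OF lcomb_closed[OF ws b]] by (intro inject[OF _ b _ i]) auto
  define \<phi> where "\<phi> x = coord x i" for x
  have \<phi>R: "\<phi> x \<in> carrier R" if "x \<in> carrier M" for x using coord[OF that] i by (auto simp: \<phi>_def)
  have \<phi>: "\<phi> \<in> carrier M \<rightarrow> carrier S" using \<phi>R carrier_subset by auto
  have \<phi>_add: "\<phi> (x \<oplus>\<^bsub>M\<^esub> y) = \<phi> x \<oplus>\<^bsub>S\<^esub> \<phi> y" if "x \<in> carrier M" "y \<in> carrier M" for x y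
  proof -
    have "x \<oplus>\<^bsub>M\<^esub> y = lcomb M (\<lambda>i. coord x i \<oplus>\<^bsub>R\<^esub> coord y i) ws"
      using coord[OF that(1)] coord[OF that(2)] lcomb_add[OF ws, of "coord x" "coord y"] by simp
    moreover have "(\<lambda>i. coord x i \<oplus>\<^bsub>R\<^esub> coord y i) \<in> {..<length ws} \<rightarrow> carrier R"
      using coord that by auto
    ultimately have "\<phi> (x \<oplus>\<^bsub>M\<^esub> y) = \<phi> x \<oplus>\<^bsub>R\<^esub> \<phi> y" using coord_eq by (simp add: \<phi>_def)
    then show ?thesis using compat(1) \<phi>R that by simp
  qed
  have \<phi>_smult: "\<phi> (c \<odot>\<^bsub>M\<^esub> x) = c \<otimes>\<^bsub>S\<^esub> \<phi> x" if "c \<in> carrier R" "x \<in> carrier M" for c x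
  proof -
    have "c \<odot>\<^bsub>M\<^esub> x = lcomb M (\<lambda>i. c \<otimes>\<^bsub>R\<^esub> coord x i) ws"
      using coord[OF that(2)] lcomb_smult[OF ws _ that(1), of "coord x"] by simp
    moreover have "(\<lambda>i. c \<otimes>\<^bsub>R\<^esub> coord x i) \<in> {..<length ws} \<rightarrow> carrier R" using coord that by auto
    ultimately have "\<phi> (c \<odot>\<^bsub>M\<^esub> x) = c \<otimes>\<^bsub>R\<^esub> \<phi> x" using coord_eq by (simp add: \<phi>_def)
    then show ?thesis using compat(2) \<phi>R that by simp
  qed
  have \<phi>_nth: "\<phi> (ws ! j) = (if j = i then \<one>\<^bsub>S\<^esub> else \<zero>\<^bsub>S\<^esub>)" if j: "j < length ws" for j
  proof -
    have "ws ! j = lcomb M (\<lambda>k. if k = j then \<one>\<^bsub>R\<^esub> else \<zero>\<^bsub>R\<^esub>) ws"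
      using lcomb_unit[OF ws j, of "\<one>\<^bsub>R\<^esub>"] nth_in_carrier[OF ws j] by simp
    moreover have "(\<lambda>k. if k = j then \<one>\<^bsub>R\<^esub> else \<zero>\<^bsub>R\<^esub>) \<in> {..<length ws} \<rightarrow> carrier R" by auto
    ultimately have "\<phi> (ws ! j) = (if i = j then \<one>\<^bsub>R\<^esub> else \<zero>\<^bsub>R\<^esub>)"
      unfolding \<phi>_def using coord_eq[of "\<lambda>k. if k = j then \<one>\<^bsub>R\<^esub> else \<zero>\<^bsub>R\<^esub>"] by simp
    then show ?thesis using compat(3,4) by auto
  qed
  obtain \<psi> where \<psi>: "\<psi> \<in> carrier E \<rightarrow> carrier S"
    "\<And>X Y. X \<in> carrier E \<Longrightarrow> Y \<in> carrier E \<Longrightarrow> \<psi> (X \<oplus>\<^bsub>E\<^esub> Y) = \<psi> X \<oplus>\<^bsub>S\<^esub> \<psi> Y"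
    "\<And>s X. s \<in> carrier S \<Longrightarrow> X \<in> carrier E \<Longrightarrow> \<psi> (s \<odot>\<^bsub>E\<^esub> X) = s \<otimes>\<^bsub>S\<^esub> \<psi> X"
    "\<And>x a. x \<in> carrier M \<Longrightarrow> a \<in> carrier S \<Longrightarrow> \<psi> (tens x a) = \<phi> x \<otimes>\<^bsub>S\<^esub> a"
    using extend_functional[OF \<phi> \<phi>_add \<phi>_smult] by blast
  have \<psi>0: "\<psi> \<zero>\<^bsub>E\<^esub> = \<zero>\<^bsub>S\<^esub>"
    using \<psi>(3)[of "\<zero>\<^bsub>S\<^esub>" "\<zero>\<^bsub>E\<^esub>"] \<psi>(1) by (auto simp: Pi_iff)
  have \<psi>_lcomb: "\<psi> (lcomb E a Ws) = (\<Oplus>\<^bsub>S\<^esub>j\<in>{..<length Ws}. a j \<otimes>\<^bsub>S\<^esub> \<psi> (Ws ! j))"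
    if "set Ws \<subseteq> carrier E" "a \<in> {..<length Ws} \<rightarrow> carrier S" for a Ws
    using that
  proof (induction Ws rule: rev_induct)
    case Nil
    then show ?case by (simp add: \<psi>0 E.lcomb_Nil)
  next
    case (snoc W Ws)
    have W: "W \<in> carrier E" "set Ws \<subseteq> carrier E" and a: "a \<in> {..<length Ws} \<rightarrow> carrier S" "a (length Ws) \<in> carrier S"
      using snoc.prems by (auto simp: Pi_lessThan_Suc)
    have \<psi>W: "\<psi> (Ws ! j) \<in> carrier S" if "j < length Ws" for j
      using E.nth_in_carrier[OF W(2) that] \<psi>(1) by auto
    have \<psi>w: "\<psi> W \<in> carrier S" using W \<psi>(1) by auto
    have "\<psi> (lcomb E a (Ws @ [W])) = \<psi> (lcomb E a Ws) \<oplus>\<^bsub>S\<^esub> a (length Ws) \<otimes>\<^bsub>S\<^esub> \<psi> W"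
      using snoc.prems W a E.lcomb_closed[OF W(2) a(1)] by (subst E.lcomb_snoc) (auto simp: \<psi>(2,3))
    also have "\<psi> (lcomb E a Ws) = (\<Oplus>\<^bsub>S\<^esub>j\<in>{..<length Ws}. a j \<otimes>\<^bsub>S\<^esub> \<psi> (Ws ! j))"
      by (rule snoc.IH[OF W(2) a(1)])
    also have "\<dots> = (\<Oplus>\<^bsub>S\<^esub>j\<in>{..<length Ws}. a j \<otimes>\<^bsub>S\<^esub> \<psi> ((Ws @ [W]) ! j))"
      using a \<psi>W by (intro S.finsum_cong') (auto simp: nth_append Pi_iff)
    also have "\<dots> \<oplus>\<^bsub>S\<^esub> a (length Ws) \<otimes>\<^bsub>S\<^esub> \<psi> W =
        (\<Oplus>\<^bsub>S\<^esub>j\<in>insert (length Ws) {..<length Ws}. a j \<otimes>\<^bsub>S\<^esub> \<psi> ((Ws @ [W]) ! j))"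
      using a \<psi>W \<psi>w by (subst S.finsum_insert) (auto simp: nth_append Pi_iff intro!: S.a_comm S.finsum_closed)
    finally show ?case by (simp add: lessThan_Suc)
  qed
  have "\<psi> (lcomb E a (map emb ws)) = a i" if a: "a \<in> {..<length ws} \<rightarrow> carrier S" for a
  proof -
    have "\<psi> (lcomb E a (map emb ws)) = (\<Oplus>\<^bsub>S\<^esub>j\<in>{..<length ws}. a j \<otimes>\<^bsub>S\<^esub> \<psi> (map emb ws ! j))"
      using \<psi>_lcomb[of "map emb ws" a] ws a by auto
    also have "\<dots> = (\<Oplus>\<^bsub>S\<^esub>j\<in>{..<length ws}. if i = j then a j else \<zero>\<^bsub>S\<^esub>)"
      using a nth_in_carrier[OF ws] by (intro S.finsum_cong') (auto simp: \<psi>(4) \<phi>_nth Pi_iff)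
    also have "\<dots> = a i" using a i by (intro S.add.finprod_singleton) auto
    finally show ?thesis .
  qed
  then show thesis by (rule that)
qed

end

text \<open>For transferring the structure to \<open>extend_filt\<close>, which is compared with
  \<open>ext_level\<close> on the carrier.\<close>

lemma nonarch_normed_space_cong:
  assumes "nonarch_normed_space \<Gamma> V \<l>" "\<And>x. x \<in> carrier V \<Longrightarrow> \<l>' x = \<l> x"
  shows "nonarch_normed_space \<Gamma> V \<l>'"
proof -
  interpret nonarch_normed_space \<Gamma> V \<l> by fact
  show ?thesis
    by unfold_locales (use assms(2) level_not_PInfty level_eq_MInfty_iff level_smult level_add in auto)
qed

lemma orthogonal_basis_cong:
  assumes "nonarch_normed_space \<Gamma> V \<l>" "\<And>x. x \<in> carrier V \<Longrightarrow> \<l>' x = \<l> x" "orthogonal_basis \<Gamma> V \<l> ws"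
  shows "orthogonal_basis \<Gamma> V \<l>' ws"
proof -
  interpret nonarch_normed_space \<Gamma> V \<l> by fact
  have ws: "set ws \<subseteq> carrier V" using assms(3) by (rule orthogonal_basis_carrier)
  have "\<l>' (lcomb V a ws) = (SUP i\<in>{..<length ws}. \<l>' (a i \<odot>\<^bsub>V\<^esub> (ws ! i)))"
    if a: "a \<in> {..<length ws} \<rightarrow> carrier (novikov \<Gamma>)" for a
  proof -
    have "(SUP i\<in>{..<length ws}. \<l>' (a i \<odot>\<^bsub>V\<^esub> (ws ! i))) = (SUP i\<in>{..<length ws}. \<l> (a i \<odot>\<^bsub>V\<^esub> (ws ! i)))"
      using a nth_in_carrier[OF ws] by (intro SUP_cong assms(2) smult_closed) auto
    moreover have "\<l>' (lcomb V a ws) = \<l> (lcomb V a ws)" using ws a by (intro assms(2) lcomb_closed)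
    moreover have "\<l> (lcomb V a ws) = (SUP i\<in>{..<length ws}. \<l> (a i \<odot>\<^bsub>V\<^esub> (ws ! i)))"
      using assms(3) a by (simp add: orthogonal_basis_def orthogonal_lcomb)
    ultimately show ?thesis by simp
  qed
  then show ?thesis using assms(3) by (simp add: orthogonal_basis_def orthogonal_lcomb)
qed

section \<open>The extended level function and its independence of the basis\<close>

locale nonarch_extension = C: nonarch_normed_space \<Gamma> C \<l>
  for \<Gamma> :: "real set" and C :: "(real \<Rightarrow> 'k::field, 'c) module" and \<l> :: "'c \<Rightarrow> ereal" +
  fixes \<Gamma>' :: "real set"
  assumes subgroup_\<Gamma>': "subgroup \<Gamma>' real_group" and \<Gamma>_le: "\<Gamma> \<subseteq> \<Gamma>'"
begin

abbreviation K :: "(real \<Rightarrow> 'k) ring" where "K \<equiv> novikov \<Gamma>"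
abbreviation S :: "(real \<Rightarrow> 'k) ring" where "S \<equiv> novikov \<Gamma>'"

sublocale X: scalar_extension K C S
proof (intro scalar_extension.intro scalar_extension_axioms.intro)
  show "module K C" by unfold_locales
  show "cring S" using subgroup_\<Gamma>' by (rule cring_novikov)
  show "carrier K \<subseteq> carrier S" using \<Gamma>_le unfolding carrier_novikov_iff subset_iff by blast
qed

sublocale E: vectorspace S X.E
  by (intro vectorspace.intro X.module_E field_novikov subgroup_\<Gamma>')

text \<open>The body of \<open>extend_filt\<close> with the chosen basis as a parameter, so that
  independence of the choice can be expressed.\<close>

definition ext_level :: "'c list \<Rightarrow> ('c \<times> (real \<Rightarrow> 'k) \<Rightarrow>\<^sub>0 int) set \<Rightarrow> ereal" where
  "ext_level ws v = (THE s. \<exists>a \<in> {..<length ws} \<rightarrow> carrier S. v = lcomb X.E a (map X.emb ws) \<and>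
     s = (SUP i\<in>{..<length ws}. \<l> (ws ! i) - nov_val (a i)))"

lemma extend_filt_eq:
  assumes "orthogonal_basis \<Gamma> C \<l> us"
  shows "extend_filt \<Gamma> \<Gamma>' C \<l> = ext_level (SOME ws. orthogonal_basis \<Gamma> C \<l> ws)"
proof
  fix v
  define ws where "ws = (SOME ws. orthogonal_basis \<Gamma> C \<l> ws)"
  have "orthogonal_basis \<Gamma> C \<l> ws" unfolding ws_def using assms by (rule someI)
  then have ws: "set ws \<subseteq> carrier C" by (rule C.orthogonal_basis_carrier)
  have "(\<Oplus>\<^bsub>X.E\<^esub>i\<in>{..<length ws}. a i \<odot>\<^bsub>X.E\<^esub> tensor_class K S C (frag_of (ws ! i, \<one>\<^bsub>S\<^esub>))) =
      lcomb X.E a (map X.emb ws)" if "a \<in> {..<length ws} \<rightarrow> carrier S" for a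
    unfolding lcomb_def using that C.nth_in_carrier[OF ws]
    by (intro E.M.finsum_cong') (auto simp: X.tens_def[symmetric] Pi_iff simp del: X.tens_smult)
  then have "(\<exists>a\<in>{..<length ws} \<rightarrow> carrier S.
        v = (\<Oplus>\<^bsub>X.E\<^esub>i\<in>{..<length ws}. a i \<odot>\<^bsub>X.E\<^esub> tensor_class K S C (frag_of (ws ! i, \<one>\<^bsub>S\<^esub>))) \<and>
        s = (SUP i\<in>{..<length ws}. \<l> (ws ! i) - nov_val (a i))) \<longleftrightarrow>
      (\<exists>a\<in>{..<length ws} \<rightarrow> carrier S. v = lcomb X.E a (map X.emb ws) \<and>
        s = (SUP i\<in>{..<length ws}. \<l> (ws ! i) - nov_val (a i)))" for s
    by (intro bex_cong refl) simp
  then show "extend_filt \<Gamma> \<Gamma>' C \<l> v = ext_level (SOME ws. orthogonal_basis \<Gamma> C \<l> ws) v"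
    unfolding extend_filt_def ext_level_def Let_def ws_def[symmetric] by (intro arg_cong[of _ _ The] ext)
qed

context
  fixes ws
  assumes ob: "orthogonal_basis \<Gamma> C \<l> ws"
begin

lemma basis_subset: "set ws \<subseteq> carrier C"
  using ob by (rule C.orthogonal_basis_carrier)

lemma emb_basis_subset: "set (map X.emb ws) \<subseteq> carrier X.E"
  using basis_subset by auto

lemma emb_cases:
  assumes "X \<in> carrier X.E"
  obtains a where "a \<in> {..<length ws} \<rightarrow> carrier S" "X = lcomb X.E a (map X.emb ws)"
  using X.emb_generates[OF basis_subset _ assms] ob by (auto simp: C.orthogonal_basis_iff)

lemma emb_inject:
  assumes "a \<in> {..<length ws} \<rightarrow> carrier S" "b \<in> {..<length ws} \<rightarrow> carrier S"
    and "lcomb X.E a (map X.emb ws) = lcomb X.E b (map X.emb ws)" and i: "i < length ws"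
  shows "a i = b i"
proof -
  have gen: "C.span (set ws) = carrier C" using ob by (simp add: C.orthogonal_basis_iff)
  show ?thesis
  proof (rule X.emb_coordinates[OF basis_subset gen])
    show "b i = c i" if "b \<in> {..<length ws} \<rightarrow> carrier K" "c \<in> {..<length ws} \<rightarrow> carrier K"
      "lcomb C b ws = lcomb C c ws" "i < length ws" for b c i
      using C.lcomb_inject[OF ob that] .
    show "i < length ws" by fact
    fix \<psi> assume "\<And>a. a \<in> {..<length ws} \<rightarrow> carrier S \<Longrightarrow> \<psi> (lcomb X.E a (map X.emb ws)) = a i"
    from this[OF assms(1)] this[OF assms(2)] show "a i = b i" using assms(3) by simp
  qed (simp_all add: add_novikov mult_novikov zero_novikov one_novikov)
qed

lemma ext_level_lcomb:
  assumes a: "a \<in> {..<length ws} \<rightarrow> carrier S"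
  shows "ext_level ws (lcomb X.E a (map X.emb ws)) = (SUP i\<in>{..<length ws}. \<l> (ws ! i) - nov_val (a i))"
  unfolding ext_level_def
proof (rule the_equality)
  fix s assume "\<exists>b\<in>{..<length ws} \<rightarrow> carrier S. lcomb X.E a (map X.emb ws) = lcomb X.E b (map X.emb ws) \<and>
    s = (SUP i\<in>{..<length ws}. \<l> (ws ! i) - nov_val (b i))"
  then obtain b where b: "b \<in> {..<length ws} \<rightarrow> carrier S"
    "lcomb X.E a (map X.emb ws) = lcomb X.E b (map X.emb ws)"
    "s = (SUP i\<in>{..<length ws}. \<l> (ws ! i) - nov_val (b i))" by blast
  then show "s = (SUP i\<in>{..<length ws}. \<l> (ws ! i) - nov_val (a i))"
    using emb_inject[OF a b(1,2)] by (simp cong: SUP_cong_simp)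
qed (use a in blast)

text \<open>An expansion over the small field is also one over the large field, and the valuation of
  its coefficients does not refer to the group of exponents.\<close>

lemma ext_level_emb:
  assumes x: "x \<in> carrier C"
  shows "ext_level ws (X.emb x) = \<l> x"
proof -
  obtain b where b: "b \<in> {..<length ws} \<rightarrow> carrier K" "x = lcomb C b ws"
    using C.orthogonal_basis_cases[OF ob x] .
  have bS: "b \<in> {..<length ws} \<rightarrow> carrier S" using b X.carrier_subset by auto
  have "ext_level ws (X.emb x) = (SUP i\<in>{..<length ws}. \<l> (ws ! i) - nov_val (b i))"
    unfolding b(2) X.emb_lcomb[OF basis_subset b(1)] using bS by (rule ext_level_lcomb)
  also have "\<dots> = (SUP i\<in>{..<length ws}. \<l> (b i \<odot>\<^bsub>C\<^esub> (ws ! i)))"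
    using b C.nth_in_carrier[OF basis_subset] by (intro SUP_cong refl C.level_smult[symmetric]) auto
  also have "\<dots> = \<l> x" using ob b by (simp add: orthogonal_basis_def orthogonal_lcomb)
  finally show ?thesis .
qed

lemma nonarch_normed_space_ext_level: "nonarch_normed_space \<Gamma>' X.E (ext_level ws)"
proof (intro nonarch_normed_space.intro nonarch_normed_space_axioms.intro)
  show "vectorspace S X.E" by unfold_locales
  have real: "\<exists>r. \<l> (ws ! i) = ereal r" if "i < length ws" for i
    using C.level_real[OF C.orthogonal_basis_nth[OF ob that]] by blast
  show fin: "ext_level ws X \<noteq> \<infinity>" if X: "X \<in> carrier X.E" for X
  proof -
    obtain a where a: "a \<in> {..<length ws} \<rightarrow> carrier S" "X = lcomb X.E a (map X.emb ws)" using emb_cases[OF X] .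
    let ?S = "(\<lambda>i. \<l> (ws ! i) - nov_val (a i)) ` {..<length ws}"
    have "\<infinity> \<notin> ?S"
    proof
      assume "\<infinity> \<in> ?S"
      then obtain i where "i < length ws" "\<l> (ws ! i) - nov_val (a i) = \<infinity>" by auto
      moreover from this obtain r where "\<l> (ws ! i) = ereal r" using real by blast
      ultimately show False by (cases "nov_val (a i)") auto
    qed
    \<comment> \<open>A supremum over a nonempty finite set is attained, hence not infinite; the
      empty one is \<open>-\<infinity>\<close>.\<close>
    moreover have "Sup ?S \<in> ?S" if "length ws \<noteq> 0"
    proof -
      have "?S \<noteq> {}" using that by auto
      then show ?thesis using Max_in[of ?S] by (simp add: Max_Sup)
    qed
    ultimately show ?thesis
      unfolding a(2) ext_level_lcomb[OF a(1)] by (cases "length ws = 0") (auto simp: bot_ereal_def)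
  qed
  show "ext_level ws X = -\<infinity> \<longleftrightarrow> X = \<zero>\<^bsub>X.E\<^esub>" if X: "X \<in> carrier X.E" for X
  proof -
    obtain a where a: "a \<in> {..<length ws} \<rightarrow> carrier S" "X = lcomb X.E a (map X.emb ws)" using emb_cases[OF X] .
    have "ext_level ws X = -\<infinity> \<longleftrightarrow> (\<forall>i<length ws. \<l> (ws ! i) - nov_val (a i) \<le> -\<infinity>)"
      unfolding a(2) ext_level_lcomb[OF a(1)]
      using SUP_le_iff[of "\<lambda>i. \<l> (ws ! i) - nov_val (a i)" "{..<length ws}" "-\<infinity>"] by (simp add: Ball_def)
    also have "\<dots> \<longleftrightarrow> (\<forall>i<length ws. a i = \<zero>\<^bsub>S\<^esub>)"
    proof (intro all_cong1 imp_cong refl)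
      fix i assume "i < length ws"
      then obtain r where "\<l> (ws ! i) = ereal r" using real by blast
      then show "\<l> (ws ! i) - nov_val (a i) \<le> -\<infinity> \<longleftrightarrow> a i = \<zero>\<^bsub>S\<^esub>"
        using nov_val_eq_PInfty_iff[of "a i"] by (cases "nov_val (a i)") (auto simp: zero_novikov)
    qed
    also have "\<dots> \<longleftrightarrow> X = \<zero>\<^bsub>X.E\<^esub>"
    proof
      assume "\<forall>i<length ws. a i = \<zero>\<^bsub>S\<^esub>"
      then show "X = \<zero>\<^bsub>X.E\<^esub>" unfolding a(2) by (intro E.lcomb_zero emb_basis_subset) simp
    next
      assume "X = \<zero>\<^bsub>X.E\<^esub>"
      then have "lcomb X.E a (map X.emb ws) = lcomb X.E (\<lambda>_. \<zero>\<^bsub>S\<^esub>) (map X.emb ws)"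
        using E.lcomb_zero[OF emb_basis_subset, of "\<lambda>_. \<zero>\<^bsub>S\<^esub>"] a by simp
      then show "\<forall>i<length ws. a i = \<zero>\<^bsub>S\<^esub>" using emb_inject[OF a(1), of "\<lambda>_. \<zero>\<^bsub>S\<^esub>"] by simp
    qed
    finally show ?thesis .
  qed
  then have level0: "ext_level ws \<zero>\<^bsub>X.E\<^esub> = -\<infinity>" by simp
  show "ext_level ws (c \<odot>\<^bsub>X.E\<^esub> X) = ext_level ws X - nov_val c" if c: "c \<in> carrier S" and X: "X \<in> carrier X.E" for c X
  proof (cases "c = \<zero>\<^bsub>S\<^esub>")
    case True
    then have "c \<odot>\<^bsub>X.E\<^esub> X = \<zero>\<^bsub>X.E\<^esub>" using X by simp
    moreover have "nov_val c = \<infinity>" using True by (simp add: zero_novikov)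
    ultimately show ?thesis using fin[OF X] level0 by (cases "ext_level ws X") simp_all
  next
    case False
    then have "nov_val c \<noteq> \<infinity>" by (simp add: nov_val_eq_PInfty_iff zero_novikov)
    then obtain r where r: "nov_val c = ereal r" by (cases "nov_val c") auto
    obtain a where a: "a \<in> {..<length ws} \<rightarrow> carrier S" "X = lcomb X.E a (map X.emb ws)" using emb_cases[OF X] .
    have ca: "(\<lambda>i. c \<otimes>\<^bsub>S\<^esub> a i) \<in> {..<length ws} \<rightarrow> carrier S" using c a by auto
    have "c \<odot>\<^bsub>X.E\<^esub> X = lcomb X.E (\<lambda>i. c \<otimes>\<^bsub>S\<^esub> a i) (map X.emb ws)"
      using E.lcomb_smult[OF emb_basis_subset, of a c] a c by simp
    then have "ext_level ws (c \<odot>\<^bsub>X.E\<^esub> X) = (SUP i\<in>{..<length ws}. \<l> (ws ! i) - nov_val (c \<otimes>\<^bsub>S\<^esub> a i))"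
      using ext_level_lcomb[OF ca] by simp
    also have "\<dots> = (SUP i\<in>{..<length ws}. \<l> (ws ! i) - nov_val (a i)) - ereal r"
    proof -
      \<comment> \<open>The finite shift passes through the supremum by comparison of upper bounds
        \<open>z\<close>, which includes the empty list and terms of level
        \<open>-\<infinity>\<close>.\<close>
      have "\<l> (ws ! i) - nov_val (c \<otimes>\<^bsub>S\<^esub> a i) \<le> z \<longleftrightarrow> \<l> (ws ! i) - nov_val (a i) \<le> z + ereal r"
        if "i < length ws" for i z
      proof -
        obtain s where s: "\<l> (ws ! i) = ereal s" using real \<open>i < length ws\<close> by blast
        have "nov_val (c \<otimes>\<^bsub>S\<^esub> a i) = ereal r + nov_val (a i)"
          using c a that r by (auto simp: mult_novikov nov_val_convolution carrier_novikov_iff Pi_iff)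
        then show ?thesis using s by (cases "nov_val (a i)"; cases z) auto
      qed
      then have iff: "(SUP i\<in>{..<length ws}. \<l> (ws ! i) - nov_val (c \<otimes>\<^bsub>S\<^esub> a i)) \<le> z \<longleftrightarrow>
          (SUP i\<in>{..<length ws}. \<l> (ws ! i) - nov_val (a i)) - ereal r \<le> z" for z
        by (simp add: SUP_le_iff ereal_minus_le)
      show ?thesis by (rule order.antisym[OF iffD2[OF iff order.refl] iffD1[OF iff order.refl]])
    qed
    finally show ?thesis using a ext_level_lcomb[OF a(1)] r by simp
  qed
  show "ext_level ws (X \<oplus>\<^bsub>X.E\<^esub> Y) \<le> max (ext_level ws X) (ext_level ws Y)"
    if X: "X \<in> carrier X.E" and Y: "Y \<in> carrier X.E" for X Y
  proof -
    obtain a where a: "a \<in> {..<length ws} \<rightarrow> carrier S" "X = lcomb X.E a (map X.emb ws)" using emb_cases[OF X] .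
    obtain b where b: "b \<in> {..<length ws} \<rightarrow> carrier S" "Y = lcomb X.E b (map X.emb ws)" using emb_cases[OF Y] .
    have ab: "(\<lambda>i. a i \<oplus>\<^bsub>S\<^esub> b i) \<in> {..<length ws} \<rightarrow> carrier S" using a b by auto
    have eq: "X \<oplus>\<^bsub>X.E\<^esub> Y = lcomb X.E (\<lambda>i. a i \<oplus>\<^bsub>S\<^esub> b i) (map X.emb ws)"
      using E.lcomb_add[OF emb_basis_subset, of a b] a b by simp
    have lX: "\<l> (ws ! i) - nov_val (a i) \<le> ext_level ws X" if "i < length ws" for i
      unfolding a(2) ext_level_lcomb[OF a(1)] using that by (intro SUP_upper) simp
    have lY: "\<l> (ws ! i) - nov_val (b i) \<le> ext_level ws Y" if "i < length ws" for i
      unfolding b(2) ext_level_lcomb[OF b(1)] using that by (intro SUP_upper) simp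
    show ?thesis
      unfolding eq ext_level_lcomb[OF ab]
    proof (rule SUP_least)
      fix i assume "i \<in> {..<length ws}"
      then have i: "i < length ws" by simp
      have min: "min (nov_val (a i)) (nov_val (b i)) \<le> nov_val (a i \<oplus>\<^bsub>S\<^esub> b i)"
        unfolding add_novikov using a b i by (intro nov_val_add) (auto simp: carrier_novikov_iff Pi_iff)
      then consider "nov_val (a i) \<le> nov_val (a i \<oplus>\<^bsub>S\<^esub> b i)" | "nov_val (b i) \<le> nov_val (a i \<oplus>\<^bsub>S\<^esub> b i)"
        by (auto simp: min_le_iff_disj)
      then show "\<l> (ws ! i) - nov_val (a i \<oplus>\<^bsub>S\<^esub> b i) \<le> max (ext_level ws X) (ext_level ws Y)"
      proof cases
        case 1
        then show ?thesis using lX[OF i] ereal_minus_mono[OF order.refl 1, of "\<l> (ws ! i)"]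
          by (meson max.coboundedI1 order.trans)
      next
        case 2
        then show ?thesis using lY[OF i] ereal_minus_mono[OF order.refl 2, of "\<l> (ws ! i)"]
          by (meson max.coboundedI2 order.trans)
      qed
    qed
  qed
qed

lemma orthogonal_basis_ext_level: "orthogonal_basis \<Gamma>' X.E (ext_level ws) (map X.emb ws)"
proof -
  interpret L: nonarch_normed_space \<Gamma>' X.E "ext_level ws" by (rule nonarch_normed_space_ext_level)
  have "orthogonal \<Gamma>' X.E (ext_level ws) (map X.emb ws)"
    unfolding orthogonal_lcomb
  proof (intro conjI emb_basis_subset ballI)
    fix a assume "a \<in> {..<length (map X.emb ws)} \<rightarrow> carrier S"
    then have a: "a \<in> {..<length ws} \<rightarrow> carrier S" by simp
    have "ext_level ws (a i \<odot>\<^bsub>X.E\<^esub> (map X.emb ws ! i)) = \<l> (ws ! i) - nov_val (a i)" if i: "i < length ws" for i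
      using L.level_smult[of "a i" "map X.emb ws ! i"] ext_level_emb C.nth_in_carrier[OF basis_subset i] a i
      by (auto simp: Pi_iff simp del: X.tens_smult)
    then show "ext_level ws (lcomb X.E a (map X.emb ws)) =
        (SUP i\<in>{..<length (map X.emb ws)}. ext_level ws (a i \<odot>\<^bsub>X.E\<^esub> (map X.emb ws ! i)))"
      unfolding ext_level_lcomb[OF a] by (intro SUP_cong) auto
  qed
  moreover have "\<zero>\<^bsub>X.E\<^esub> \<notin> set (map X.emb ws)"
  proof
    assume "\<zero>\<^bsub>X.E\<^esub> \<in> set (map X.emb ws)"
    then obtain w where w: "w \<in> set ws" "X.emb w = \<zero>\<^bsub>X.E\<^esub>" by auto
    then have "w \<in> carrier C" using basis_subset by auto
    then have "\<l> w = -\<infinity>" using ext_level_emb[of w] w L.level_zero by simp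
    then have "w = \<zero>\<^bsub>C\<^esub>" using C.level_eq_MInfty_iff \<open>w \<in> carrier C\<close> by simp
    then show False using ob w by (simp add: C.orthogonal_basis_iff)
  qed
  moreover have "E.span (set (map X.emb ws)) = carrier X.E"
  proof
    show "E.span (set (map X.emb ws)) \<subseteq> carrier X.E" using emb_basis_subset by (rule E.span_is_subset2)
    show "carrier X.E \<subseteq> E.span (set (map X.emb ws))"
    proof
      fix X assume "X \<in> carrier X.E"
      then obtain a where "a \<in> {..<length ws} \<rightarrow> carrier S" "X = lcomb X.E a (map X.emb ws)" using emb_cases by blast
      then show "X \<in> E.span (set (map X.emb ws))" unfolding E.span_set_eq[OF emb_basis_subset] by auto
    qed
  qed
  ultimately show ?thesis by (simp only: L.orthogonal_basis_iff simp_thms)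
qed

end

text \<open>Expand \<open>X\<close> in the second basis. The level built from the first basis is a
  non-Archimedean norm that restricts to the original level, so it is bounded by the largest term,
  which is the level built from the second. By symmetry both levels agree.\<close>

lemma ext_level_le:
  assumes ob: "orthogonal_basis \<Gamma> C \<l> ws" and ob': "orthogonal_basis \<Gamma> C \<l> us" and X: "X \<in> carrier X.E"
  shows "ext_level ws X \<le> ext_level us X"
proof -
  interpret L: nonarch_normed_space \<Gamma>' X.E "ext_level ws" by (rule nonarch_normed_space_ext_level[OF ob])
  obtain a where a: "a \<in> {..<length us} \<rightarrow> carrier S" "X = lcomb X.E a (map X.emb us)" using emb_cases[OF ob' X] .
  show ?thesis
    unfolding a(2)
  proof (rule L.level_lcomb_le[OF emb_basis_subset[OF ob']])
    fix i assume "i < length (map X.emb us)"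
    then have i: "i < length us" by simp
    have u: "us ! i \<in> carrier C" using C.orthogonal_basis_nth[OF ob' i] by simp
    have "ext_level ws (a i \<odot>\<^bsub>X.E\<^esub> X.emb (us ! i)) = \<l> (us ! i) - nov_val (a i)"
      using L.level_smult[of "a i" "X.emb (us ! i)"] ext_level_emb[OF ob u] u a i
      by (auto simp: Pi_iff simp del: X.tens_smult)
    also have "\<dots> \<le> ext_level us (lcomb X.E a (map X.emb us))"
      unfolding ext_level_lcomb[OF ob' a(1)] using i by (intro SUP_upper) simp
    finally show "ext_level ws (a i \<odot>\<^bsub>X.E\<^esub> (map X.emb us ! i)) \<le> ext_level us (lcomb X.E a (map X.emb us))"
      using i by (simp del: X.tens_smult)
  qed (use a in auto)
qed

lemma extend_filt_eq_ext_level: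
  assumes ob: "orthogonal_basis \<Gamma> C \<l> us" and X: "X \<in> carrier X.E"
  shows "extend_filt \<Gamma> \<Gamma>' C \<l> X = ext_level us X"
proof -
  have ob': "orthogonal_basis \<Gamma> C \<l> (SOME ws. orthogonal_basis \<Gamma> C \<l> ws)" using ob by (rule someI)
  show ?thesis
    unfolding extend_filt_eq[OF ob] using ext_level_le[OF ob ob' X] ext_level_le[OF ob' ob X] by (rule order.antisym[rotated])
qed

lemma nonarch_normed_space_extend_filt:
  assumes ob: "orthogonal_basis \<Gamma> C \<l> us"
  shows "nonarch_normed_space \<Gamma>' X.E (extend_filt \<Gamma> \<Gamma>' C \<l>)"
  using nonarch_normed_space_ext_level[OF ob] extend_filt_eq_ext_level[OF ob]
  by (rule nonarch_normed_space_cong)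

lemma orthogonal_basis_extend_filt:
  assumes ob: "orthogonal_basis \<Gamma> C \<l> us"
  shows "orthogonal_basis \<Gamma>' X.E (extend_filt \<Gamma> \<Gamma>' C \<l>) (map X.emb us)"
  using nonarch_normed_space_ext_level[OF ob] extend_filt_eq_ext_level[OF ob] orthogonal_basis_ext_level[OF ob]
  by (rule orthogonal_basis_cong)

lemma extend_filt_emb:
  assumes ob: "orthogonal_basis \<Gamma> C \<l> us" and x: "x \<in> carrier C"
  shows "extend_filt \<Gamma> \<Gamma>' C \<l> (X.emb x) = \<l> x"
  using extend_filt_eq_ext_level[OF ob, of "X.emb x"] ext_level_emb[OF ob x] x by simp

end

section \<open>The barcode of the extended complex\<close>

text \<open>The part of an orthogonal basis that spans \<open>U\<close> may be exchanged for any
  orthogonal basis of \<open>U\<close>. The component in \<open>U\<close> of a combination is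
  rewritten in the old basis, where it cannot cancel against the rest; its level in turn bounds the
  terms in the new vectors.\<close>

lemma (in nonarch_normed_space) orthogonal_basis_append:
  assumes ob: "orthogonal_basis \<Gamma> C \<l> us" and U: "submodule K U C"
    and dr: "orthogonal_basis \<Gamma> (C\<lparr>carrier := U\<rparr>) \<l> (drop s us)"
    and xs: "orthogonal_basis \<Gamma> (C\<lparr>carrier := U\<rparr>) \<l> xs"
  shows "orthogonal_basis \<Gamma> C \<l> (take s us @ xs)"
proof -
  let ?tk = "take s us" and ?dr = "drop s us"
  have us: "set us \<subseteq> carrier C" and orth: "orthogonal \<Gamma> C \<l> us"
    using ob by (auto simp: orthogonal_basis_iff orthogonal_lcomb)
  have tk: "set ?tk \<subseteq> carrier C" and drC: "set ?dr \<subseteq> carrier C"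
    using us set_take_subset[of s us] set_drop_subset[of s us] by auto
  have orth_xs: "orthogonal \<Gamma> C \<l> xs" and nz_xs: "\<zero>\<^bsub>C\<^esub> \<notin> set xs" and sp_xs: "span (set xs) = U"
    using xs by (auto simp: orthogonal_basis_subspace_iff[OF U])
  have sp_dr: "span (set ?dr) = U" using dr by (auto simp: orthogonal_basis_subspace_iff[OF U])
  have xsC: "set xs \<subseteq> carrier C" using orth_xs by (simp add: orthogonal_lcomb)
  let ?ws = "?tk @ xs"
  have ws: "set ?ws \<subseteq> carrier C" using tk xsC by auto
  have "orthogonal \<Gamma> C \<l> ?ws"
    unfolding orthogonal_iff[OF ws]
  proof (intro ballI allI impI)
    fix a i assume "a \<in> {..<length ?ws} \<rightarrow> carrier K" and i: "i < length ?ws"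
    then have a: "a \<in> {..<length ?tk + length xs} \<rightarrow> carrier K" by simp
    let ?ax = "\<lambda>j. a (length ?tk + j)"
    have ax: "?ax \<in> {..<length xs} \<rightarrow> carrier K" using a by auto
    have eq: "lcomb C a ?ws = lcomb C a ?tk \<oplus>\<^bsub>C\<^esub> lcomb C ?ax xs" using tk xsC a by (rule lcomb_append)
    have "lcomb C ?ax xs \<in> span (set ?dr)"
      unfolding sp_dr sp_xs[symmetric] span_set_eq[OF xsC] using ax by blast
    then obtain b where b: "b \<in> {..<length ?dr} \<rightarrow> carrier K" "lcomb C ?ax xs = lcomb C b ?dr"
      by (rule span_set_cases[OF drC])
    let ?c = "\<lambda>j. if j < length ?tk then a j else b (j - length ?tk)"
    have c: "?c \<in> {..<length ?tk + length ?dr} \<rightarrow> carrier K" using a b by (auto simp: Pi_iff)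
    have len: "length ?tk + length ?dr = length us" by (metis append_take_drop_id length_append)
    have "lcomb C ?c (?tk @ ?dr) = lcomb C ?c ?tk \<oplus>\<^bsub>C\<^esub> lcomb C (\<lambda>j. ?c (length ?tk + j)) ?dr"
      using tk drC c by (rule lcomb_append)
    also have "lcomb C ?c ?tk = lcomb C a ?tk" using a by (intro lcomb_cong[OF tk]) (auto simp: Pi_iff)
    also have "lcomb C (\<lambda>j. ?c (length ?tk + j)) ?dr = lcomb C b ?dr" by (rule lcomb_cong[OF drC b(1)]) simp
    finally have eq': "lcomb C a ?ws = lcomb C ?c us" unfolding eq b(2) by (simp only: append_take_drop_id)
    have level_c: "\<l> (?c j \<odot>\<^bsub>C\<^esub> (us ! j)) \<le> \<l> (lcomb C a ?ws)" if "j < length us" for j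
      unfolding eq' using c that len by (intro orthogonal_le[OF orth]) auto
    show "\<l> (a i \<odot>\<^bsub>C\<^esub> (?ws ! i)) \<le> \<l> (lcomb C a ?ws)"
    proof (cases "i < length ?tk")
      case True
      then show ?thesis using level_c[of i] by (simp add: nth_append)
    next
      case False
      then obtain j where j: "i = length ?tk + j" "j < length xs"
        using i by (metis add_diff_inverse_nat length_append nat_add_left_cancel_less)
      have "\<l> (?ax j \<odot>\<^bsub>C\<^esub> (xs ! j)) \<le> \<l> (lcomb C b ?dr)"
        unfolding b(2)[symmetric] using orth_xs ax j(2) by (rule orthogonal_le)
      also have "\<dots> \<le> \<l> (lcomb C a ?ws)"
      proof (rule level_lcomb_le[OF drC b(1)])
        fix k assume "k < length ?dr"
        then show "\<l> (b k \<odot>\<^bsub>C\<^esub> (?dr ! k)) \<le> \<l> (lcomb C a ?ws)"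
          using level_c[of "length ?tk + k"] len by (simp split: if_splits)
      qed
      finally show ?thesis unfolding j(1) nth_append_length_plus .
    qed
  qed
  moreover have "\<zero>\<^bsub>C\<^esub> \<notin> set ?ws" using nz_xs orthogonal_basis_part(2)[OF ob, of s] by auto
  moreover have "span (set ?ws) = carrier C"
  proof
    have sub: "submodule K (span (set ?ws)) C" using ws by (rule span_is_submodule)
    have mem: "set ?ws \<subseteq> span (set ?ws)" using ws by (rule in_own_span)
    have "U \<subseteq> span (set ?ws)"
      unfolding sp_xs[symmetric] by (rule span_is_subset[OF _ sub]) (use mem in auto)
    moreover have "set ?dr \<subseteq> U" using in_own_span[OF drC] sp_dr by simp
    ultimately have "set ?tk \<union> set ?dr \<subseteq> span (set ?ws)" using mem by auto
    then have "set us \<subseteq> span (set ?ws)" by (metis append_take_drop_id set_append)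
    then have "span (set us) \<subseteq> span (set ?ws)" using ws by (rule span_mono_submodule)
    then show "carrier C \<subseteq> span (set ?ws)" using ob by (simp add: orthogonal_basis_iff)
    show "span (set ?ws) \<subseteq> carrier C" using ws by (rule span_is_subset2)
  qed
  ultimately show ?thesis by (simp only: orthogonal_basis_iff simp_thms)
qed

lemma mod_hom_restrict_codomain:
  assumes f: "mod_hom R M N f" and U: "submodule R U N" and sub: "f ` carrier M \<subseteq> U"
  shows "mod_hom R M (N\<lparr>carrier := U\<rparr>) f"
proof -
  interpret f: mod_hom R M N f by fact
  have "module R (N\<lparr>carrier := U\<rparr>)" using U by (rule f.N.submodule_is_module)
  moreover have "f \<in> module_hom R M (N\<lparr>carrier := U\<rparr>)"
    using sub by (auto simp: module_hom_def)
  moreover have "module R M" by unfold_locales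
  ultimately show ?thesis by (simp add: mod_hom_def mod_hom_axioms_def)
qed

text \<open>Resolves the definite description: the given decomposition is a witness once
  \<open>r\<close> is recognised as the rank, and \<open>barcode_unique\<close> excludes other
  values.\<close>

lemma verbose_barcode_eq:
  fixes F :: "('k::field, 'c) filtered_complex"
  assumes \<Gamma>: "subgroup \<Gamma> real_group"
    and lin: "nonarch_linear_map \<Gamma> (chains F (k + 1)) (filt F (k + 1)) (cycles F k) (filt F k) (bdry F (k + 1))"
    and svd: "nonarch_linear_map.svd_data \<Gamma> (chains F (k + 1)) (filt F (k + 1)) (cycles F k) (filt F k)
      (bdry F (k + 1)) r ys xs"
  shows "verbose_barcode \<Gamma> F k =
    mset (map (nonarch_linear_map.bar \<Gamma> (filt F (k + 1)) (filt F k) r ys xs) [0..<length xs])"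
proof -
  interpret B: nonarch_linear_map \<Gamma> "chains F (k + 1)" "filt F (k + 1)" "cycles F k" "filt F k" "bdry F (k + 1)"
    by fact
  let ?r = "rank_of \<Gamma> (chains F (k + 1)) (cycles F k) (bdry F (k + 1))"
  have bar: "svd_barcode \<Gamma> F k ys xs = mset (map (B.bar ?r ys xs) [0..<length xs])" for ys xs
    by (simp add: svd_barcode_def B.bar_def[abs_def] Let_def)
  have r: "?r = r" using svd by (rule B.rank_svd_data)
  show ?thesis
    unfolding verbose_barcode_def B.is_svd_iff
  proof (rule the_equality)
    show "\<exists>ys' xs'. B.svd_data ?r ys' xs' \<and>
        mset (map (B.bar r ys xs) [0..<length xs]) = svd_barcode \<Gamma> F k ys' xs'"
      using svd by (intro exI[of _ ys] exI[of _ xs]) (simp add: bar r)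
    fix b assume "\<exists>ys xs. B.svd_data ?r ys xs \<and> b = svd_barcode \<Gamma> F k ys xs"
    then obtain ys' xs' where "B.svd_data ?r ys' xs'" "b = svd_barcode \<Gamma> F k ys' xs'" by blast
    then show "b = mset (map (B.bar r ys xs) [0..<length xs])"
      unfolding bar using B.barcode_unique[OF \<Gamma> _ svd] by simp
  qed
qed

lemma coset_proj_coset:
  assumes \<Gamma>: "subgroup \<Gamma> real_group" and \<Gamma>': "subgroup \<Gamma>' real_group" and "\<Gamma> \<subseteq> \<Gamma>'"
  shows "coset_proj \<Gamma>' (\<Gamma> #>\<^bsub>real_group\<^esub> x) = \<Gamma>' #>\<^bsub>real_group\<^esub> x"
proof (intro Set.set_eqI iffI)
  fix z assume "z \<in> coset_proj \<Gamma>' (\<Gamma> #>\<^bsub>real_group\<^esub> x)"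
  then obtain h' h where "h' \<in> \<Gamma>'" "h \<in> \<Gamma>" "z = h' + (h + x)"
    by (auto simp: coset_proj_def set_mult_def coset_real_group)
  moreover from this have "h' + h \<in> \<Gamma>'" using subgroup_real_group_add[OF \<Gamma>'] assms(3) by blast
  ultimately show "z \<in> \<Gamma>' #>\<^bsub>real_group\<^esub> x"
    by (auto simp: coset_real_group intro!: exI[of _ "h' + h"])
next
  fix z assume "z \<in> \<Gamma>' #>\<^bsub>real_group\<^esub> x"
  then obtain h' where "h' \<in> \<Gamma>'" "z = h' + x" by (auto simp: coset_real_group)
  moreover have "x \<in> \<Gamma> #>\<^bsub>real_group\<^esub> x"
    using subgroup_real_group_zero[OF \<Gamma>] by (auto simp: coset_real_group intro!: exI[of _ 0])
  ultimately show "z \<in> coset_proj \<Gamma>' (\<Gamma> #>\<^bsub>real_group\<^esub> x)"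
    by (auto simp: coset_proj_def set_mult_def)
qed

lemma orthogonalizable_nonarch_extension:
  assumes "orthogonalizable \<Gamma> C \<l>" "subgroup \<Gamma>' real_group" "\<Gamma> \<subseteq> \<Gamma>'"
  shows "nonarch_extension \<Gamma> C \<l> \<Gamma>'"
  using assms by (auto simp: orthogonalizable_def nonarch_extension_def nonarch_extension_axioms_def)

text \<open>The two bases guarantee that the choice of a basis inside \<open>extend_filt\<close> is
  meaningful.\<close>

locale extended_linear_map =
  A: nonarch_linear_map \<Gamma> C \<l>C D \<l>D A + EC: nonarch_extension \<Gamma> C \<l>C \<Gamma>' + ED: nonarch_extension \<Gamma> D \<l>D \<Gamma>'
  for \<Gamma> :: "real set" and C :: "(real \<Rightarrow> 'k::field, 'c) module" and \<l>C :: "'c \<Rightarrow> ereal"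
    and D :: "(real \<Rightarrow> 'k, 'd) module" and \<l>D :: "'d \<Rightarrow> ereal" and A :: "'c \<Rightarrow> 'd" and \<Gamma>' :: "real set" +
  fixes ys\<^sub>0 xs\<^sub>0
  assumes source_basis: "orthogonal_basis \<Gamma> C \<l>C ys\<^sub>0" and target_basis: "orthogonal_basis \<Gamma> D \<l>D xs\<^sub>0"
begin

sublocale H: scalar_extension_hom "novikov \<Gamma>" C D "novikov \<Gamma>'" A
  by unfold_locales

abbreviation "\<l>C' \<equiv> extend_filt \<Gamma> \<Gamma>' C \<l>C"
abbreviation "\<l>D' \<equiv> extend_filt \<Gamma> \<Gamma>' D \<l>D"
abbreviation "A' \<equiv> extend_map (novikov \<Gamma>) (novikov \<Gamma>') D A"

sublocale A': nonarch_linear_map \<Gamma>' EC.X.E \<l>C' ED.X.E \<l>D' A'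
  by (intro nonarch_linear_map.intro linear_map.intro EC.nonarch_normed_space_extend_filt[OF source_basis]
      ED.nonarch_normed_space_extend_filt[OF target_basis] H.mod_hom_extend_map EC.E.vectorspace_axioms
      ED.E.vectorspace_axioms)

lemma extend_map_emb: "x \<in> carrier C \<Longrightarrow> A' (EC.X.emb x) = ED.X.emb (A x)"
  by (rule H.extend_map_tens) simp_all

text \<open>Every clause is an orthogonal basis, an equation for the images of basis vectors or a
  comparison of their levels, and \<open>emb\<close> preserves all three.\<close>

lemma svd_data_extend:
  assumes svd: "A.svd_data r ys xs"
  shows "A'.svd_data r (map EC.X.emb ys) (map ED.X.emb xs)"
  unfolding A'.svd_data_def
proof (intro conjI allI impI)
  have r: "r \<le> length ys" "r \<le> length xs" and ob: "orthogonal_basis \<Gamma> C \<l>C ys" "orthogonal_basis \<Gamma> D \<l>D xs"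
    using svd by (auto simp: A.svd_data_def)
  have y: "ys ! i \<in> carrier C" if "i < length ys" for i using A.C.orthogonal_basis_nth[OF ob(1) that] by simp
  have x: "xs ! i \<in> carrier D" if "i < length xs" for i using A.D.orthogonal_basis_nth[OF ob(2) that] by simp
  show "orthogonal_basis \<Gamma>' EC.X.E \<l>C' (map EC.X.emb ys)" using ob(1) by (rule EC.orthogonal_basis_extend_filt)
  show "orthogonal_basis \<Gamma>' ED.X.E \<l>D' (map ED.X.emb xs)" using ob(2) by (rule ED.orthogonal_basis_extend_filt)
  show "r \<le> length (map EC.X.emb ys)" "r \<le> length (map ED.X.emb xs)" using r by auto
  show "A' (map EC.X.emb ys ! i) = map ED.X.emb xs ! i" if "i < r" for i
    using that r svd y[of i] by (simp add: extend_map_emb A.svd_data_def)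
  show "A' (map EC.X.emb ys ! i) = \<zero>\<^bsub>ED.X.E\<^esub>" if "i < length (map EC.X.emb ys)" "r \<le> i" for i
    using that svd y[of i] by (simp add: extend_map_emb A.svd_data_def ED.X.tens_zero_left)
  show "\<l>C' (map EC.X.emb ys ! j) - \<l>D' (map ED.X.emb xs ! j) \<le>
      \<l>C' (map EC.X.emb ys ! i) - \<l>D' (map ED.X.emb xs ! i)" if "i \<le> j" "j < r" for i j
    using that r svd y x
    by (simp add: EC.extend_filt_emb[OF ob(1)] ED.extend_filt_emb[OF ob(2)] A.svd_data_def)
qed

end

theorem proposition6p8:
  fixes \<Gamma> \<Gamma>' :: "real set" and F :: "('k::field, 'c) filtered_complex" and k :: int
  assumes "subgroup \<Gamma> real_group" and "subgroup \<Gamma>' real_group" and "\<Gamma> \<subseteq> \<Gamma>'"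
    and "floer_complex \<Gamma> F"
  shows "verbose_barcode \<Gamma>' (extend_complex \<Gamma> \<Gamma>' F) k =
    image_mset (\<lambda>(X, L). (coset_proj \<Gamma>' X, L)) (verbose_barcode \<Gamma> F k)"
proof -
  interpret F: floer_complex \<Gamma> F by fact
  let ?F' = "extend_complex \<Gamma> \<Gamma>' F"
  have ext: "nonarch_extension \<Gamma> (chains F j) (filt F j) \<Gamma>'" for j
    using F.chains_orthogonalizable assms(2,3) by (rule orthogonalizable_nonarch_extension)
  have nn: "nonarch_normed_space \<Gamma> (chains F j) (filt F j)" for j
    using F.chains_orthogonalizable[of j] by (simp add: orthogonalizable_def)
  obtain ob where ob: "orthogonal_basis \<Gamma> (chains F j) (filt F j) (ob j)" for j
    using F.chains_orthogonalizable unfolding orthogonalizable_def by metis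
  have lin: "nonarch_linear_map \<Gamma> (chains F j) (filt F j) (chains F (j - 1)) (filt F (j - 1)) (bdry F j)" for j
    by (intro nonarch_linear_map.intro nn F.bdry_linear)
  have extl: "extended_linear_map \<Gamma> (chains F j) (filt F j) (chains F (j - 1)) (filt F (j - 1)) (bdry F j) \<Gamma>'
      (ob j) (ob (j - 1))" for j
    by (intro extended_linear_map.intro extended_linear_map_axioms.intro lin ext ob)
  interpret A: extended_linear_map \<Gamma> "chains F k" "filt F k" "chains F (k - 1)" "filt F (k - 1)" "bdry F k" \<Gamma>'
    "ob k" "ob (k - 1)" by (rule extl)
  interpret B: extended_linear_map \<Gamma> "chains F (k + 1)" "filt F (k + 1)" "chains F k" "filt F k"
    "bdry F (k + 1)" \<Gamma>' "ob (k + 1)" "ob k" using extl[of "k + 1"] by simp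
  let ?U = "A.A.A.ker" and ?U' = "A.A'.A.ker"
  have cyc: "cycles F k = (chains F k)\<lparr>carrier := ?U\<rparr>" by (simp add: cycles_def)
  have U: "submodule (novikov \<Gamma>) ?U (chains F k)" by (rule A.A.A.ker_is_submodule)
  have U': "submodule (novikov \<Gamma>') ?U' A.EC.X.E" by (rule A.A'.A.ker_is_submodule)
  have F': "chains ?F' j = extend_scalars (novikov \<Gamma>) (novikov \<Gamma>') (chains F j)"
    "filt ?F' j = extend_filt \<Gamma> \<Gamma>' (chains F j) (filt F j)"
    "bdry ?F' j = extend_map (novikov \<Gamma>) (novikov \<Gamma>') (chains F (j - 1)) (bdry F j)" for j
    by (simp_all add: extend_complex_def)
  have cyc': "cycles ?F' k = A.EC.X.E\<lparr>carrier := ?U'\<rparr>" by (simp add: cycles_def F')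
  have bb: "bdry F k (bdry F (k + 1) x) = \<zero>\<^bsub>chains F (k - 1)\<^esub>" if "x \<in> carrier (chains F (k + 1))" for x
    using F.bdry_bdry[OF that] by simp
  have linB: "nonarch_linear_map \<Gamma> (chains F (k + 1)) (filt F (k + 1)) (cycles F k) (filt F k) (bdry F (k + 1))"
    unfolding cyc
  proof (intro nonarch_linear_map.intro linear_map.intro nn A.A.C.nonarch_normed_space_subspace[OF U]
      mod_hom_restrict_codomain[OF B.A.A.mod_hom_axioms U])
    show "bdry F (k + 1) ` carrier (chains F (k + 1)) \<subseteq> ?U"
      using bb B.A.A.f_im by (auto simp: A.A.A.ker_def)
    show "vectorspace (novikov \<Gamma>) (chains F (k + 1))" by (rule B.A.C.vectorspace_axioms)
    show "vectorspace (novikov \<Gamma>) (chains F k\<lparr>carrier := ?U\<rparr>)"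
      using A.A.C.nonarch_normed_space_subspace[OF U] by (rule nonarch_normed_space.axioms(1))
  qed
  interpret BZ: nonarch_linear_map \<Gamma> "chains F (k + 1)" "filt F (k + 1)" "cycles F k" "filt F k" "bdry F (k + 1)"
    by (rule linB)
  have linB': "nonarch_linear_map \<Gamma>' (chains ?F' (k + 1)) (filt ?F' (k + 1)) (cycles ?F' k) (filt ?F' k) (bdry ?F' (k + 1))"
    unfolding cyc' F' add_diff_cancel_right'
  proof (intro nonarch_linear_map.intro linear_map.intro A.A'.C.nonarch_normed_space_subspace[OF U']
      mod_hom_restrict_codomain[OF B.A'.A.mod_hom_axioms U'] B.A'.C.nonarch_normed_space_axioms)
    show "B.A' ` carrier B.EC.X.E \<subseteq> ?U'"
    proof
      fix Y assume "Y \<in> B.A' ` carrier B.EC.X.E"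
      then obtain X where X: "X \<in> carrier B.EC.X.E" "Y = B.A' X" by blast
      \<comment> \<open>That consecutive extended boundary maps compose to zero is checked on
        elementary tensors.\<close>
      from X(1) have "A.A' (B.A' X) = \<zero>\<^bsub>A.ED.X.E\<^esub>"
      proof (induction X rule: B.EC.X.tensor_induct)
        case (tens x a)
        then show ?case by (simp add: B.H.extend_map_tens A.H.extend_map_tens bb A.ED.X.tens_zero_left)
      next
        case (add X Y)
        then show ?case using B.H.extend_map_closed
          by (simp add: B.H.extend_map_add A.H.extend_map_add)
      qed (simp add: B.H.extend_map_zero A.H.extend_map_zero)
      then show "Y \<in> ?U'" using X B.H.extend_map_closed by (simp add: A.A'.A.ker_def)
    qed
    show "vectorspace (novikov \<Gamma>') B.EC.X.E" by (rule B.EC.E.vectorspace_axioms)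
    show "vectorspace (novikov \<Gamma>') (A.EC.X.E\<lparr>carrier := ?U'\<rparr>)"
      using A.A'.C.nonarch_normed_space_subspace[OF U'] by (rule nonarch_normed_space.axioms(1))
  qed
  interpret BZ': nonarch_linear_map \<Gamma>' "chains ?F' (k + 1)" "filt ?F' (k + 1)" "cycles ?F' k" "filt ?F' k"
    "bdry ?F' (k + 1)" by (rule linB')
  \<comment> \<open>Decomposing the boundary map out of degree \<open>k\<close> produces, as the
    tail of \<open>us\<close>, an orthogonal basis of the cycles; the second decomposition, of the
    map into the cycles, starts from it.\<close>
  obtain s us vs where A_svd: "A.A.svd_data s us vs"
    using A.A.svd_data_exists[OF ob ob] .
  then have s: "s \<le> length us" and ob_us: "orthogonal_basis \<Gamma> (chains F k) (filt F k) us"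
    by (auto simp: A.A.svd_data_def)
  have drop_us: "orthogonal_basis \<Gamma> (cycles F k) (filt F k) (drop s us)"
    unfolding cyc A.A.C.orthogonal_basis_subspace_iff[OF U]
    using A.A.C.orthogonal_basis_part[OF ob_us] A.A.svd_data_ker[OF A_svd] by simp
  obtain r ys xs where B_svd: "BZ.svd_data r ys xs" using BZ.svd_data_exists[OF ob drop_us] .
  then have r: "r \<le> length ys" "r \<le> length xs" and ob_ys: "orthogonal_basis \<Gamma> (chains F (k + 1)) (filt F (k + 1)) ys"
    and ob_xs: "orthogonal_basis \<Gamma> (cycles F k) (filt F k) xs" by (auto simp: BZ.svd_data_def)
  have ys: "ys ! i \<in> carrier (chains F (k + 1))" if "i < length ys" for i
    using B.A.C.orthogonal_basis_nth[OF ob_ys that] by simp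
  have xsU: "set xs \<subseteq> ?U" using BZ.D.orthogonal_basis_carrier[OF ob_xs] by (simp add: cyc)
  then have xs: "xs ! i \<in> ?U" if "i < length xs" for i using nth_mem[OF that] by blast
  have xsC: "xs ! i \<in> carrier (chains F k)" if "i < length xs" for i
    using xs[OF that] by (simp add: A.A.A.ker_def)
  \<comment> \<open>The second decomposition changes the basis of the cycles. The exchange puts
    \<open>xs\<close> in place of the tail, so that the first decomposition now has
    \<open>xs\<close> as its kernel part.\<close>
  let ?zs = "take s us @ xs"
  have "A.A.svd_data s ?zs vs"
    unfolding A.A.svd_data_def
  proof (intro conjI allI impI)
    show "orthogonal_basis \<Gamma> (chains F k) (filt F k) ?zs"
      using ob_us U drop_us[unfolded cyc] ob_xs[unfolded cyc] by (rule A.A.C.orthogonal_basis_append)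
    show "bdry F k (?zs ! i) = \<zero>\<^bsub>chains F (k - 1)\<^esub>" if "i < length ?zs" "s \<le> i" for i
      using xs[of "i - s"] that s by (auto simp: nth_append A.A.A.ker_def)
  qed (use A_svd s in \<open>auto simp: A.A.svd_data_def nth_append\<close>)
  then have A'_svd: "A.A'.svd_data s (map A.EC.X.emb ?zs) (map A.ED.X.emb vs)" by (rule A.svd_data_extend)
  \<comment> \<open>The kernel of the extended map is spanned by the tail of the extended
    decomposition, that is by the vectors \<open>x \<otimes> 1\<close> with \<open>x\<close> in
    \<open>xs\<close>. This determines the cycles of the extended complex inside the extended
    chains.\<close>
  have ob_xs': "orthogonal_basis \<Gamma>' (cycles ?F' k) (filt ?F' k) (map A.EC.X.emb xs)"
  proof -
    have "orthogonal_basis \<Gamma>' A.EC.X.E A.\<l>C' (map A.EC.X.emb ?zs)" using A'_svd by (simp add: A.A'.svd_data_def)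
    moreover have "drop s (map A.EC.X.emb ?zs) = map A.EC.X.emb xs" using s by (simp add: drop_map)
    ultimately show ?thesis
      unfolding cyc' F' A.A'.C.orthogonal_basis_subspace_iff[OF U']
      using A.A'.C.orthogonal_basis_part(3,4)[of "map A.EC.X.emb ?zs" s] A.A'.svd_data_ker[OF A'_svd] by simp
  qed
  have filt_ys: "filt ?F' (k + 1) (B.EC.X.emb (ys ! i)) = filt F (k + 1) (ys ! i)" if "i < length ys" for i
    unfolding F' using B.EC.extend_filt_emb[OF ob_ys ys[OF that]] .
  have filt_xs: "filt ?F' k (A.EC.X.emb (xs ! i)) = filt F k (xs ! i)" if "i < length xs" for i
    unfolding F' using A.EC.extend_filt_emb[OF ob xsC[OF that]] .
  have bdry_ys: "bdry ?F' (k + 1) (B.EC.X.emb (ys ! i)) = A.EC.X.emb (bdry F (k + 1) (ys ! i))" if "i < length ys" for i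
    unfolding F' add_diff_cancel_right' using B.extend_map_emb[OF ys[OF that]] .
  have B'_svd: "BZ'.svd_data r (map B.EC.X.emb ys) (map A.EC.X.emb xs)"
    unfolding BZ'.svd_data_def
  proof (intro conjI allI impI ob_xs')
    show "orthogonal_basis \<Gamma>' (chains ?F' (k + 1)) (filt ?F' (k + 1)) (map B.EC.X.emb ys)"
      unfolding F' using ob_ys by (rule B.EC.orthogonal_basis_extend_filt)
    show "r \<le> length (map B.EC.X.emb ys)" "r \<le> length (map A.EC.X.emb xs)" using r by auto
    show "bdry ?F' (k + 1) (map B.EC.X.emb ys ! i) = map A.EC.X.emb xs ! i" if "i < r" for i
      using that r B_svd by (simp add: bdry_ys BZ.svd_data_def)
    show "bdry ?F' (k + 1) (map B.EC.X.emb ys ! i) = \<zero>\<^bsub>cycles ?F' k\<^esub>" if "i < length (map B.EC.X.emb ys)" "r \<le> i" for i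
    proof -
      have "bdry F (k + 1) (ys ! i) = \<zero>\<^bsub>cycles F k\<^esub>" using that B_svd by (simp add: BZ.svd_data_def)
      then show ?thesis using that by (simp add: bdry_ys cyc cyc' A.EC.X.tens_zero_left)
    qed
    show "filt ?F' (k + 1) (map B.EC.X.emb ys ! j) - filt ?F' k (map A.EC.X.emb xs ! j) \<le>
        filt ?F' (k + 1) (map B.EC.X.emb ys ! i) - filt ?F' k (map A.EC.X.emb xs ! i)" if "i \<le> j" "j < r" for i j
      using that r B_svd by (simp add: filt_ys filt_xs BZ.svd_data_def)
  qed
  \<comment> \<open>Levels, and hence lengths, are unchanged by \<open>emb\<close>; only the group
    whose cosets are formed is larger.\<close>
  have "BZ'.bar r (map B.EC.X.emb ys) (map A.EC.X.emb xs) i =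
      (\<lambda>(X, L). (coset_proj \<Gamma>' X, L)) (BZ.bar r ys xs i)" if "i < length xs" for i
    using that r by (simp add: BZ.bar_def BZ'.bar_def filt_ys filt_xs coset_proj_coset[OF assms(1-3)])
  then show ?thesis
    unfolding verbose_barcode_eq[OF assms(1) linB B_svd] verbose_barcode_eq[OF assms(2) linB' B'_svd]
    by (simp flip: mset_map) (intro arg_cong[of _ _ mset], simp)
qed

end
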